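(* Let $(M,L)$ be a Finsler spacetime of dimension $4$ and let $f$ be a smooth function defined on an open subset $\mathscr U\subseteq M$ which admits a gradient $\nabla f$ on $\mathscr U$. If $N:=\nabla f$ is a lightlike vector field, then there exist coordinates $(x^0,x^1,x^2,x^3)$ about any point in $\mathscr U$ in which the metric $g_N$ has components $g_{ij}(N)=g_N(\partial_i,\partial_j)$ of the form $$(g_{ij}(N))=\begin{pmatrix}0&1&0&0\\ 1&g_{11}(N)&g_{12}(N)&g_{13}(N)\\ 0&g_{21}(N)&h_{22}&h_{23}\\ 0&g_{31}(N)&h_{32}&h_{33}\end{pmatrix},$$ with $(h_{ij})_{i,j=2,3}$ a positive-definite $2\times2$ matrix.
   Context: Finsler spacetime: $M$ is a connected smooth manifold, $\pi\colon TM\to M$ its tangent bundle. $A\subset TM\setminus\mathbf 0$ is a connected open subset which is conic ($\lambda v\in A$ for all $v\in A$, $\lambda>0$), has smooth boundary, and is such that $A_p=A\cap T_pM\neq\emptyset$ for all $p\in M$; $\bar A$ is its closure in $TM\setminus\mathbf 0$ and $\bar A_p=\bar A\cap T_pM$. The pair $(M,L)$ is a Finsler spacetime if $L\colon\bar A\to[0,\infty)$ is smooth, positively homogeneous of degree $2$ on each $\bar A_p$, its fundamental tensor $$g_v(u,w)=\frac12\left.\frac{\partial^2}{\partial s\,\partial t}L(v+tu+sw)\right|_{t=s=0},\qquad v\in\bar A,\ u,w\in T_{\pi(v)}M,$$ has signature $(+,-,\dots,-)$, and the boundary of $\bar A$ in $TM\setminus\mathbf 0$ coincides with the lightcone $\mathcal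 C=L^{-1}(0)$. Gradient: $f\colon\mathscr U\to\mathbb R$ admits a gradient $\nabla f$ if there is a vector field $\nabla f$ on $\mathscr U$ with values in $\bar A$ such that $g_{\nabla f}(\nabla f,X)=df(X)$ for all vector fields $X$ on $\mathscr U$. A vector field $N$ with values in $\bar A$ (hence nowhere vanishing) is lightlike if $L(N)=0$. $g_N$ denotes the pseudo-Riemannian metric on $\mathscr U$ obtained by evaluating the fundamental tensor $g_v$ at $v=N$.
   Formalization: The block (h_ij), i,j=2,3, is proved negative definite (that is, −h is positive definite): with signature (+,−,−,−) and the displayed zero and one entries, a positive-definite h is impossible, as Minkowski space with f = t − x shows. *)

theory Defs
  imports "HOL-Analysis.Analysis"
begin

section \<open>Smooth functions between normed spaces\<close>

text \<open>Only used for open sets \<open>S\<close>.\<close>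

primrec Ck_on :: "nat \<Rightarrow> 'a::real_normed_vector set \<Rightarrow> ('a \<Rightarrow> 'b::real_normed_vector) \<Rightarrow> bool" where
  "Ck_on 0 S f \<longleftrightarrow> continuous_on S f"
| "Ck_on (Suc k) S f \<longleftrightarrow> (\<forall>x\<in>S. f differentiable (at x)) \<and>
     (\<forall>v. Ck_on k S (\<lambda>x. frechet_derivative f (at x) v))"

definition smooth_on :: "'a::real_normed_vector set \<Rightarrow> ('a \<Rightarrow> 'b::real_normed_vector) \<Rightarrow> bool" where
  "smooth_on S f \<longleftrightarrow> (\<forall>k. Ck_on k S f)"


section \<open>Smooth manifolds\<close>

text \<open>
  The manifold is the whole type \<open>'m\<close>, of dimension \<open>CARD('n)\<close>. A chart is a pair of its domain
  and a map that is only relevant on that domain.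
\<close>

type_synonym ('m, 'n) chart = "'m set \<times> ('m \<Rightarrow> real ^ 'n)"

definition chart_inv :: "('m, 'n::finite) chart \<Rightarrow> real ^ 'n \<Rightarrow> 'm" where
  "chart_inv c = inv_into (fst c) (snd c)"

definition is_chart :: "('m::topological_space, 'n::finite) chart \<Rightarrow> bool" where
  "is_chart c \<longleftrightarrow> open (fst c) \<and> open (snd c ` fst c) \<and>
     homeomorphism (fst c) (snd c ` fst c) (snd c) (chart_inv c)"

definition transition :: "('m, 'n::finite) chart \<Rightarrow> ('m, 'n) chart \<Rightarrow> real ^ 'n \<Rightarrow> real ^ 'n" where
  "transition c d = snd d \<circ> chart_inv c"

definition compatible :: "('m, 'n::finite) chart \<Rightarrow> ('m, 'n) chart \<Rightarrow> bool" where
  "compatible c d \<longleftrightarrow>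
     smooth_on (snd c ` (fst c \<inter> fst d)) (transition c d) \<and>
     smooth_on (snd d ` (fst c \<inter> fst d)) (transition d c)"

text \<open>The atlas is maximal, so local coordinates are exactly its members.\<close>

definition smooth_structure :: "('m::topological_space, 'n::finite) chart set \<Rightarrow> bool" where
  "smooth_structure atl \<longleftrightarrow>
     (\<forall>c\<in>atl. is_chart c) \<and> (\<Union>c\<in>atl. fst c) = UNIV \<and>
     (\<forall>c\<in>atl. \<forall>d\<in>atl. compatible c d) \<and>
     (\<forall>c. is_chart c \<and> (\<forall>d\<in>atl. compatible c d) \<longrightarrow> c \<in> atl)"

definition smooth_fun :: "('m, 'n::finite) chart set \<Rightarrow> 'm set \<Rightarrow> ('m \<Rightarrow> real) \<Rightarrow> bool" where
  "smooth_fun atl U f \<longleftrightarrow> (\<forall>c\<in>atl. smooth_on (snd c ` (fst c \<inter> U)) (f \<circ> chart_inv c))"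


section \<open>The tangent bundle\<close>

text \<open>
  A tangent vector at \<open>p\<close> is the family of its components in all charts around \<open>p\<close>, which transform
  by the derivatives of the transition maps. The family is \<open>0\<close> at all other charts, so that
  the vector space operations are pointwise and the zero vector is the zero family.
\<close>

type_synonym ('m, 'n) tvec = "('m, 'n) chart \<Rightarrow> real ^ 'n"

definition tangent_space :: "('m, 'n::finite) chart set \<Rightarrow> 'm \<Rightarrow> ('m, 'n) tvec set" where
  "tangent_space atl p = {u.
     (\<forall>c. \<not> (c \<in> atl \<and> p \<in> fst c) \<longrightarrow> u c = 0) \<and>
     (\<forall>c\<in>atl. \<forall>d\<in>atl. p \<in> fst c \<and> p \<in> fst d \<longrightarrow>
        u d = frechet_derivative (transition c d) (at (snd c p)) (u c))}"

text \<open>The tangent vector at \<open>p\<close> whose components in the chart \<open>c\<close> are \<open>\<xi>\<close>.\<close>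

definition vec_of_comps ::
  "('m, 'n::finite) chart set \<Rightarrow> ('m, 'n) chart \<Rightarrow> 'm \<Rightarrow> real ^ 'n \<Rightarrow> ('m, 'n) tvec" where
  "vec_of_comps atl c p \<xi> = (\<lambda>d. if d \<in> atl \<and> p \<in> fst d
     then frechet_derivative (transition c d) (at (snd c p)) \<xi> else 0)"

definition coord_vec ::
  "('m, 'n::finite) chart set \<Rightarrow> ('m, 'n) chart \<Rightarrow> 'n \<Rightarrow> 'm \<Rightarrow> ('m, 'n) tvec" where
  "coord_vec atl c i p = vec_of_comps atl c p (axis i 1)"

definition tangent_bundle :: "('m, 'n::finite) chart set \<Rightarrow> ('m \<times> ('m, 'n) tvec) set" where
  "tangent_bundle atl = (SIGMA p:UNIV. tangent_space atl p)"

definition slit_bundle :: "('m, 'n::finite) chart set \<Rightarrow> ('m \<times> ('m, 'n) tvec) set" where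
  "slit_bundle atl = {v \<in> tangent_bundle atl. snd v \<noteq> (\<lambda>_. 0)}"

text \<open>
  The inverse of the bundle chart induced by \<open>c\<close>, and the image of a set under that bundle chart.
\<close>

definition bundle_param ::
  "('m, 'n::finite) chart set \<Rightarrow> ('m, 'n) chart \<Rightarrow> (real ^ 'n) \<times> (real ^ 'n) \<Rightarrow> 'm \<times> ('m, 'n) tvec" where
  "bundle_param atl c z = (chart_inv c (fst z), vec_of_comps atl c (chart_inv c (fst z)) (snd z))"

definition bundle_coords ::
  "('m, 'n::finite) chart set \<Rightarrow> ('m, 'n) chart \<Rightarrow> ('m \<times> ('m, 'n) tvec) set
     \<Rightarrow> ((real ^ 'n) \<times> (real ^ 'n)) set" where
  "bundle_coords atl c W = {z. fst z \<in> snd c ` fst c \<and> bundle_param atl c z \<in> W}"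

definition tangent_topology :: "('m, 'n::finite) chart set \<Rightarrow> ('m \<times> ('m, 'n) tvec) topology" where
  "tangent_topology atl =
     topology (\<lambda>W. W \<subseteq> tangent_bundle atl \<and> (\<forall>c\<in>atl. open (bundle_coords atl c W)))"

lemma openin_tangent_topology:
  "openin (tangent_topology atl) W \<longleftrightarrow>
     W \<subseteq> tangent_bundle atl \<and> (\<forall>c\<in>atl. open (bundle_coords atl c W))"
proof -
  have Int: "bundle_coords atl c (S \<inter> T) = bundle_coords atl c S \<inter> bundle_coords atl c T" for c S T
    by (auto simp: bundle_coords_def)
  have Un: "bundle_coords atl c (\<Union>K) = (\<Union>S\<in>K. bundle_coords atl c S)" for c K
    by (auto simp: bundle_coords_def)
  have "istopology (\<lambda>W. W \<subseteq> tangent_bundle atl \<and> (\<forall>c\<in>atl. open (bundle_coords atl c W)))"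
    unfolding istopology_def Int Un by (blast intro: open_Int open_UN)
  then show ?thesis
    by (simp add: tangent_topology_def topology_inverse')
qed

definition slit_topology :: "('m, 'n::finite) chart set \<Rightarrow> ('m \<times> ('m, 'n) tvec) topology" where
  "slit_topology atl = subtopology (tangent_topology atl) (slit_bundle atl)"

definition smooth_on_bundle ::
  "('m, 'n::finite) chart set \<Rightarrow> ('m \<times> ('m, 'n) tvec) set \<Rightarrow> ('m \<times> ('m, 'n) tvec \<Rightarrow> real) \<Rightarrow> bool" where
  "smooth_on_bundle atl W F \<longleftrightarrow>
     (\<forall>c\<in>atl. smooth_on (bundle_coords atl c W) (F \<circ> bundle_param atl c))"

definition vector_field ::
  "('m, 'n::finite) chart set \<Rightarrow> 'm set \<Rightarrow> ('m \<Rightarrow> ('m, 'n) tvec) \<Rightarrow> bool" where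
  "vector_field atl U X \<longleftrightarrow> (\<forall>p\<in>U. X p \<in> tangent_space atl p) \<and>
     (\<forall>c\<in>atl. smooth_on (snd c ` (fst c \<inter> U)) (\<lambda>x. X (chart_inv c x) c))"

text \<open>By the transformation law, the value does not depend on the chosen chart.\<close>

definition differential ::
  "('m, 'n::finite) chart set \<Rightarrow> ('m \<Rightarrow> real) \<Rightarrow> 'm \<Rightarrow> ('m, 'n) tvec \<Rightarrow> real" where
  "differential atl f p u = (let c = (SOME c. c \<in> atl \<and> p \<in> fst c)
     in frechet_derivative (f \<circ> chart_inv c) (at (snd c p)) (u c))"


section \<open>Finsler spacetimes\<close>

text \<open>The closure of \<open>A\<close> is taken in the tangent bundle without the zero section.\<close>

definition cone_closure ::
  "('m, 'n::finite) chart set \<Rightarrow> ('m \<times> ('m, 'n) tvec) set \<Rightarrow> ('m \<times> ('m, 'n) tvec) set" where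
  "cone_closure atl A = slit_topology atl closure_of A"

text \<open>Near each boundary point, \<open>A\<close> is the positivity set of a function with nonzero differential.\<close>

definition smooth_boundary ::
  "('m, 'n::finite) chart set \<Rightarrow> ('m \<times> ('m, 'n) tvec) set \<Rightarrow> bool" where
  "smooth_boundary atl A \<longleftrightarrow> (\<forall>v \<in> slit_topology atl frontier_of A.
     \<exists>W \<rho>. openin (slit_topology atl) W \<and> v \<in> W \<and> smooth_on_bundle atl W \<rho> \<and>
       A \<inter> W = {w\<in>W. 0 < \<rho> w} \<and> \<rho> v = 0 \<and>
       (\<exists>c\<in>atl. fst v \<in> fst c \<and>
          frechet_derivative (\<rho> \<circ> bundle_param atl c) (at (snd c (fst v), snd v c)) \<noteq> (\<lambda>_. 0)))"

definition cone_domain ::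
  "('m, 'n::finite) chart set \<Rightarrow> ('m \<times> ('m, 'n) tvec) set \<Rightarrow> bool" where
  "cone_domain atl A \<longleftrightarrow>
     openin (slit_topology atl) A \<and> connectedin (slit_topology atl) A \<and>
     (\<forall>p u. \<forall>r>0. (p, u) \<in> A \<longrightarrow> (p, \<lambda>c. r *\<^sub>R u c) \<in> A) \<and>
     smooth_boundary atl A \<and>
     (\<forall>p. \<exists>u. (p, u) \<in> A)"

text \<open>
  A function on the closure of \<open>A\<close>, a manifold with boundary, is smooth if it has a smooth extension
  around each point.
\<close>

definition local_extension ::
  "('m, 'n::finite) chart set \<Rightarrow> ('m \<times> ('m, 'n) tvec) set \<Rightarrow> ('m \<times> ('m, 'n) tvec \<Rightarrow> real)
     \<Rightarrow> 'm \<times> ('m, 'n) tvec \<Rightarrow> ('m \<times> ('m, 'n) tvec \<Rightarrow> real) \<Rightarrow> bool" where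
  "local_extension atl A L v F \<longleftrightarrow>
     (\<exists>W. openin (slit_topology atl) W \<and> v \<in> W \<and> smooth_on_bundle atl W F \<and>
        (\<forall>w \<in> W \<inter> cone_closure atl A. F w = L w))"

text \<open>
  At a boundary point \<open>v\<close> of the cone, \<open>v + t u + s w\<close> may leave the domain of \<open>L\<close>, so the derivatives
  are those of a local smooth extension. They do not depend on the extension: they are determined
  on the open set \<open>A\<close>, hence by continuity on its closure.
\<close>

definition fundamental_tensor ::
  "('m, 'n::finite) chart set \<Rightarrow> ('m \<times> ('m, 'n) tvec) set \<Rightarrow> ('m \<times> ('m, 'n) tvec \<Rightarrow> real)
     \<Rightarrow> 'm \<times> ('m, 'n) tvec \<Rightarrow> ('m, 'n) tvec \<Rightarrow> ('m, 'n) tvec \<Rightarrow> real" where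
  "fundamental_tensor atl A L v u w = (let F = (SOME F. local_extension atl A L v F) in
     (1 / 2) * deriv (\<lambda>s. deriv (\<lambda>t. F (fst v, \<lambda>c. snd v c + t *\<^sub>R u c + s *\<^sub>R w c)) 0) 0)"

text \<open>Signature \<open>(+, -, \<dots>, -)\<close>: \<open>i0\<close> is the index of the plus sign.\<close>

definition lorentz_signature ::
  "('m, 'n::finite) chart set \<Rightarrow> 'm \<Rightarrow> (('m, 'n) tvec \<Rightarrow> ('m, 'n) tvec \<Rightarrow> real) \<Rightarrow> bool" where
  "lorentz_signature atl p B \<longleftrightarrow> (\<exists>(e :: 'n \<Rightarrow> ('m, 'n) tvec) i0.
     (\<forall>i. e i \<in> tangent_space atl p) \<and>
     (\<forall>u \<in> tangent_space atl p. \<exists>!a :: 'n \<Rightarrow> real. u = (\<lambda>c. \<Sum>i\<in>UNIV. a i *\<^sub>R e i c)) \<and>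
     (\<forall>i j. B (e i) (e j) = (if i = j then if i = i0 then 1 else - 1 else 0)))"

definition finsler_spacetime ::
  "('m::{t2_space, second_countable_topology}, 'n::finite) chart set
     \<Rightarrow> ('m \<times> ('m, 'n) tvec) set \<Rightarrow> ('m \<times> ('m, 'n) tvec \<Rightarrow> real) \<Rightarrow> bool" where
  "finsler_spacetime atl A L \<longleftrightarrow>
     smooth_structure atl \<and> connected (UNIV :: 'm set) \<and> cone_domain atl A \<and>
     (\<forall>v \<in> cone_closure atl A. 0 \<le> L v) \<and>
     (\<forall>v \<in> cone_closure atl A. \<exists>F. local_extension atl A L v F) \<and>
     (\<forall>p u. \<forall>r>0. (p, u) \<in> cone_closure atl A \<longrightarrow> L (p, \<lambda>c. r *\<^sub>R u c) = r\<^sup>2 * L (p, u)) \<and>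
     (\<forall>v \<in> cone_closure atl A. lorentz_signature atl (fst v) (fundamental_tensor atl A L v)) \<and>
     slit_topology atl frontier_of (cone_closure atl A) = {v \<in> cone_closure atl A. L v = 0}"

definition is_gradient ::
  "('m, 'n::finite) chart set \<Rightarrow> ('m \<times> ('m, 'n) tvec) set \<Rightarrow> ('m \<times> ('m, 'n) tvec \<Rightarrow> real)
     \<Rightarrow> 'm set \<Rightarrow> ('m \<Rightarrow> real) \<Rightarrow> ('m \<Rightarrow> ('m, 'n) tvec) \<Rightarrow> bool" where
  "is_gradient atl A L U f N \<longleftrightarrow>
     vector_field atl U N \<and> (\<forall>p\<in>U. (p, N p) \<in> cone_closure atl A) \<and>
     (\<forall>X. vector_field atl U X \<longrightarrow>
        (\<forall>p\<in>U. fundamental_tensor atl A L (p, N p) (N p) (X p) = differential atl f p (X p)))"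

definition lightlike_field ::
  "('m, 'n::finite) chart set \<Rightarrow> ('m \<times> ('m, 'n) tvec) set \<Rightarrow> ('m \<times> ('m, 'n) tvec \<Rightarrow> real)
     \<Rightarrow> 'm set \<Rightarrow> ('m \<Rightarrow> ('m, 'n) tvec) \<Rightarrow> bool" where
  "lightlike_field atl A L U N \<longleftrightarrow>
     vector_field atl U N \<and> (\<forall>p\<in>U. (p, N p) \<in> cone_closure atl A \<and> L (p, N p) = 0)"

text \<open>The components \<open>g\<^sub>N(\<partial>\<^sub>i, \<partial>\<^sub>j)\<close> in the chart \<open>c\<close>.\<close>

definition metric_component ::
  "('m, 'n::finite) chart set \<Rightarrow> ('m \<times> ('m, 'n) tvec) set \<Rightarrow> ('m \<times> ('m, 'n) tvec \<Rightarrow> real)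
     \<Rightarrow> ('m \<Rightarrow> ('m, 'n) tvec) \<Rightarrow> ('m, 'n) chart \<Rightarrow> 'm \<Rightarrow> 'n \<Rightarrow> 'n \<Rightarrow> real" where
  "metric_component atl A L N c q i j =
     fundamental_tensor atl A L (q, N q) (coord_vec atl c i q) (coord_vec atl c j q)"

definition positive_definite_on :: "'i set \<Rightarrow> ('i \<Rightarrow> 'i \<Rightarrow> real) \<Rightarrow> bool" where
  "positive_definite_on I h \<longleftrightarrow> (\<forall>i\<in>I. \<forall>j\<in>I. h i j = h j i) \<and>
     (\<forall>a. (\<exists>i\<in>I. a i \<noteq> 0) \<longrightarrow> 0 < (\<Sum>i\<in>I. \<Sum>j\<in>I. a i * h i j * a j))"

end

theory Submission
  imports Defs
begin

text \<open>
  In a chart, let \<open>\<phi>\<close> be the local flow of \<open>N\<close>. Euler's relation gives \<open>g\<^sub>N(N, N) = L(N) = 0\<close>, hence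
  \<open>df(N) = 0\<close>. Following the flow out of a transversal hyperplane gives coordinates
  \<open>(y\<^sup>0, \<dots>, y\<^sup>3)\<close> with \<open>N = \<partial>/\<partial>y\<^sup>0\<close>; since \<open>df \<noteq> 0\<close>, some \<open>y\<^sup>j\<close> with \<open>j \<noteq> 0\<close> can be exchanged for \<open>f\<close>. In the
  resulting chart \<open>\<partial>\<^sub>0 = N\<close> and \<open>x\<^sup>1 = f\<close>, so \<open>g\<^sub>N(\<partial>\<^sub>0, \<partial>\<^sub>j) = df(\<partial>\<^sub>j) = \<delta>\<^sub>1\<^sub>j\<close>, and \<open>\<partial>\<^sub>2, \<partial>\<^sub>3\<close> span
  a complement of the null vector \<open>N\<close> in \<open>ker df = N\<^sup>\<bottom>\<close>, on which a Lorentzian form is negative definite.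

  Smoothness of the flow is proved by induction on the order of differentiability: a directional
  derivative of the flow with respect to the initial point solves a linear equation with parameters,
  whose coefficients are as often differentiable as the flow is already known to be.
\<close>

section \<open>Calculus of \<open>C\<^sup>k\<close> functions\<close>

text \<open>Differentiating a flow in its initial point produces an equation with time- and
  parameter-dependent coefficients and a parameter-dependent initial value. The induction therefore
  runs over this larger class. The class is stable because linearizing keeps the time interval and
  the Lipschitz constant, so one smallness condition \<open>a * K \<le> 1 / 2\<close>, fixed at the
  start, serves every order of differentiability. Null vectors lie on the boundary of the cone,
  where the metric is defined by derivatives of an extension of \<open>L\<close> whose values off
  the closure are not prescribed. Only the ray through \<open>N\<close> is used: it stays in the
  closure of the conic set \<open>A\<close>, the extension vanishes along it near \<open>N\<close>,
  and two radial derivatives give \<open>g(N, N) = 0\<close>. The gradient equation is posed for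
  vector fields, so bump functions are needed to apply it to single tangent vectors; with
  \<open>N \<noteq> 0\<close> and nondegeneracy it yields \<open>df \<noteq> 0\<close>. Exchanging a
  coordinate for \<open>f\<close> does not spoil the straightened form of \<open>N\<close>, because
  \<open>f\<close> is constant along the flow lines of \<open>N\<close>.\<close>

lemma Ck_on_cong:
  assumes "open S" "\<And>x. x \<in> S \<Longrightarrow> f x = g x"
  shows "Ck_on k S f \<longleftrightarrow> Ck_on k S g"
proof -
  have "Ck_on k S g" if "Ck_on k S f" "\<And>x. x \<in> S \<Longrightarrow> f x = g x" for f g :: "'a \<Rightarrow> 'b"
    using that
  proof (induction k arbitrary: f g)
    case 0
    then show ?case using continuous_on_cong[of S S f g] by simp
  next
    case (Suc k)
    have d: "(g has_derivative frechet_derivative f (at x)) (at x)" if "x \<in> S" for x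
    proof (rule has_derivative_transform_within_open[of f])
      show "(f has_derivative frechet_derivative f (at x)) (at x)"
        using Suc.prems that frechet_derivative_works by auto
    qed (use assms Suc that in auto)
    have e: "frechet_derivative g (at x) = frechet_derivative f (at x)" if "x \<in> S" for x
      using frechet_derivative_at[OF d[OF that]] by simp
    have "Ck_on k S (\<lambda>x. frechet_derivative g (at x) v)" for v
      by (rule Suc.IH[of "\<lambda>x. frechet_derivative f (at x) v"]) (use Suc e in auto)
    then show ?case using d by (auto simp: differentiable_def)
  qed
  from this[of f g] this[of g f] show ?thesis using assms(2) by auto
qed

lemma Ck_on_congI: "Ck_on k S g \<Longrightarrow> open S \<Longrightarrow> (\<And>x. x \<in> S \<Longrightarrow> f x = g x) \<Longrightarrow> Ck_on k S f"
  using Ck_on_cong by blast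

lemma Ck_on_SucI:
  assumes "open S" "\<And>x. x \<in> S \<Longrightarrow> (f has_derivative f' x) (at x)"
    and "\<And>v. Ck_on k S (\<lambda>x. f' x v)"
  shows "Ck_on (Suc k) S f"
proof -
  have "frechet_derivative f (at x) = f' x" if "x \<in> S" for x
    using frechet_derivative_at[OF assms(2)[OF that]] by simp
  then have "Ck_on k S (\<lambda>x. frechet_derivative f (at x) v)" for v
    using Ck_on_cong[OF assms(1), of "\<lambda>x. frechet_derivative f (at x) v" "\<lambda>x. f' x v"] assms(3)
    by simp
  then show ?thesis using assms(2) by (auto simp: differentiable_def)
qed

lemma Ck_on_SucD:
  assumes "Ck_on (Suc k) S f" "x \<in> S"
  shows "(f has_derivative frechet_derivative f (at x)) (at x)"
  using assms frechet_derivative_works by auto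

lemma Ck_on_Suc_imp: "Ck_on (Suc k) S f \<Longrightarrow> Ck_on k S f"
proof (induction k arbitrary: f)
  case 0
  then show ?case
    by (simp add: continuous_at_imp_continuous_on differentiable_imp_continuous_within)
qed auto

lemma Ck_on_mono: "Ck_on k S f \<Longrightarrow> j \<le> k \<Longrightarrow> Ck_on j S f"
proof (induction k)
  case (Suc k)
  then show ?case using Ck_on_Suc_imp by (metis le_Suc_eq)
qed simp

lemma Ck_on_imp_continuous_on: "Ck_on k S f \<Longrightarrow> continuous_on S f"
  by (induction k) (use Ck_on_Suc_imp in \<open>auto simp del: Ck_on.simps(2)\<close>)

lemma Ck_on_subset: "Ck_on k S f \<Longrightarrow> T \<subseteq> S \<Longrightarrow> Ck_on k T f"
  by (induction k arbitrary: f) (auto intro: continuous_on_subset)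

lemma Ck_on_local:
  assumes "\<And>x. x \<in> S \<Longrightarrow> \<exists>T. open T \<and> x \<in> T \<and> Ck_on k T f"
  shows "Ck_on k S f"
  using assms
proof (induction k arbitrary: f)
  case 0
  then show ?case
    by (metis Ck_on.simps(1) continuous_at_imp_continuous_on continuous_on_eq_continuous_at)
next
  case (Suc k)
  have "Ck_on k S (\<lambda>x. frechet_derivative f (at x) v)" for v
  proof (rule Suc.IH)
    fix x assume "x \<in> S"
    from Suc.prems[OF this] obtain T where "open T" "x \<in> T" "Ck_on (Suc k) T f" by blast
    then show "\<exists>T. open T \<and> x \<in> T \<and> Ck_on k T (\<lambda>x. frechet_derivative f (at x) v)"
      by auto
  qed
  moreover have "f differentiable (at x)" if "x \<in> S" for x
    using Suc.prems[OF that] by auto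
  ultimately show ?case by simp
qed

lemma Ck_on_const [simp]: "Ck_on k S (\<lambda>x. c)"
proof (induction k arbitrary: c)
  case (Suc k)
  then show ?case by auto
qed auto

lemma Ck_on_bounded_linear:
  assumes "bounded_linear h" "Ck_on k S f" "open S"
  shows "Ck_on k S (\<lambda>x. h (f x))"
  using assms(2)
proof (induction k arbitrary: f)
  case 0
  then show ?case using assms(1) by (auto intro: bounded_linear.continuous_on)
next
  case (Suc k)
  show ?case
  proof (rule Ck_on_SucI[OF assms(3)])
    fix x assume "x \<in> S"
    from bounded_linear.has_derivative[OF assms(1) Ck_on_SucD[OF Suc.prems this]]
    show "((\<lambda>x. h (f x)) has_derivative (\<lambda>v. h (frechet_derivative f (at x) v))) (at x)" .
  next
    show "Ck_on k S (\<lambda>x. h (frechet_derivative f (at x) v))" for v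
      by (rule Suc.IH) (use Suc.prems in simp)
  qed
qed

lemma Ck_on_ident: "open S \<Longrightarrow> Ck_on k S (\<lambda>x. x)"
proof (cases k)
  case (Suc j)
  assume "open S"
  then show ?thesis unfolding Suc
    by (rule Ck_on_SucI[where f'="\<lambda>x v. v"]) (auto intro: has_derivative_ident)
qed auto

lemma Ck_on_linear: "bounded_linear h \<Longrightarrow> open S \<Longrightarrow> Ck_on k S h"
  using Ck_on_bounded_linear[of h k S "\<lambda>x. x"] Ck_on_ident[of S k] by auto

lemma Ck_on_add:
  assumes "Ck_on k S f" "Ck_on k S g" "open S"
  shows "Ck_on k S (\<lambda>x. f x + g x)"
  using assms(1,2)
proof (induction k arbitrary: f g)
  case 0
  then show ?case by (auto intro: continuous_on_add)
next
  case (Suc k)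
  show ?case
  proof (rule Ck_on_SucI[OF assms(3)])
    fix x assume "x \<in> S"
    from has_derivative_add[OF Ck_on_SucD[OF Suc.prems(1) this] Ck_on_SucD[OF Suc.prems(2) this]]
    show "((\<lambda>x. f x + g x) has_derivative
      (\<lambda>v. frechet_derivative f (at x) v + frechet_derivative g (at x) v)) (at x)" .
  next
    show "Ck_on k S (\<lambda>x. frechet_derivative f (at x) v + frechet_derivative g (at x) v)" for v
      by (rule Suc.IH) (use Suc.prems in simp_all)
  qed
qed

lemma Ck_on_sum:
  assumes "\<And>i. i \<in> I \<Longrightarrow> Ck_on k S (f i)" "open S"
  shows "Ck_on k S (\<lambda>x. \<Sum>i\<in>I. f i x)"
  using assms by (induction I rule: infinite_finite_induct) (simp_all add: Ck_on_add)

lemma Ck_on_Pair: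
  assumes "Ck_on k S f" "Ck_on k S g" "open S"
  shows "Ck_on k S (\<lambda>x. (f x, g x))"
proof -
  have "Ck_on k S (\<lambda>x. (f x, 0) + (0, g x))"
    by (intro Ck_on_add Ck_on_bounded_linear[of "\<lambda>y. (y, 0)"] Ck_on_bounded_linear[of "\<lambda>y. (0, y)"]
        assms) (auto intro: bounded_linear_Pair bounded_linear_ident bounded_linear_zero)
  then show ?thesis by simp
qed

lemma Ck_on_bilinear:
  assumes "bounded_bilinear h" "Ck_on k S f" "Ck_on k S g" "open S"
  shows "Ck_on k S (\<lambda>x. h (f x) (g x))"
  using assms(2,3)
proof (induction k arbitrary: f g)
  case 0
  then show ?case using assms(1) by (auto intro: bounded_bilinear.continuous_on)
next
  case (Suc k)
  show ?case
  proof (rule Ck_on_SucI[OF assms(4)])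
    fix x assume "x \<in> S"
    from bounded_bilinear.FDERIV[OF assms(1) Ck_on_SucD[OF Suc.prems(1) this]
        Ck_on_SucD[OF Suc.prems(2) this]]
    show "((\<lambda>x. h (f x) (g x)) has_derivative
      (\<lambda>v. h (f x) (frechet_derivative g (at x) v) + h (frechet_derivative f (at x) v) (g x))) (at x)" .
  next
    show "Ck_on k S (\<lambda>x. h (f x) (frechet_derivative g (at x) v) +
      h (frechet_derivative f (at x) v) (g x))" for v
    proof -
      have "Ck_on k S f" "Ck_on k S g" using Suc.prems Ck_on_Suc_imp by blast+
      moreover have "Ck_on k S (\<lambda>x. frechet_derivative f (at x) v)"
        "Ck_on k S (\<lambda>x. frechet_derivative g (at x) v)"
        using Suc.prems by auto
      ultimately show ?thesis by (intro Ck_on_add Suc.IH assms(4))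
    qed
  qed
qed

lemmas Ck_on_scaleR = Ck_on_bilinear[OF bounded_bilinear_scaleR]
lemmas Ck_on_mult = Ck_on_bilinear[OF bounded_bilinear_mult]
lemmas Ck_on_inner = Ck_on_bilinear[OF bounded_bilinear_inner]

lemma linear_eq_sum_Basis:
  fixes h :: "'a::euclidean_space \<Rightarrow> 'b::real_vector"
  assumes "linear h"
  shows "h v = (\<Sum>b\<in>Basis. (v \<bullet> b) *\<^sub>R h b)"
proof -
  have "h v = h (\<Sum>b\<in>Basis. (v \<bullet> b) *\<^sub>R b)" by (simp add: euclidean_representation)
  also have "\<dots> = (\<Sum>b\<in>Basis. (v \<bullet> b) *\<^sub>R h b)"
    using assms by (simp add: linear_sum linear_cmul)
  finally show ?thesis .
qed

lemma Ck_on_Suc_linear_frechet: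
  assumes "Ck_on (Suc k) S f" "x \<in> S"
  shows "linear (frechet_derivative f (at x))"
  using Ck_on_SucD[OF assms] has_derivative_linear by blast

text \<open>\<open>Ck_on\<close> differentiates in fixed directions, whereas the chain rule
  evaluates the derivative of \<open>g\<close> in a direction that moves with \<open>x\<close>.
  Expanding this direction over \<open>Basis\<close> leaves fixed directions with scalar
  coefficients, to which the induction hypothesis applies; hence the Euclidean middle space.\<close>

lemma Ck_on_compose:
  fixes f :: "'a::real_normed_vector \<Rightarrow> 'b::euclidean_space"
    and g :: "'b \<Rightarrow> 'c::real_normed_vector"
  assumes "Ck_on k T g" "Ck_on k S f" "f ` S \<subseteq> T" "open S"
  shows "Ck_on k S (\<lambda>x. g (f x))"
  using assms(1,2)
proof (induction k arbitrary: g)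
  case 0
  then show ?case using assms(3) by (auto intro: continuous_on_compose2)
next
  case (Suc k)
  show ?case
  proof (rule Ck_on_SucI[OF assms(4)])
    fix x assume x: "x \<in> S"
    then have fx: "f x \<in> T" using assms(3) by auto
    have "((\<lambda>x. g (f x)) has_derivative
      (\<lambda>v. frechet_derivative g (at (f x)) (frechet_derivative f (at x) v))) (at x)"
      using diff_chain_at[OF Ck_on_SucD[OF Suc.prems(2) x] Ck_on_SucD[OF Suc.prems(1) fx]]
      by (simp add: o_def)
    then show "((\<lambda>x. g (f x)) has_derivative (\<lambda>v. \<Sum>b\<in>Basis.
        (frechet_derivative f (at x) v \<bullet> b) *\<^sub>R frechet_derivative g (at (f x)) b)) (at x)"
      by (subst (asm) linear_eq_sum_Basis[OF Ck_on_Suc_linear_frechet[OF Suc.prems(1) fx]])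
  next
    have "Ck_on k S f" using Suc.prems(2) Ck_on_Suc_imp by blast
    then show "Ck_on k S (\<lambda>x. \<Sum>b\<in>Basis.
        (frechet_derivative f (at x) v \<bullet> b) *\<^sub>R frechet_derivative g (at (f x)) b)" for v
      by (intro Ck_on_sum Ck_on_scaleR Ck_on_inner assms(4) Suc.IH) (use Suc.prems in simp_all)
  qed
qed

text \<open>The expansion over \<open>Basis\<close> again, now for a moving base point and a moving
  direction: the form in which derivatives occur in variational equations and transformation
  laws.\<close>

lemma Ck_on_dir_deriv:
  fixes f :: "'b::euclidean_space \<Rightarrow> 'c::real_normed_vector"
  assumes "Ck_on (Suc k) T f" "Ck_on k S g" "Ck_on k S h" "g ` S \<subseteq> T" "open S"
  shows "Ck_on k S (\<lambda>x. frechet_derivative f (at (g x)) (h x))"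
proof -
  have "Ck_on k S (\<lambda>x. \<Sum>b\<in>Basis. (h x \<bullet> b) *\<^sub>R frechet_derivative f (at (g x)) b)"
    by (intro Ck_on_sum Ck_on_scaleR Ck_on_inner Ck_on_compose[OF _ assms(2,4,5)] Ck_on_const assms(3,5))
      (use assms(1) in simp)
  moreover have "frechet_derivative f (at (g x)) (h x) =
      (\<Sum>b\<in>Basis. (h x \<bullet> b) *\<^sub>R frechet_derivative f (at (g x)) b)" if "x \<in> S" for x
    by (rule linear_eq_sum_Basis[OF Ck_on_Suc_linear_frechet[OF assms(1)]]) (use that assms in auto)
  ultimately show ?thesis by (rule Ck_on_congI[OF _ assms(5)])
qed

lemma Ck_on_inverse:
  fixes f :: "'a::real_normed_vector \<Rightarrow> real"
  assumes "Ck_on k S f" "open S" "\<And>x. x \<in> S \<Longrightarrow> f x \<noteq> 0"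
  shows "Ck_on k S (\<lambda>x. inverse (f x))"
  using assms(1)
proof (induction k)
  case 0
  then show ?case using assms(3) by (auto intro: continuous_on_inverse)
next
  case (Suc k)
  show ?case
  proof (rule Ck_on_SucI[OF assms(2)])
    fix x assume x: "x \<in> S"
    show "((\<lambda>x. inverse (f x)) has_derivative
      (\<lambda>v. - (inverse (f x) * frechet_derivative f (at x) v * inverse (f x)))) (at x)"
      by (rule Deriv.has_derivative_inverse[OF assms(3)[OF x] Ck_on_SucD[OF Suc.prems x]])
  next
    show "Ck_on k S (\<lambda>x. - (inverse (f x) * frechet_derivative f (at x) v * inverse (f x)))" for v
      by (rule Ck_on_bounded_linear[OF bounded_linear_minus[OF bounded_linear_ident]],
          intro Ck_on_mult Suc.IH Ck_on_Suc_imp[OF Suc.prems] assms(2)) (use Suc.prems assms(2) in auto)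
  qed
qed

lemma Ck_on_prod:
  fixes f :: "'i \<Rightarrow> 'a::real_normed_vector \<Rightarrow> real"
  assumes "\<And>i. i \<in> I \<Longrightarrow> Ck_on k S (f i)" "open S"
  shows "Ck_on k S (\<lambda>x. \<Prod>i\<in>I. f i x)"
  using assms by (induction I rule: infinite_finite_induct) (simp_all add: Ck_on_mult)

lemma Ck_on_vec_lambda:
  fixes f :: "'n::finite \<Rightarrow> 'a::real_normed_vector \<Rightarrow> real"
  assumes "\<And>i. Ck_on k S (f i)" "open S"
  shows "Ck_on k S (\<lambda>x. \<chi> i. f i x)"
proof -
  have "(\<chi> i. f i x) = (\<Sum>i\<in>UNIV. f i x *\<^sub>R axis i 1)" for x
    by (simp add: vec_eq_iff axis_def if_distrib cong: if_cong)
  then show ?thesis by (simp only:) (intro Ck_on_sum Ck_on_scaleR assms Ck_on_const)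
qed

lemma Ck_on_vec_nth:
  assumes "Ck_on k S f" "open S"
  shows "Ck_on k S (\<lambda>x. f x $ i :: real)"
  by (rule Ck_on_bounded_linear[OF bounded_linear_vec_nth]) (use assms in auto)

lemma Ck_on_det:
  fixes M :: "'a::real_normed_vector \<Rightarrow> real ^ 'n::finite ^ 'n"
  assumes "\<And>i j. Ck_on k S (\<lambda>x. M x $ i $ j)" "open S"
  shows "Ck_on k S (\<lambda>x. det (M x))"
  unfolding det_def using assms by (intro Ck_on_sum Ck_on_mult Ck_on_prod Ck_on_const) auto

text \<open>By Cramer's rule each component of \<open>z\<close> is a quotient of determinants in the
  entries of \<open>M x\<close>, and injectivity keeps the denominator away from zero.\<close>

lemma Ck_on_linear_solve:
  fixes M :: "'a::real_normed_vector \<Rightarrow> real ^ 'n::finite \<Rightarrow> real ^ 'n"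
  assumes "\<And>v. Ck_on k S (\<lambda>x. M x v)" "open S"
    and lin: "\<And>x. x \<in> S \<Longrightarrow> linear (M x)" and inj: "\<And>x. x \<in> S \<Longrightarrow> inj (M x)"
    and eq: "\<And>x. x \<in> S \<Longrightarrow> M x (z x) = b"
  shows "Ck_on k S z"
proof -
  define A where "A x = matrix (M x)" for x
  have A: "Ck_on k S (\<lambda>x. A x $ i $ j)" for i j
    unfolding A_def matrix_def
    using Ck_on_vec_nth[OF assms(1)[of "axis j 1"] assms(2), of i] by simp
  have M: "M x v = A x *v v" if "x \<in> S" for x v
    using fun_cong[OF matrix_vector_mul(2)[OF lin[OF that]], of v] by (simp add: A_def)
  have det: "det (A x) \<noteq> 0" if "x \<in> S" for x
    unfolding A_def using det_nz_iff_inj[OF lin[OF that]] inj[OF that] by blast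
  have z: "z x = (\<chi> m. det (\<chi> i j. if j = m then b $ i else A x $ i $ j) * inverse (det (A x)))"
    if "x \<in> S" for x
    unfolding divide_inverse[symmetric]
    by (rule cramer[OF det[OF that], of "z x" b, THEN iffD1])
      (simp only: M[OF that, symmetric] eq[OF that])
  have A': "Ck_on k S (\<lambda>x. (\<chi> i j. if j = m then b $ i else A x $ i $ j) $ i $ j)" for m i j
    by (cases "j = m") (simp_all add: A)
  have "Ck_on k S (\<lambda>x. \<chi> m. det (\<chi> i j. if j = m then b $ i else A x $ i $ j) * inverse (det (A x)))"
    by (intro Ck_on_vec_lambda Ck_on_mult Ck_on_det Ck_on_inverse assms(2) A A' det)
  then show ?thesis by (rule Ck_on_congI[OF _ assms(2) z])
qed

section \<open>Derivatives as bounded operators, and the smooth inverse function theorem\<close>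

lemma blinfun_apply_frechet:
  assumes "(f has_derivative f') (at x)"
  shows "blinfun_apply (Blinfun (frechet_derivative f (at x))) = frechet_derivative f (at x)"
proof -
  have "bounded_linear (frechet_derivative f (at x))"
    unfolding frechet_derivative_at[OF assms, symmetric] by (rule has_derivative_bounded_linear[OF assms])
  then show ?thesis by (rule bounded_linear_Blinfun_apply)
qed

text \<open>Finitely many basis directions determine the operator, so continuity in each direction
  gives continuity in operator norm, the form needed for compactness arguments and for
  inversion.\<close>

lemma continuous_on_blinfun_frechet:
  fixes f :: "'a::euclidean_space \<Rightarrow> 'b::real_normed_vector"
  assumes "Ck_on (Suc k) S f"
  shows "continuous_on S (\<lambda>x. Blinfun (frechet_derivative f (at x)))"
proof (rule continuous_on_blinfun_componentwise)
  fix i :: 'a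
  have "Ck_on k S (\<lambda>x. frechet_derivative f (at x) i)" using assms by simp
  then have "continuous_on S (\<lambda>x. frechet_derivative f (at x) i)"
    by (rule Ck_on_imp_continuous_on)
  then show "continuous_on S (\<lambda>x. blinfun_apply (Blinfun (frechet_derivative f (at x))) i)"
    by (rule continuous_on_eq) (simp add: blinfun_apply_frechet[OF Ck_on_SucD[OF assms]])
qed

text \<open>The inverse function theorem gives a differentiable \<open>G\<close> whose derivative
  inverts that of \<open>F\<close> at \<open>G y\<close>. If \<open>G\<close> is C^k, then so is
  this inverse by \<open>Ck_on_linear_solve\<close>, which makes \<open>G\<close> of class
  C^(k+1).\<close>

lemma smooth_inverse_function:
  fixes F :: "real ^ 'n::finite \<Rightarrow> real ^ 'n"
  assumes "open S" "smooth_on S F" "x0 \<in> S" "inj (frechet_derivative F (at x0))"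
  obtains P Q G where "open P" "P \<subseteq> S" "x0 \<in> P" "open Q" "homeomorphism P Q F G" "smooth_on Q G"
    "\<And>y. y \<in> Q \<Longrightarrow> bij (frechet_derivative F (at (G y)))"
    "\<And>y. y \<in> Q \<Longrightarrow> (G has_derivative inv (frechet_derivative F (at (G y)))) (at y)"
proof -
  define D where "D x = Blinfun (frechet_derivative F (at x))" for x
  have Ck: "Ck_on k S F" for k using assms(2) by (simp add: smooth_on_def)
  note derF = Ck_on_SucD[OF Ck]
  have D: "blinfun_apply (D x) = frechet_derivative F (at x)" if "x \<in> S" for x
    unfolding D_def using blinfun_apply_frechet[OF derF[OF that]] .
  have lin: "linear (frechet_derivative F (at x0))" using derF[OF assms(3)] has_derivative_linear by blast
  obtain g where g: "linear g" "g \<circ> frechet_derivative F (at x0) = id"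
    using linear_injective_left_inverse[OF lin assms(4)] by auto
  have blg: "bounded_linear g" using g(1) linear_conv_bounded_linear by blast
  have inv: "Blinfun g o\<^sub>L D x0 = id_blinfun"
    by (rule blinfun_eqI)
       (use g(2) in \<open>auto simp: bounded_linear_Blinfun_apply[OF blg] D[OF assms(3)] o_def fun_eq_iff\<close>)
  have der: "(F has_derivative blinfun_apply (D x)) (at x)" if "x \<in> S" for x
    using derF[OF that] D[OF that] by simp
  have cont: "continuous_on S D"
    unfolding D_def by (rule continuous_on_blinfun_frechet[OF Ck])
  obtain P Q G G' where *: "open P" "P \<subseteq> S" "x0 \<in> P" "open Q" "F x0 \<in> Q" "homeomorphism P Q F G"
    "\<And>y. y \<in> Q \<Longrightarrow> (G has_derivative (G' y)) (at y)"
    "\<And>y. y \<in> Q \<Longrightarrow> G' y = inv (blinfun_apply (D (G y)))"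
    "\<And>y. y \<in> Q \<Longrightarrow> bij (blinfun_apply (D (G y)))"
    by (rule inverse_function_theorem[OF assms(1) der cont assms(3) inv], assumption, rule that, assumption+)
  have GS: "G y \<in> S" if "y \<in> Q" for y using *(2,6) that by (auto simp: homeomorphism_def)
  have bij: "bij (frechet_derivative F (at (G y)))" if "y \<in> Q" for y
    using *(9)[OF that] D[OF GS[OF that]] by simp
  have derG: "(G has_derivative inv (frechet_derivative F (at (G y)))) (at y)" if "y \<in> Q" for y
    using *(7,8)[OF that] D[OF GS[OF that]] by simp
  have "Ck_on k Q G" for k
  proof (induction k)
    case 0
    then show ?case using *(6) by (simp add: homeomorphism_def)
  next
    case (Suc k)
    show ?case
    proof (rule Ck_on_SucI[OF *(4) derG])
      fix v
      show "Ck_on k Q (\<lambda>y. inv (frechet_derivative F (at (G y))) v)"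
      proof (rule Ck_on_linear_solve[where M="\<lambda>y. frechet_derivative F (at (G y))" and b=v])
        show "Ck_on k Q (\<lambda>y. frechet_derivative F (at (G y)) w)" for w
          by (rule Ck_on_dir_deriv[OF Ck Suc]) (use GS *(4) in auto)
        show "linear (frechet_derivative F (at (G y)))" if "y \<in> Q" for y
          using derF[OF GS[OF that]] has_derivative_linear by blast
      qed (use bij *(4) in \<open>auto simp: bij_def surj_f_inv_f\<close>)
    qed
  qed
  then have "smooth_on Q G" by (simp add: smooth_on_def)
  from that[OF *(1,2,3,4,6) this bij derG] show ?thesis by blast
qed

section \<open>Ordinary differential equations with parameters\<close>

lemma vector_derivative_bound:
  fixes w :: "real \<Rightarrow> 'e::real_normed_vector"
  assumes "convex I" "\<And>s. s \<in> I \<Longrightarrow> (w has_vector_derivative w' s) (at s within I)"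
    and "\<And>s. s \<in> I \<Longrightarrow> norm (w' s) \<le> B" "x \<in> I" "y \<in> I"
  shows "norm (w x - w y) \<le> B * \<bar>x - y\<bar>"
proof -
  have "0 \<le> B" using assms(3)[OF assms(4)] norm_ge_zero order_trans by blast
  have "norm (w x - w y) \<le> B * norm (x - y)"
  proof (rule differentiable_bound[OF assms(1) _ _ assms(4,5)])
    show "(w has_derivative (\<lambda>h. h *\<^sub>R w' s)) (at s within I)" if "s \<in> I" for s
      using assms(2)[OF that] by (simp add: has_vector_derivative_def)
    show "onorm (\<lambda>h. h *\<^sub>R w' s) \<le> B" if "s \<in> I" for s
      by (rule onorm_bound[OF \<open>0 \<le> B\<close>])
        (use assms(3)[OF that] in \<open>simp add: mult.commute[of B] mult_left_mono\<close>)
  qed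
  then show ?thesis by simp
qed

text \<open>On a short interval this replaces the Gronwall inequality: evaluate at the point where
  \<open>norm w\<close> is maximal.\<close>

lemma short_time_estimate:
  fixes w :: "real \<Rightarrow> 'e::real_normed_vector"
  assumes der: "\<And>s. \<bar>s\<bar> \<le> b \<Longrightarrow> (w has_vector_derivative w' s) (at s within {-b..b})"
    and bound: "\<And>s. \<bar>s\<bar> \<le> b \<Longrightarrow> norm (w' s) \<le> K * norm (w s) + d"
    and "b * K \<le> 1 / 2" "0 \<le> K" "0 \<le> d" "\<bar>t\<bar> \<le> b"
  shows "norm (w t) \<le> 2 * (norm (w 0) + b * d)"
proof -
  have b: "0 \<le> b" using \<open>\<bar>t\<bar> \<le> b\<close> by linarith
  have I: "s \<in> {-b..b} \<longleftrightarrow> \<bar>s\<bar> \<le> b" for s by auto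
  have "continuous_on {-b..b} w"
    by (rule continuous_on_vector_derivative) (use der I in blast)
  then have "continuous_on {-b..b} (\<lambda>s. norm (w s))" by (rule continuous_on_norm)
  then obtain m where m: "\<bar>m\<bar> \<le> b" "\<And>s. \<bar>s\<bar> \<le> b \<Longrightarrow> norm (w s) \<le> norm (w m)"
    using continuous_attains_sup[of "{-b..b}" "\<lambda>s. norm (w s)"] b I by (metis compact_Icc empty_iff abs_zero)
  have "norm (w m - w 0) \<le> (K * norm (w m) + d) * \<bar>m - 0\<bar>"
  proof (rule vector_derivative_bound[of "{-b..b}"])
    fix s assume s: "s \<in> {-b..b}"
    then show "(w has_vector_derivative w' s) (at s within {-b..b})" using der I by blast
    have "norm (w' s) \<le> K * norm (w s) + d" using bound s I by blast
    also have "\<dots> \<le> K * norm (w m) + d" using m(2)[of s] s I assms(4) by (simp add: mult_left_mono)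
    finally show "norm (w' s) \<le> K * norm (w m) + d" .
  qed (use m b in auto)
  also have "\<dots> \<le> (K * norm (w m) + d) * b" using m(1) assms(4,5) by (simp add: mult_left_mono)
  also have "\<dots> = (b * K) * norm (w m) + b * d" by (simp add: algebra_simps)
  also have "\<dots> \<le> 1 / 2 * norm (w m) + b * d" using assms(3) by (intro add_right_mono mult_right_mono) auto
  finally have "norm (w m - w 0) \<le> 1 / 2 * norm (w m) + b * d" .
  moreover have "norm (w m) \<le> norm (w m - w 0) + norm (w 0)"
    by (metis diff_add_cancel norm_triangle_ineq)
  ultimately have "norm (w m) \<le> 2 * (norm (w 0) + b * d)"
    unfolding distrib_left by linarith
  then show ?thesis using m(2)[OF assms(6)] by linarith
qed

text \<open>Picard's contraction on bounded continuous functions over the whole line. The Lipschitz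
  bound holds for all states, so there is no region to be left, and \<open>b * K \<le> 1 / 2\<close>
  makes a single step a contraction with factor 1/2.\<close>

lemma short_time_solution:
  fixes g :: "real \<Rightarrow> 'e::banach \<Rightarrow> 'e"
  assumes b: "0 \<le> b"
    and cont: "continuous_on ({-b..b} \<times> UNIV) (\<lambda>(t, y). g t y)"
    and lip: "\<And>t y z. \<bar>t\<bar> \<le> b \<Longrightarrow> norm (g t y - g t z) \<le> K * norm (y - z)"
    and K: "0 \<le> K" "b * K \<le> 1 / 2"
  obtains w where "w 0 = y0"
    "\<And>t. \<bar>t\<bar> \<le> b \<Longrightarrow> (w has_vector_derivative g t (w t)) (at t within {-b..b})"
proof -
  \<comment> \<open>The primitive starts at the left end \<open>-b\<close>, so that one integral
    covers every \<open>t\<close> of the interval; subtracting \<open>J w 0\<close> in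
    \<open>T\<close> moves the initial time to 0.\<close>
  define J where "J w t = integral {-b..t} (\<lambda>r. g r (apply_bcontfun w r))" for w t
  \<comment> \<open>Clamping time to \<open>{-b..b}\<close> turns a curve on the interval into a
    bounded continuous function on the line, an element of the complete space used for the fixed
    point.\<close>
  define c where "c t = max (-b) (min b t)" for t
  have c: "\<bar>c t\<bar> \<le> b" "c t \<in> {-b..b}" for t using b by (auto simp: c_def)
  have c_id: "c t = t" if "\<bar>t\<bar> \<le> b" for t using that by (auto simp: c_def)
  have I: "s \<in> {-b..b} \<longleftrightarrow> \<bar>s\<bar> \<le> b" for s by auto
  have c_cont: "continuous_on UNIV c"
    unfolding c_def by (intro continuous_intros)
  have J_der: "(J w has_vector_derivative g t (apply_bcontfun w t)) (at t within {-b..b})"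
    if "\<bar>t\<bar> \<le> b" for w t
  proof -
    have "continuous_on {-b..b} (\<lambda>r. (\<lambda>(t, y). g t y) (r, apply_bcontfun w r))"
      by (rule continuous_on_compose2[OF cont]) (auto intro!: continuous_intros)
    then show ?thesis unfolding J_def using integral_has_vector_derivative that I by fastforce
  qed
  have J_cont: "continuous_on {-b..b} (J w)" for w
    by (rule continuous_on_vector_derivative) (use J_der I in blast)
  define T where "T w t = y0 + (J w (c t) - J w 0)" for w t
  have T: "T w \<in> bcontfun" for w
  proof -
    have cont: "continuous_on UNIV (\<lambda>t. J w (c t))"
      by (rule continuous_on_compose2[OF J_cont c_cont]) (use c in auto)
    have "compact (J w ` {-b..b})" by (rule compact_continuous_image[OF J_cont]) simp
    then have "bounded (J w ` {-b..b})" by (rule compact_imp_bounded)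
    then obtain B where B: "\<And>t. \<bar>t\<bar> \<le> b \<Longrightarrow> norm (J w t) \<le> B"
      unfolding bounded_iff using I by blast
    show ?thesis
    proof (rule bcontfun_normI)
      show "continuous_on UNIV (T w)" unfolding T_def using cont by (intro continuous_intros)
      show "norm (T w t) \<le> norm y0 + (B + B)" for t
        unfolding T_def using B[OF c(1), of t] B[of 0] b
        by (intro norm_triangle_le add_mono norm_triangle_le_diff) auto
    qed
  qed
  have contraction: "dist (Bcontfun (T w)) (Bcontfun (T v)) \<le> 1 / 2 * dist w v" for w v
  proof (rule dist_bound)
    fix t
    have "norm ((\<lambda>s. J w s - J v s) (c t) - (\<lambda>s. J w s - J v s) 0) \<le> (K * dist w v) * \<bar>c t - 0\<bar>"
    proof (rule vector_derivative_bound[of "{-b..b}"])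
      fix s assume s: "s \<in> {-b..b}"
      show "((\<lambda>s. J w s - J v s) has_vector_derivative (g s (apply_bcontfun w s) - g s (apply_bcontfun v s)))
        (at s within {-b..b})"
        using J_der s I by (intro has_vector_derivative_diff) blast+
      have "norm (g s (apply_bcontfun w s) - g s (apply_bcontfun v s)) \<le>
        K * norm (apply_bcontfun w s - apply_bcontfun v s)"
        using lip s I by blast
      also have "\<dots> \<le> K * dist w v"
        using dist_bounded[of w s v] K by (intro mult_left_mono) (auto simp: dist_norm)
      finally show "norm (g s (apply_bcontfun w s) - g s (apply_bcontfun v s)) \<le> K * dist w v" .
    qed (use c b in auto)
    also have "\<dots> \<le> (K * dist w v) * b" using c(1)[of t] K by (intro mult_left_mono) auto
    also have "\<dots> = (b * K) * dist w v" by simp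
    also have "\<dots> \<le> 1 / 2 * dist w v" using K(2) by (intro mult_right_mono) auto
    finally have "norm (T w t - T v t) \<le> 1 / 2 * dist w v"
      by (simp add: T_def algebra_simps)
    then show "dist (apply_bcontfun (Bcontfun (T w)) t) (apply_bcontfun (Bcontfun (T v)) t) \<le> 1 / 2 * dist w v"
      using T by (simp add: Bcontfun_inverse dist_norm)
  qed
  have "\<exists>!w. Bcontfun (T w) = w"
    by (rule banach_fix_type[of "1/2"]) (use contraction in auto)
  then obtain w where "Bcontfun (T w) = w" by blast
  then have w: "apply_bcontfun w = T w" by (metis Bcontfun_inverse T)
  show ?thesis
  proof (rule that[of "apply_bcontfun w"])
    show "apply_bcontfun w 0 = y0" unfolding w T_def using c_id[of 0] b by simp
    fix t assume t: "\<bar>t\<bar> \<le> b"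
    have "((\<lambda>s. y0 + (J w s - J w 0)) has_vector_derivative g t (apply_bcontfun w t)) (at t within {-b..b})"
      using J_der[OF t, of w] by (auto intro!: derivative_eq_intros)
    then show "(apply_bcontfun w has_vector_derivative g t (apply_bcontfun w t)) (at t within {-b..b})"
      by (rule has_vector_derivative_transform[rotated 2]) (use t c_id I in \<open>auto simp: w T_def\<close>)
  qed
qed

text \<open>A closed thickening \<open>S\<close> of \<open>C\<close> is still compact and inside
  \<open>D\<close>, so the derivative is uniformly continuous on it; the mean value inequality on a
  small ball then bounds the linearization error by a constant independent of
  \<open>c\<close>.\<close>

lemma uniform_linearization:
  fixes f :: "'a::euclidean_space \<Rightarrow> 'b::real_normed_vector"
  assumes "open D" "Ck_on (Suc 0) D f" "compact C" "C \<subseteq> D" "0 < e"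
  obtains d where "0 < d" "\<And>c c'. c \<in> C \<Longrightarrow> norm (c' - c) < d \<Longrightarrow>
    c' \<in> D \<and> norm (f c' - f c - frechet_derivative f (at c) (c' - c)) \<le> e * norm (c' - c)"
proof -
  obtain r where r: "0 < r" "(\<Union>x\<in>C. ball x r) \<subseteq> D"
    using compact_subset_open_imp_ball_epsilon_subset[OF assms(3,1,4)] by blast
  define S where "S = {x + y | x y. x \<in> C \<and> y \<in> cball 0 (r / 2)}"
  have S: "compact S" unfolding S_def by (rule compact_sums) (use assms in auto)
  have S_mem: "x \<in> S" if "c \<in> C" "norm (x - c) \<le> r / 2" for x c
  proof -
    have "x = c + (x - c) \<and> c \<in> C \<and> x - c \<in> cball 0 (r / 2)" using that by simp
    then show ?thesis unfolding S_def by blast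
  qed
  have "S \<subseteq> D"
  proof
    fix z assume "z \<in> S"
    then obtain x y where "z = x + y" "x \<in> C" "norm y \<le> r / 2" by (auto simp: S_def)
    then have "z \<in> ball x r" using r(1) by (simp add: dist_norm)
    then show "z \<in> D" using r(2) \<open>x \<in> C\<close> by blast
  qed
  define F where "F x = Blinfun (frechet_derivative f (at x))" for x
  have F: "blinfun_apply (F x) = frechet_derivative f (at x)" if "x \<in> D" for x
    unfolding F_def by (rule blinfun_apply_frechet[OF Ck_on_SucD[OF assms(2) that]])
  have "continuous_on S F"
    unfolding F_def by (rule continuous_on_subset[OF continuous_on_blinfun_frechet[OF assms(2)] \<open>S \<subseteq> D\<close>])
  then have "uniformly_continuous_on S F" using S by (rule compact_uniformly_continuous)
  then obtain d where d: "0 < d" "\<And>x x'. x \<in> S \<Longrightarrow> x' \<in> S \<Longrightarrow> dist x' x < d \<Longrightarrow> dist (F x') (F x) < e"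
    using assms(5) unfolding uniformly_continuous_on_def by meson
  show ?thesis
  proof (rule that[of "min d (r / 2)"])
    show "0 < min d (r / 2)" using d r by simp
    fix c c' assume c: "c \<in> C" "norm (c' - c) < min d (r / 2)"
    define B where "B = ball c (min d (r / 2))"
    have BS: "B \<subseteq> S" using S_mem[OF c(1)] by (auto simp: B_def dist_norm norm_minus_commute)
    have "norm (f c' - f c - blinfun_apply (F c) (c' - c)) \<le> norm (c' - c) * e"
    proof (rule differentiable_bound_linearization[where S=B])
      have "c \<in> B" "c' \<in> B" using c d(1) r(1) by (auto simp: B_def dist_norm norm_minus_commute)
      then show "c \<in> B" by simp
      show "c + t *\<^sub>R (c' - c) \<in> B" if "t \<in> {0..1}" for t
      proof -
        have "convex B" by (simp add: B_def)
        then have "(1 - t) *\<^sub>R c + t *\<^sub>R c' \<in> B"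
          using \<open>c \<in> B\<close> \<open>c' \<in> B\<close> that by (auto simp: convex_alt)
        then show ?thesis by (simp add: algebra_simps)
      qed
      fix x assume x: "x \<in> B"
      then have "x \<in> D" using BS \<open>S \<subseteq> D\<close> by blast
      show "(f has_derivative blinfun_apply (F x)) (at x within B)"
        unfolding F[OF \<open>x \<in> D\<close>] by (rule has_derivative_at_withinI[OF Ck_on_SucD[OF assms(2) \<open>x \<in> D\<close>]])
      have "dist (F x) (F c) < e"
        by (rule d(2)) (use BS x \<open>c \<in> B\<close> in \<open>auto simp: B_def dist_commute\<close>)
      then have "norm (F x - F c) \<le> e" by (simp add: dist_norm)
      then show "onorm (blinfun_apply (F x) - blinfun_apply (F c)) \<le> e"
        by (simp add: norm_blinfun.rep_eq minus_blinfun.rep_eq fun_diff_def)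
    qed
    moreover have "c' \<in> D"
      using S_mem[OF c(1), of c'] c(2) \<open>S \<subseteq> D\<close> by auto
    moreover have "c \<in> D" using c assms by auto
    ultimately show "c' \<in> D \<and> norm (f c' - f c - frechet_derivative f (at c) (c' - c)) \<le> e * norm (c' - c)"
      using F[of c] by (simp add: mult.commute)
  qed
qed

lemma norm_diff_triangle: "norm (x - z) \<le> norm (x - y) + norm (y - z)"
  for x y z :: "'a::real_normed_vector"
  using norm_triangle_ineq[of "x - y" "y - z"] by simp

text \<open>Increments of \<open>f\<close> in direction \<open>h\<close>, divided by the step length
  \<open>s\<close>, are bounded by \<open>K * norm h\<close> and approximate \<open>f' h\<close> up
  to any \<open>e * norm h\<close>.\<close>

lemma Lipschitz_derivative_bound:
  fixes f :: "'a::real_normed_vector \<Rightarrow> 'b::real_normed_vector"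
  assumes "(f has_derivative f') (at y)" "open S" "y \<in> S"
    and "\<And>z. z \<in> S \<Longrightarrow> norm (f z - f y) \<le> K * norm (z - y)"
  shows "norm (f' h) \<le> K * norm h"
proof (cases "h = 0")
  case True
  then show ?thesis using linear_0[OF has_derivative_linear[OF assms(1)]] by simp
next
  case False
  then have h: "0 < norm h" by simp
  have lin: "linear f'" by (rule has_derivative_linear[OF assms(1)])
  have bound: "norm (f' h) \<le> K * norm h + e * norm h" if "0 < e" for e
  proof -
    obtain d where d: "0 < d" "\<And>z. norm (z - y) < d \<Longrightarrow> norm (f z - f y - f' (z - y)) \<le> e * norm (z - y)"
      using assms(1) \<open>0 < e\<close> unfolding has_derivative_at_alt by blast
    obtain r where r: "0 < r" "ball y r \<subseteq> S" using assms(2,3) open_contains_ball by blast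
    \<comment> \<open>The displacement \<open>s *\<^sub>R h\<close> has length
      \<open>min d r / 2\<close>: within the range of the linear approximation and within the ball
      inside \<open>S\<close>.\<close>
    define s where "s = min d r / (2 * norm h)"
    have s: "0 < s" "s * norm h < d" "s * norm h < r"
      using d(1) r(1) h by (auto simp: s_def field_simps min_def)
    have "norm (f (y + s *\<^sub>R h) - f y - f' (s *\<^sub>R h)) \<le> e * (s * norm h)"
      using d(2)[of "y + s *\<^sub>R h"] s by simp
    moreover have "norm (f (y + s *\<^sub>R h) - f y) \<le> K * (s * norm h)"
    proof -
      have "y + s *\<^sub>R h \<in> ball y r" using s by (simp add: dist_norm)
      then show ?thesis using assms(4)[of "y + s *\<^sub>R h"] r(2) s(1) by auto
    qed
    moreover have "norm (f' (s *\<^sub>R h)) \<le>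
      norm (f (y + s *\<^sub>R h) - f y) + norm (f (y + s *\<^sub>R h) - f y - f' (s *\<^sub>R h))"
      by (metis norm_triangle_sub norm_minus_commute)
    moreover have "norm (f' (s *\<^sub>R h)) = s * norm (f' h)"
      using s(1) by (simp add: linear_cmul[OF lin])
    ultimately have "s * norm (f' h) \<le> s * (K * norm h + e * norm h)"
      by (simp add: algebra_simps)
    then show ?thesis using s(1) by simp
  qed
  show ?thesis
  proof (rule field_le_epsilon)
    fix e :: real assume "0 < e"
    then show "norm (f' h) \<le> K * norm h + e" using bound[of "e / norm h"] h by simp
  qed
qed

text \<open>Arguments are grouped as ((parameter, time), state). The initial value
  \<open>u (x, 0)\<close> may be any function of the parameter, so that flows and their
  linearizations both fit. The set \<open>\<Omega>\<close> localizes the Lipschitz condition: a ball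
  for the flow, the whole space for linear equations. The bound \<open>a * K \<le> 1 / 2\<close> is
  what \<open>short_time_estimate\<close> requires.\<close>

locale ode_family =
  fixes G :: "('l::euclidean_space \<times> real) \<times> 'e::euclidean_space \<Rightarrow> 'e"
    and u :: "'l \<times> real \<Rightarrow> 'e"
    and a K :: real and \<Lambda> :: "'l set" and \<Omega> :: "'e set"
  assumes a_pos: "0 < a" and K_nonneg: "0 \<le> K" and aK: "a * K \<le> 1 / 2"
    and open_params: "open \<Lambda>" and open_range: "open \<Omega>"
    and Lipschitz: "\<And>x t y z. x \<in> \<Lambda> \<Longrightarrow> \<bar>t\<bar> < a \<Longrightarrow> y \<in> \<Omega> \<Longrightarrow> z \<in> \<Omega> \<Longrightarrow>
      norm (G ((x, t), y) - G ((x, t), z)) \<le> K * norm (y - z)"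
    and in_range: "\<And>x t. x \<in> \<Lambda> \<Longrightarrow> \<bar>t\<bar> < a \<Longrightarrow> u (x, t) \<in> \<Omega>"
    and solves: "\<And>x t. x \<in> \<Lambda> \<Longrightarrow> \<bar>t\<bar> < a \<Longrightarrow>
      ((\<lambda>s. u (x, s)) has_vector_derivative G ((x, t), u (x, t))) (at t)"
begin

abbreviation domain :: "(('l \<times> real) \<times> 'e) set" where
  "domain \<equiv> (\<Lambda> \<times> ball 0 a) \<times> \<Omega>"

lemma open_domain: "open domain"
  by (intro open_Times open_params open_range open_ball)

lemma open_source: "open (\<Lambda> \<times> ball (0::real) a)"
  by (intro open_Times open_params open_ball)

lemma bK: "b < a \<Longrightarrow> b * K \<le> 1 / 2"
  using aK K_nonneg mult_right_mono[of b a K] by linarith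

lemma continuous_in_time:
  assumes "x \<in> \<Lambda>" "b < a"
  shows "continuous_on {-b..b} (\<lambda>t. u (x, t))"
  by (rule continuous_on_vector_derivative[of _ _ "\<lambda>t. G ((x, t), u (x, t))"])
    (use assms in \<open>auto intro!: has_vector_derivative_at_within[OF solves]\<close>)

text \<open>The difference of two right-hand sides splits into a change of state, controlled by
  \<open>K\<close>, and a change of parameter along the fixed solution \<open>u (x0, _)\<close>. The
  latter is small uniformly in time, because \<open>{-b..b}\<close> is compact.\<close>

lemma uniform_continuity_in_parameter:
  assumes cont: "continuous_on domain G" and cont0: "continuous_on \<Lambda> (\<lambda>x. u (x, 0))"
    and x0: "x0 \<in> \<Lambda>" and b: "0 \<le> b" "b < a" and e: "0 < e"
  obtains d where "0 < d" "\<And>x t. norm (x - x0) < d \<Longrightarrow> \<bar>t\<bar> \<le> b \<Longrightarrow>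
    x \<in> \<Lambda> \<and> norm (u (x, t) - u (x0, t)) \<le> e"
proof -
  \<comment> \<open>The comparison ends with the bound \<open>2 * (e1 + b * e1)\<close>; this choice
    makes it equal to \<open>e\<close>.\<close>
  define e1 where "e1 = e / (2 * (1 + b))"
  have "e1 * (2 * (1 + b)) = e" using b by (simp add: e1_def)
  then have e1: "0 < e1" "2 * (e1 + b * e1) = e" using e b by (simp add: e1_def, argo)
  have "continuous_on (\<Lambda> \<times> {-b..b}) (\<lambda>p. G ((fst p, snd p), u (x0, snd p)))"
  proof (rule continuous_on_compose2[OF cont])
    have "continuous_on (\<Lambda> \<times> {-b..b}) (\<lambda>p. u (x0, snd p))"
      by (rule continuous_on_compose2[OF continuous_in_time[OF x0 b(2)]]) (auto intro: continuous_intros)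
    then show "continuous_on (\<Lambda> \<times> {-b..b}) (\<lambda>p. ((fst p, snd p), u (x0, snd p)))"
      by (intro continuous_intros)
  qed (use x0 b in \<open>auto intro!: in_range\<close>)
  from this compact_Icc x0 e1(1) obtain X0 where X0: "x0 \<in> X0" "open X0"
    and X0_bound: "\<forall>x\<in>X0 \<inter> \<Lambda>. \<forall>t\<in>{-b..b}.
      dist (G ((fst (x, t), snd (x, t)), u (x0, snd (x, t)))) (G ((fst (x0, t), snd (x0, t)), u (x0, snd (x0, t)))) \<le> e1"
    by (rule continuous_on_prod_compactE)
  have X0_est: "norm (G ((x, t), u (x0, t)) - G ((x0, t), u (x0, t))) \<le> e1"
    if "x \<in> X0" "x \<in> \<Lambda>" "\<bar>t\<bar> \<le> b" for x t
    using X0_bound[rule_format, of x t] that by (simp add: dist_norm abs_le_iff)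
  obtain d1 where d1: "0 < d1" "\<And>x. norm (x - x0) < d1 \<Longrightarrow> x \<in> X0 \<and> x \<in> \<Lambda>"
  proof -
    have "open (X0 \<inter> \<Lambda>)" "x0 \<in> X0 \<inter> \<Lambda>" using X0(1,2) x0 open_params by auto
    then show ?thesis using that unfolding open_dist dist_norm by blast
  qed
  obtain d2 where d2: "0 < d2" "\<And>x. x \<in> \<Lambda> \<Longrightarrow> norm (x - x0) < d2 \<Longrightarrow> norm (u (x, 0) - u (x0, 0)) < e1"
    using cont0 x0 e1(1) unfolding continuous_on_iff dist_norm by blast
  show ?thesis
  proof (rule that[of "min d1 d2"])
    fix x t assume x: "norm (x - x0) < min d1 d2" and t: "\<bar>t\<bar> \<le> b"
    then have xm: "x \<in> X0" "x \<in> \<Lambda>" using d1 by auto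
    have "norm (u (x, t) - u (x0, t)) \<le> 2 * (norm (u (x, 0) - u (x0, 0)) + b * e1)"
    proof (rule short_time_estimate[where b=b and K=K and
        w'="\<lambda>s. G ((x, s), u (x, s)) - G ((x0, s), u (x0, s))"])
      fix s assume s: "\<bar>s\<bar> \<le> b"
      then have sa: "\<bar>s\<bar> < a" using b by linarith
      show "((\<lambda>s. u (x, s) - u (x0, s)) has_vector_derivative
          G ((x, s), u (x, s)) - G ((x0, s), u (x0, s))) (at s within {-b..b})"
        by (intro has_vector_derivative_diff has_vector_derivative_at_within[OF solves] xm x0 sa)
      have "norm (G ((x, s), u (x, s)) - G ((x0, s), u (x0, s))) \<le>
        norm (G ((x, s), u (x, s)) - G ((x, s), u (x0, s))) +
        norm (G ((x, s), u (x0, s)) - G ((x0, s), u (x0, s)))"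
        by (rule norm_diff_triangle)
      also have "\<dots> \<le> K * norm (u (x, s) - u (x0, s)) + e1"
        by (intro add_mono Lipschitz X0_est xm sa s in_range x0)
      finally show "norm (G ((x, s), u (x, s)) - G ((x0, s), u (x0, s))) \<le>
        K * norm (u (x, s) - u (x0, s)) + e1" .
    qed (use t e1 K_nonneg bK[OF b(2)] in auto)
    also have "\<dots> \<le> 2 * (e1 + b * e1)"
      using d2(2)[OF xm(2)] x by simp
    finally show "x \<in> \<Lambda> \<and> norm (u (x, t) - u (x0, t)) \<le> e" using e1(2) xm(2) by simp
  qed (use d1 d2 in auto)
qed

lemma continuous_solution:
  assumes cont: "continuous_on domain G" and cont0: "continuous_on \<Lambda> (\<lambda>x. u (x, 0))"
  shows "continuous_on (\<Lambda> \<times> ball 0 a) u"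
  unfolding continuous_on_iff
proof (intro ballI allI impI)
  fix p :: "'l \<times> real" and e :: real assume p: "p \<in> \<Lambda> \<times> ball 0 a" and e: "0 < e"
  obtain x0 t0 where xt: "p = (x0, t0)" "x0 \<in> \<Lambda>" "\<bar>t0\<bar> < a" using p by auto
  \<comment> \<open>Halfway between \<open>\<bar>t0\<bar>\<close> and \<open>a\<close>: the compact
    interval \<open>{-b..b}\<close> lies in the time domain and contains a neighbourhood of
    \<open>t0\<close>.\<close>
  define b where "b = (\<bar>t0\<bar> + a) / 2"
  have b: "0 \<le> b" "b < a" "\<bar>t0\<bar> < b" using xt(3) by (auto simp: b_def)
  obtain d1 where d1: "0 < d1" "\<And>x t. norm (x - x0) < d1 \<Longrightarrow> \<bar>t\<bar> \<le> b \<Longrightarrow>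
      x \<in> \<Lambda> \<and> norm (u (x, t) - u (x0, t)) \<le> e / 2"
    by (rule uniform_continuity_in_parameter[OF cont cont0 xt(2) b(1,2) half_gt_zero[OF e]]) (rule that)
  have "continuous (at t0) (\<lambda>t. u (x0, t))"
    by (rule has_vector_derivative_continuous[OF solves[OF xt(2,3)]])
  then obtain d2 where d2: "0 < d2" "\<And>t. \<bar>t - t0\<bar> < d2 \<Longrightarrow> norm (u (x0, t) - u (x0, t0)) < e / 2"
    using half_gt_zero[OF e] unfolding continuous_at_eps_delta dist_norm real_norm_def by blast
  have "dist (u q) (u p) < e" if q: "dist q p < min d1 (min d2 (b - \<bar>t0\<bar>))" for q
  proof -
    obtain x t where xt': "q = (x, t)" by fastforce
    have "norm (x - x0) \<le> dist q p" "\<bar>t - t0\<bar> \<le> dist q p"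
      using dist_fst_le[of q p] dist_snd_le[of q p] by (auto simp: xt xt' dist_norm)
    then have *: "norm (x - x0) < d1" "\<bar>t - t0\<bar> < d2" "\<bar>t\<bar> \<le> b" using q by auto
    have "dist (u q) (u p) \<le> norm (u (x, t) - u (x0, t)) + norm (u (x0, t) - u (x0, t0))"
      unfolding xt xt' dist_norm by (rule norm_diff_triangle)
    then show ?thesis using d1(2)[OF *(1,3), THEN conjunct2] d2(2)[OF *(2)] by linarith
  qed
  moreover have "0 < min d1 (min d2 (b - \<bar>t0\<bar>))" using d1 d2 b by simp
  ultimately show "\<exists>d>0. \<forall>x'\<in>\<Lambda> \<times> ball 0 a. dist x' p < d \<longrightarrow> dist (u x') (u p) < e" by blast
qed

text \<open>With parameter and time frozen, the Lipschitz hypothesis bounds the state part of the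
  derivative. Hence the linearized equation satisfies the smallness condition with the same
  \<open>a\<close> and \<open>K\<close>.\<close>

lemma partial_derivative_bound:
  assumes "Ck_on (Suc 0) domain G" "x \<in> \<Lambda>" "\<bar>t\<bar> < a" "y \<in> \<Omega>"
  shows "norm (frechet_derivative G (at ((x, t), y)) (0, h)) \<le> K * norm h"
proof (rule Lipschitz_derivative_bound[OF _ open_range assms(4)])
  have "(G has_derivative frechet_derivative G (at ((x, t), y))) (at ((x, t), y))"
    using assms by (intro Ck_on_SucD[OF assms(1)]) auto
  moreover have "((\<lambda>z. ((x, t), z)) has_derivative (\<lambda>h. (0, h))) (at y)"
    by (auto intro!: derivative_eq_intros simp: zero_prod_def)
  ultimately show "((\<lambda>z. G ((x, t), z)) has_derivative
      (\<lambda>h. frechet_derivative G (at ((x, t), y)) (0, h))) (at y)"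
    using diff_chain_at[of "\<lambda>z. ((x, t), z)" "\<lambda>h. (0, h)" y G] by (simp add: o_def)
qed (use Lipschitz assms in auto)

text \<open>The variational equation along \<open>u (x0, _)\<close>: in the direction
  \<open>((v, 0), z t)\<close> the parameter moves by \<open>v\<close>, time is fixed and the state
  moves by \<open>z t\<close>. The equation is affine in \<open>z\<close>, hence globally Lipschitz
  with constant \<open>K\<close>, and so solvable on all of \<open>{-b..b}\<close>.\<close>

lemma linearized_solution:
  assumes G: "Ck_on (Suc 0) domain G" and x0: "x0 \<in> \<Lambda>" and b: "0 \<le> b" "b < a"
  obtains z where "z 0 = z0" "\<And>t. \<bar>t\<bar> \<le> b \<Longrightarrow> (z has_vector_derivative
    frechet_derivative G (at ((x0, t), u (x0, t))) ((v, 0), z t)) (at t within {-b..b})"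
proof -
  define c where "c t = ((x0, t), u (x0, t))" for t
  have c: "c t \<in> domain" if "\<bar>t\<bar> \<le> b" for t using that b x0 in_range by (auto simp: c_def)
  have cD: "c ` {-b..b} \<subseteq> domain"
  proof (rule image_subsetI)
    fix s assume "s \<in> {-b..b}"
    then have "\<bar>s\<bar> \<le> b" by auto
    then show "c s \<in> domain" by (rule c)
  qed
  have c_cont: "continuous_on {-b..b} c"
    unfolding c_def using continuous_in_time[OF x0 b(2)] by (intro continuous_intros)
  define D where "D p = Blinfun (frechet_derivative G (at p))" for p
  have D: "blinfun_apply (D p) = frechet_derivative G (at p)" if "p \<in> domain" for p
    unfolding D_def by (rule blinfun_apply_frechet[OF Ck_on_SucD[OF G that]])
  have "continuous_on {-b..b} (\<lambda>t. D (c t))"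
    by (rule continuous_on_compose2[OF continuous_on_blinfun_frechet[OF G, folded D_def] c_cont cD])
  then have "continuous_on ({-b..b} \<times> UNIV) (\<lambda>p. D (c (fst p)))"
    by (rule continuous_on_compose2) (auto intro: continuous_intros)
  then have cont: "continuous_on ({-b..b} \<times> UNIV) (\<lambda>(t, y). blinfun_apply (D (c t)) ((v, 0), y))"
    unfolding case_prod_beta by (intro continuous_intros)
  have lip: "norm (blinfun_apply (D (c t)) ((v, 0), y) - blinfun_apply (D (c t)) ((v, 0), y')) \<le> K * norm (y - y')"
    if t: "\<bar>t\<bar> \<le> b" for t y y'
  proof -
    have "blinfun_apply (D (c t)) ((v, 0), y) - blinfun_apply (D (c t)) ((v, 0), y') =
        frechet_derivative G (at (c t)) (0, y - y')"
    proof -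
      have "((v, 0), y) - ((v, 0), y') = (0 :: 'l \<times> real, y - y')" by (simp add: zero_prod_def)
      then show ?thesis by (simp only: D[OF c[OF t]] linear_diff[OF Ck_on_Suc_linear_frechet[OF G c[OF t]], symmetric])
    qed
    also have "norm \<dots> \<le> K * norm (y - y')"
      unfolding c_def using t b by (intro partial_derivative_bound[OF G x0] in_range x0) auto
    finally show ?thesis .
  qed
  obtain z where z: "z 0 = z0" "\<And>t. \<bar>t\<bar> \<le> b \<Longrightarrow>
      (z has_vector_derivative blinfun_apply (D (c t)) ((v, 0), z t)) (at t within {-b..b})"
    by (rule short_time_solution[OF b(1) cont lip K_nonneg bK[OF b(2)], where ?y0.0=z0], assumption, rule that)
  show ?thesis
  proof (rule that[of z])
    show "z 0 = z0" by (rule z(1))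
    fix t assume "\<bar>t\<bar> \<le> b"
    then show "(z has_vector_derivative
      frechet_derivative G (at ((x0, t), u (x0, t))) ((v, 0), z t)) (at t within {-b..b})"
      using z(2) D[OF c] by (simp add: c_def)
  qed
qed

text \<open>The remainder \<open>u (x, s) - u (x0, s) - Z (x - x0) s\<close> solves the homogeneous
  linearized equation up to the linearization error of \<open>G\<close>, which is small relative to
  \<open>norm (x - x0)\<close> uniformly in \<open>s\<close>. \<open>short_time_estimate\<close>
  turns this into the differentiability estimate.\<close>

lemma linearized_flow_derivative:
  assumes G: "Ck_on (Suc 0) domain G" and x0: "x0 \<in> \<Lambda>" and b: "0 \<le> b" "b < a"
    and u0: "((\<lambda>x. u (x, 0)) has_derivative u0') (at x0)"
    and Z0: "\<And>v. Z v 0 = u0' v"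
    and Z: "\<And>v t. \<bar>t\<bar> \<le> b \<Longrightarrow> (Z v has_vector_derivative
      frechet_derivative G (at ((x0, t), u (x0, t))) ((v, 0), Z v t)) (at t within {-b..b})"
    and t: "\<bar>t\<bar> \<le> b"
  shows "((\<lambda>x. u (x, t)) has_derivative (\<lambda>v. Z v t)) (at x0)"
proof -
  define c where "c t = ((x0, t), u (x0, t))" for t
  define DG where "DG t = frechet_derivative G (at (c t))" for t
  note Z = Z[folded c_def, folded DG_def]
  have c: "c t \<in> domain" if "\<bar>t\<bar> \<le> b" for t using that b x0 in_range by (auto simp: c_def)
  have lin: "linear (DG t)" if "\<bar>t\<bar> \<le> b" for t
    unfolding DG_def by (rule Ck_on_Suc_linear_frechet[OF G c[OF that]])
  have DG_bound: "norm (DG s (0, h)) \<le> K * norm h" if "\<bar>s\<bar> \<le> b" for s h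
    unfolding DG_def c_def using that b by (intro partial_derivative_bound[OF G x0] in_range x0) auto
  have lin0: "linear u0'" by (rule has_derivative_linear[OF u0])
  have b': "b * K \<le> 1 / 2" by (rule bK[OF b(2)])

  \<comment> \<open>Uniqueness for the homogeneous equation. The curves \<open>Z v\<close> are given
    separately for each \<open>v\<close>; this is what makes them depend linearly on
    \<open>v\<close>.\<close>
  have zero: "w s = 0" if w: "w 0 = 0" "\<And>s. \<bar>s\<bar> \<le> b \<Longrightarrow>
      (w has_vector_derivative DG s (0, w s)) (at s within {-b..b})" and s: "\<bar>s\<bar> \<le> b" for w s
  proof -
    have "norm (w s) \<le> 2 * (norm (w 0) + b * 0)"
      by (rule short_time_estimate[where b=b and K=K and w'="\<lambda>s. DG s (0, w s)", OF w(2)]) (use DG_bound b' K_nonneg s in auto)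
    then show ?thesis by (simp add: w)
  qed
  have add: "Z (v + v') s = Z v s + Z v' s" if s: "\<bar>s\<bar> \<le> b" for v v' s
  proof -
    have "(\<lambda>s. Z (v + v') s - (Z v s + Z v' s)) s = 0"
    proof (rule zero[OF _ _ s])
      show "Z (v + v') 0 - (Z v 0 + Z v' 0) = 0" by (simp add: Z0 linear_add[OF lin0])
      fix s assume s: "\<bar>s\<bar> \<le> b"
      have "(0 :: 'l \<times> real, Z (v + v') s - (Z v s + Z v' s)) =
          ((v + v', 0), Z (v + v') s) - (((v, 0), Z v s) + ((v', 0), Z v' s))"
        by (simp add: zero_prod_def)
      then have "DG s (0, Z (v + v') s - (Z v s + Z v' s)) =
          DG s ((v + v', 0), Z (v + v') s) - (DG s ((v, 0), Z v s) + DG s ((v', 0), Z v' s))"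
        by (simp only: linear_diff[OF lin[OF s]] linear_add[OF lin[OF s]])
      then show "((\<lambda>s. Z (v + v') s - (Z v s + Z v' s)) has_vector_derivative
          DG s (0, Z (v + v') s - (Z v s + Z v' s))) (at s within {-b..b})"
        using has_vector_derivative_diff[OF Z[OF s] has_vector_derivative_add[OF Z[OF s] Z[OF s]]] by simp
    qed
    then show ?thesis by simp
  qed
  have scale: "Z (r *\<^sub>R v) s = r *\<^sub>R Z v s" if s: "\<bar>s\<bar> \<le> b" for r v s
  proof -
    have "(\<lambda>s. Z (r *\<^sub>R v) s - r *\<^sub>R Z v s) s = 0"
    proof (rule zero[OF _ _ s])
      show "Z (r *\<^sub>R v) 0 - r *\<^sub>R Z v 0 = 0" by (simp add: Z0 linear_cmul[OF lin0])
      fix s assume s: "\<bar>s\<bar> \<le> b"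
      have "(0 :: 'l \<times> real, Z (r *\<^sub>R v) s - r *\<^sub>R Z v s) = ((r *\<^sub>R v, 0), Z (r *\<^sub>R v) s) - r *\<^sub>R ((v, 0), Z v s)"
        by (simp add: zero_prod_def)
      then have "DG s (0, Z (r *\<^sub>R v) s - r *\<^sub>R Z v s) =
          DG s ((r *\<^sub>R v, 0), Z (r *\<^sub>R v) s) - r *\<^sub>R DG s ((v, 0), Z v s)"
        by (simp only: linear_diff[OF lin[OF s]] linear_cmul[OF lin[OF s]])
      then show "((\<lambda>s. Z (r *\<^sub>R v) s - r *\<^sub>R Z v s) has_vector_derivative
          DG s (0, Z (r *\<^sub>R v) s - r *\<^sub>R Z v s)) (at s within {-b..b})"
        using has_vector_derivative_diff[OF Z[OF s]
            bounded_linear.has_vector_derivative[OF bounded_linear_scaleR_right Z[OF s]]] by simp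
    qed
    then show ?thesis by simp
  qed
  have Zlin: "bounded_linear (\<lambda>v. Z v t)"
    unfolding linear_conv_bounded_linear[symmetric] by (rule linearI) (use add scale t in auto)

  have cD: "c ` {-b..b} \<subseteq> domain"
  proof (rule image_subsetI)
    fix s assume "s \<in> {-b..b}"
    then have "\<bar>s\<bar> \<le> b" by auto
    then show "c s \<in> domain" by (rule c)
  qed
  have cI: "c s \<in> c ` {-b..b}" if "\<bar>s\<bar> \<le> b" for s
    by (rule imageI) (use that in auto)
  have C: "compact (c ` {-b..b})" "c ` {-b..b} \<subseteq> domain"
  proof -
    have "continuous_on {-b..b} c"
      unfolding c_def using continuous_in_time[OF x0 b(2)] by (intro continuous_intros)
    then show "compact (c ` {-b..b})" by (rule compact_continuous_image) simp
  qed (rule cD)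
  have "compact ((\<lambda>p. Blinfun (frechet_derivative G (at p))) ` c ` {-b..b})"
    by (rule compact_continuous_image[OF continuous_on_subset[OF continuous_on_blinfun_frechet[OF G] C(2)] C(1)])
  then obtain B where "\<forall>y\<in>(\<lambda>p. Blinfun (frechet_derivative G (at p))) ` c ` {-b..b}. norm y \<le> B"
    by (metis compact_imp_bounded bounded_iff)
  then have B: "norm (Blinfun (DG s)) \<le> B" if "\<bar>s\<bar> \<le> b" for s
    using that by (simp add: DG_def abs_le_iff)
  have B0: "0 \<le> B" using B[OF t] norm_ge_zero order_trans by blast
  have DG_norm: "norm (DG s h) \<le> B * norm h" if "\<bar>s\<bar> \<le> b" for s h
  proof -
    have "norm (blinfun_apply (Blinfun (DG s)) h) \<le> norm (Blinfun (DG s)) * norm h"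
      by (rule norm_blinfun)
    also have "\<dots> \<le> B * norm h" by (rule mult_right_mono[OF B[OF that]]) simp
    finally show ?thesis
      unfolding DG_def blinfun_apply_frechet[OF Ck_on_SucD[OF G c[OF that]]] .
  qed
  obtain M0 where M0: "0 \<le> M0" "\<And>v. norm (u0' v) \<le> M0 * norm v"
    using bounded_linear.nonneg_bounded[OF has_derivative_bounded_linear[OF u0]]
    by (auto simp: mult.commute)
  obtain r where r: "0 < r" "ball x0 r \<subseteq> \<Lambda>" using open_params x0 open_contains_ball by blast

  \<comment> \<open>Precision 1 suffices for \<open>d1\<close> and \<open>d2\<close>, since they
    only enter a Lipschitz bound for the solution as a function of the parameter.\<close>
  obtain d1 where d1: "0 < d1" "\<And>p p'. p \<in> c ` {-b..b} \<Longrightarrow> norm (p' - p) < d1 \<Longrightarrow>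
      p' \<in> domain \<and> norm (G p' - G p - frechet_derivative G (at p) (p' - p)) \<le> 1 * norm (p' - p)"
    by (rule uniform_linearization[OF open_domain G C zero_less_one]) (rule that)
  obtain d2 where d2: "0 < d2" "\<And>x. norm (x - x0) < d2 \<Longrightarrow>
      norm (u (x, 0) - u (x0, 0) - u0' (x - x0)) \<le> 1 * norm (x - x0)"
    using u0 zero_less_one unfolding has_derivative_at_alt by blast
  \<comment> \<open>The Lipschitz constant in the parameter: \<open>M0 + 1\<close> bounds the change
    of the initial value, \<open>B + 1\<close> the direct effect of the parameter on
    \<open>G\<close>, and the factor 2 comes from \<open>short_time_estimate\<close>.\<close>
  define M where "M = 2 * ((M0 + 1) + b * (B + 1))"
  have M: "0 \<le> M" using M0 B0 b by (simp add: M_def)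
  define d where "d = min r (min d1 d2)"
  have d: "0 < d" using r d1 d2 by (simp add: d_def)

  have param_Lipschitz: "norm (u (x, s) - u (x0, s)) \<le> M * norm (x - x0)"
    if x: "norm (x - x0) < d" and s: "\<bar>s\<bar> \<le> b" for x s
  proof -
    have xm: "x \<in> \<Lambda>" using x r by (auto simp: d_def dist_norm norm_minus_commute)
    have "norm (u (x, s) - u (x0, s)) \<le> 2 * (norm (u (x, 0) - u (x0, 0)) + b * ((B + 1) * norm (x - x0)))"
    proof (rule short_time_estimate[where b=b and K=K and
        w'="\<lambda>s. G ((x, s), u (x, s)) - G ((x0, s), u (x0, s))"])
      fix s assume s: "\<bar>s\<bar> \<le> b"
      then have sa: "\<bar>s\<bar> < a" using b by linarith
      show "((\<lambda>s. u (x, s) - u (x0, s)) has_vector_derivative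
          G ((x, s), u (x, s)) - G ((x0, s), u (x0, s))) (at s within {-b..b})"
        by (intro has_vector_derivative_diff has_vector_derivative_at_within[OF solves] xm x0 sa)
      have diff: "((x, s), u (x0, s)) - c s = ((x - x0, 0), 0)" by (simp add: c_def)
      have "norm (G ((x, s), u (x0, s)) - G (c s) - DG s (((x, s), u (x0, s)) - c s))
          \<le> 1 * norm (((x, s), u (x0, s)) - c s)"
        unfolding DG_def by (rule d1(2)[THEN conjunct2]) (use cI[OF s] x in \<open>auto simp: diff d_def\<close>)
      moreover have "norm (DG s (((x, s), u (x0, s)) - c s)) \<le> B * norm (x - x0)"
        using DG_norm[OF s, of "((x - x0, 0), 0)"] by (simp add: diff)
      moreover have "norm (G ((x, s), u (x0, s)) - G (c s)) \<le>
          norm (DG s (((x, s), u (x0, s)) - c s)) +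
          norm (G ((x, s), u (x0, s)) - G (c s) - DG s (((x, s), u (x0, s)) - c s))"
        by (rule norm_triangle_sub)
      ultimately have 1: "norm (G ((x, s), u (x0, s)) - G ((x0, s), u (x0, s))) \<le> (B + 1) * norm (x - x0)"
        by (simp add: diff c_def algebra_simps)
      have "norm (G ((x, s), u (x, s)) - G ((x0, s), u (x0, s))) \<le>
        norm (G ((x, s), u (x, s)) - G ((x, s), u (x0, s))) +
        norm (G ((x, s), u (x0, s)) - G ((x0, s), u (x0, s)))"
        by (rule norm_diff_triangle)
      also have "\<dots> \<le> K * norm (u (x, s) - u (x0, s)) + (B + 1) * norm (x - x0)"
        by (intro add_mono Lipschitz 1 xm sa in_range x0)
      finally show "norm (G ((x, s), u (x, s)) - G ((x0, s), u (x0, s))) \<le>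
        K * norm (u (x, s) - u (x0, s)) + (B + 1) * norm (x - x0)" .
    qed (use s B0 K_nonneg b' in auto)
    moreover have "norm (u (x, 0) - u (x0, 0)) \<le> (M0 + 1) * norm (x - x0)"
    proof -
      have "norm (u (x, 0) - u (x0, 0)) \<le> norm (u0' (x - x0)) + norm (u (x, 0) - u (x0, 0) - u0' (x - x0))"
        by (rule norm_triangle_sub)
      then show ?thesis using d2(2)[of x] M0(2)[of "x - x0"] x by (simp add: d_def algebra_simps)
    qed
    ultimately show ?thesis by (simp add: M_def algebra_simps)
  qed

  show ?thesis
    unfolding has_derivative_at_alt
  proof (intro conjI allI impI)
    show "bounded_linear (\<lambda>v. Z v t)" by (rule Zlin)
    fix e :: real assume e: "0 < e"
    \<comment> \<open>\<open>q\<close> collects the factors of the final estimate, so that precision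
      \<open>e1 = e / q\<close> in each ingredient ends in \<open>e\<close>.\<close>
    define q where "q = 2 * (1 + b * (1 + M))"
    have q: "0 < q" using b M by (simp add: q_def add_pos_nonneg)
    define e1 where "e1 = e / q"
    have e1: "0 < e1" using e q by (simp add: e1_def)
    obtain d3 where d3: "0 < d3" "\<And>p p'. p \<in> c ` {-b..b} \<Longrightarrow> norm (p' - p) < d3 \<Longrightarrow>
        p' \<in> domain \<and> norm (G p' - G p - frechet_derivative G (at p) (p' - p)) \<le> e1 * norm (p' - p)"
      by (rule uniform_linearization[OF open_domain G C e1]) (rule that)
    obtain d4 where d4: "0 < d4" "\<And>x. norm (x - x0) < d4 \<Longrightarrow>
        norm (u (x, 0) - u (x0, 0) - u0' (x - x0)) \<le> e1 * norm (x - x0)"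
      using u0 e1 unfolding has_derivative_at_alt by blast
    \<comment> \<open>The arguments of \<open>G\<close> along the two solutions differ by at most
      \<open>(1 + M) * norm (x - x0)\<close>, and this must stay below \<open>d3\<close>.\<close>
    define d5 where "d5 = min d (min d4 (d3 / (1 + M)))"
    have "norm (u (x, t) - u (x0, t) - Z (x - x0) t) \<le> e * norm (x - x0)" if x: "norm (x - x0) < d5" for x
    proof -
      have xm: "x \<in> \<Lambda>" using x r by (auto simp: d_def d5_def dist_norm norm_minus_commute)
      have xd: "norm (x - x0) < d" using x by (simp add: d5_def)
      define v where "v = x - x0"
      have "norm (u (x, t) - u (x0, t) - Z v t) \<le>
          2 * (norm (u (x, 0) - u (x0, 0) - Z v 0) + b * (e1 * ((1 + M) * norm v)))"
      proof (rule short_time_estimate[where b=b and K=K and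
          w'="\<lambda>s. G ((x, s), u (x, s)) - G ((x0, s), u (x0, s)) - DG s ((v, 0), Z v s)"])
        fix s assume s: "\<bar>s\<bar> \<le> b"
        then have sa: "\<bar>s\<bar> < a" using b by linarith
        show "((\<lambda>s. u (x, s) - u (x0, s) - Z v s) has_vector_derivative
            G ((x, s), u (x, s)) - G ((x0, s), u (x0, s)) - DG s ((v, 0), Z v s)) (at s within {-b..b})"
          by (intro has_vector_derivative_diff has_vector_derivative_at_within[OF solves] Z xm x0 sa s)
        define p where "p = ((x, s), u (x, s))"
        have diff: "p - c s = ((v, 0), u (x, s) - u (x0, s))" by (simp add: p_def c_def v_def)
        have "norm (p - c s) \<le> norm (v, 0::real) + norm (u (x, s) - u (x0, s))"
          unfolding diff by (rule norm_Pair_le)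
        also have "\<dots> \<le> norm v + M * norm v"
          using param_Lipschitz[OF xd s] by (simp add: v_def)
        finally have n: "norm (p - c s) \<le> (1 + M) * norm v" by (simp add: algebra_simps)
        also have "\<dots> < d3" using x M by (simp add: d5_def v_def pos_less_divide_eq mult.commute)
        finally have "norm (G p - G (c s) - DG s (p - c s)) \<le> e1 * norm (p - c s)"
          unfolding DG_def using d3(2)[OF cI[OF s]] by blast
        also have "\<dots> \<le> e1 * ((1 + M) * norm v)" using n e1 by simp
        finally have 1: "norm (G p - G (c s) - DG s (p - c s)) \<le> e1 * ((1 + M) * norm v)" .
        have "p - c s - ((v, 0), Z v s) = (0, u (x, s) - u (x0, s) - Z v s)"
          unfolding diff by (simp add: zero_prod_def)
        then have 2: "DG s (p - c s) - DG s ((v, 0), Z v s) = DG s (0, u (x, s) - u (x0, s) - Z v s)"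
          by (simp only: linear_diff[OF lin[OF s], symmetric])
        have "G p - G (c s) - DG s ((v, 0), Z v s) =
            DG s (0, u (x, s) - u (x0, s) - Z v s) + (G p - G (c s) - DG s (p - c s))"
          unfolding 2[symmetric] by simp
        then have "norm (G p - G (c s) - DG s ((v, 0), Z v s)) \<le>
            norm (DG s (0, u (x, s) - u (x0, s) - Z v s)) + norm (G p - G (c s) - DG s (p - c s))"
          by (simp only: norm_triangle_ineq)
        also have "\<dots> \<le> K * norm (u (x, s) - u (x0, s) - Z v s) + e1 * ((1 + M) * norm v)"
          by (intro add_mono DG_bound s 1)
        finally show "norm (G ((x, s), u (x, s)) - G ((x0, s), u (x0, s)) - DG s ((v, 0), Z v s)) \<le>
            K * norm (u (x, s) - u (x0, s) - Z v s) + e1 * ((1 + M) * norm v)"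
          by (simp add: p_def c_def)
      qed (use t e1 M K_nonneg b' in auto)
      also have "\<dots> \<le> 2 * (e1 * norm v + b * (e1 * ((1 + M) * norm v)))"
        using d4(2)[of x] x by (simp add: Z0 v_def d5_def)
      also have "\<dots> = (e1 * q) * norm v" by (simp add: q_def algebra_simps)
      also have "\<dots> = e * norm v" using q by (simp add: e1_def)
      finally show ?thesis by (simp add: v_def)
    qed
    moreover have "0 < d5" using d d3 d4 M by (simp add: d5_def)
    ultimately show "\<exists>d>0. \<forall>y. norm (y - x0) < d \<longrightarrow>
        norm (u (y, t) - u (x0, t) - Z (y - x0) t) \<le> e * norm (y - x0)" by blast
  qed
qed

text \<open>The variational solutions exist on each \<open>{-b..b}\<close> with
  \<open>b < a\<close>. Choosing \<open>\<bar>t\<bar> < b\<close> makes \<open>t\<close> an interior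
  point, where derivatives within the interval become two-sided.\<close>

lemma partial_derivative_solves:
  assumes G: "Ck_on (Suc 0) domain G" and u0: "Ck_on (Suc 0) \<Lambda> (\<lambda>x. u (x, 0))"
    and x: "x \<in> \<Lambda>" and t: "\<bar>t\<bar> < a"
  shows "((\<lambda>x. u (x, t)) has_derivative frechet_derivative (\<lambda>x. u (x, t)) (at x)) (at x)"
    and "((\<lambda>s. frechet_derivative (\<lambda>x. u (x, s)) (at x) v) has_vector_derivative
      frechet_derivative G (at ((x, t), u (x, t)))
        ((v, 0), frechet_derivative (\<lambda>x. u (x, t)) (at x) v)) (at t)"
proof -
  define b where "b = (\<bar>t\<bar> + a) / 2"
  have b: "0 \<le> b" "b < a" "\<bar>t\<bar> < b" using t by (auto simp: b_def)
  note der0 = Ck_on_SucD[OF u0 x]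
  have "\<exists>z. z 0 = frechet_derivative (\<lambda>x. u (x, 0)) (at x) v \<and> (\<forall>t. \<bar>t\<bar> \<le> b \<longrightarrow>
    (z has_vector_derivative frechet_derivative G (at ((x, t), u (x, t))) ((v, 0), z t)) (at t within {-b..b}))" for v
    by (rule linearized_solution[OF G x b(1,2)]) blast
  then obtain Z where Z: "\<And>v. Z v 0 = frechet_derivative (\<lambda>x. u (x, 0)) (at x) v"
    "\<And>v t. \<bar>t\<bar> \<le> b \<Longrightarrow> (Z v has_vector_derivative
      frechet_derivative G (at ((x, t), u (x, t))) ((v, 0), Z v t)) (at t within {-b..b})"
    by metis
  have der: "((\<lambda>x. u (x, s)) has_derivative (\<lambda>v. Z v s)) (at x)" if "\<bar>s\<bar> \<le> b" for s
    by (rule linearized_flow_derivative[OF G x b(1,2) der0 Z that])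
  have eq: "frechet_derivative (\<lambda>x. u (x, s)) (at x) = (\<lambda>v. Z v s)" if "\<bar>s\<bar> \<le> b" for s
    using frechet_derivative_at[OF der[OF that]] by simp
  show "((\<lambda>x. u (x, t)) has_derivative frechet_derivative (\<lambda>x. u (x, t)) (at x)) (at x)"
    using der[of t] eq[of t] b by simp
  have "(Z v has_vector_derivative frechet_derivative G (at ((x, t), u (x, t))) ((v, 0), Z v t)) (at t)"
    using Z(2)[of t v] b at_within_interior[of t "{-b..b}"] by (simp add: abs_less_iff)
  then have "((\<lambda>s. frechet_derivative (\<lambda>x. u (x, s)) (at x) v) has_vector_derivative
      frechet_derivative G (at ((x, t), u (x, t))) ((v, 0), Z v t)) (at t)"
    by (rule has_vector_derivative_transform_within_open[where S="{-b<..<b}"])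
      (use b in \<open>auto simp: eq\<close>)
  then show "((\<lambda>s. frechet_derivative (\<lambda>x. u (x, s)) (at x) v) has_vector_derivative
      frechet_derivative G (at ((x, t), u (x, t)))
        ((v, 0), frechet_derivative (\<lambda>x. u (x, t)) (at x) v)) (at t)"
    using eq[of t] b by simp
qed

end

text \<open>The induction hypothesis is used twice: for \<open>u\<close> itself, one order lower,
  which makes the coefficients \<open>Gv v\<close> of the variational equation C^k; then for the
  derivative \<open>z v\<close>, which solves that equation. Hence the generalization over
  \<open>G\<close>, \<open>u\<close> and \<open>\<Omega>\<close>, while \<open>a\<close>,
  \<open>K\<close> and \<open>\<Lambda>\<close> stay fixed and the time interval never
  shrinks.\<close>

theorem ode_family_Ck:
  assumes "ode_family G u a K \<Lambda> \<Omega>" "Ck_on k ((\<Lambda> \<times> ball 0 a) \<times> \<Omega>) G" "Ck_on k \<Lambda> (\<lambda>x. u (x, 0))"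
  shows "Ck_on k (\<Lambda> \<times> ball 0 a) u"
  using assms
proof (induction k arbitrary: G u \<Omega>)
  case 0
  interpret ode_family G u a K \<Lambda> \<Omega> by (rule 0)
  show ?case using continuous_solution 0 by simp
next
  case (Suc k)
  interpret ode_family G u a K \<Lambda> \<Omega> by (rule Suc.prems)
  have C1: "Ck_on (Suc 0) S f" if "Ck_on (Suc k) S f" for S and f :: "'c::real_normed_vector \<Rightarrow> 'd::real_normed_vector"
    using that by (rule Ck_on_mono) simp
  note G = C1[OF Suc.prems(2)] and u0 = C1[OF Suc.prems(3)]
  have uk: "Ck_on k (\<Lambda> \<times> ball 0 a) u"
    by (rule Suc.IH[OF Suc.prems(1) Suc.prems(2,3)[THEN Ck_on_Suc_imp]])
  define z where "z v p = frechet_derivative (\<lambda>x. u (x, snd p)) (at (fst p)) v" for v and p :: "'a \<times> real"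
  define Gv where "Gv v q = frechet_derivative G (at (fst q, u (fst q))) ((v, 0), snd q)"
    for v and q :: "('a \<times> real) \<times> 'b"
  have zk: "Ck_on k (\<Lambda> \<times> ball 0 a) (z v)" for v
  proof (rule Suc.IH)
    show "ode_family (Gv v) (z v) a K \<Lambda> UNIV"
    proof
      fix x t and y y' :: 'b assume x: "x \<in> \<Lambda>" "\<bar>t\<bar> < a"
      have "((v, 0), y) - ((v, 0), y') = (0 :: 'a \<times> real, y - y')" by (simp add: zero_prod_def)
      moreover have "linear (frechet_derivative G (at ((x, t), u (x, t))))"
        by (rule Ck_on_Suc_linear_frechet[OF G]) (use x in_range in auto)
      ultimately have "Gv v ((x, t), y) - Gv v ((x, t), y') =
          frechet_derivative G (at ((x, t), u (x, t))) (0, y - y')"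
        by (simp add: Gv_def linear_diff[symmetric])
      then show "norm (Gv v ((x, t), y) - Gv v ((x, t), y')) \<le> K * norm (y - y')"
        using partial_derivative_bound[OF G x in_range[OF x]] by simp
      show "((\<lambda>s. z v (x, s)) has_vector_derivative Gv v ((x, t), z v (x, t))) (at t)"
        using partial_derivative_solves(2)[OF G u0 x, of v] by (simp add: z_def Gv_def)
    qed (use a_pos K_nonneg aK open_params in auto)
    show "Ck_on k ((\<Lambda> \<times> ball 0 a) \<times> UNIV) (Gv v)"
      unfolding Gv_def
    proof (rule Ck_on_dir_deriv[OF Suc.prems(2)])
      have o: "open ((\<Lambda> \<times> ball (0::real) a) \<times> (UNIV :: 'b set))"
        by (intro open_Times open_source open_UNIV)
      then show "open ((\<Lambda> \<times> ball (0::real) a) \<times> (UNIV :: 'b set))" .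
      have fst: "Ck_on k ((\<Lambda> \<times> ball (0::real) a) \<times> (UNIV :: 'b set)) fst"
        by (rule Ck_on_linear[OF bounded_linear_fst o])
      show "Ck_on k ((\<Lambda> \<times> ball 0 a) \<times> (UNIV :: 'b set)) (\<lambda>q. (fst q, u (fst q)))"
        by (intro Ck_on_Pair o fst Ck_on_compose[OF uk fst]) auto
      show "Ck_on k ((\<Lambda> \<times> ball 0 a) \<times> UNIV) (\<lambda>q :: ('a \<times> real) \<times> 'b. ((v, 0 :: real), snd q))"
        by (intro Ck_on_Pair o Ck_on_const Ck_on_linear[OF bounded_linear_snd o])
    qed (use in_range in auto)
    show "Ck_on k \<Lambda> (\<lambda>x. z v (x, 0))"
      using Suc.prems(3) by (simp add: z_def)
  qed
  have Gu: "Ck_on k (\<Lambda> \<times> ball 0 a) (\<lambda>p. G (p, u p))"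
  proof (rule Ck_on_compose[OF Ck_on_Suc_imp[OF Suc.prems(2)] _ _ open_source])
    show "Ck_on k (\<Lambda> \<times> ball 0 a) (\<lambda>p. (p, u p))"
      by (intro Ck_on_Pair Ck_on_ident uk open_source)
  qed (use in_range in auto)
  show ?case
  proof (rule Ck_on_SucI[OF open_source])
    fix p :: "'a \<times> real" assume p: "p \<in> \<Lambda> \<times> ball 0 a"
    obtain x t where xt: "p = (x, t)" "x \<in> \<Lambda>" "\<bar>t\<bar> < a" using p by auto
    have "((\<lambda>(x, t). u (x, t)) has_derivative (\<lambda>(v, \<tau>). z v (x, t) +
        blinfun_apply (blinfun_scaleR_left (G ((x, t), u (x, t)))) \<tau>)) (at (x, t) within \<Lambda> \<times> ball 0 a)"
    proof (rule has_derivative_partialsI)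
      show "((\<lambda>x. u (x, t)) has_derivative (\<lambda>v. z v (x, t))) (at x within \<Lambda>)"
        using partial_derivative_solves(1)[OF G u0 xt(2,3)]
        by (simp add: z_def has_derivative_at_withinI)
      show "((\<lambda>t. u (x, t)) has_derivative
          blinfun_apply (blinfun_scaleR_left (G ((x, t), u (x, t))))) (at t within ball 0 a)"
        if "x \<in> \<Lambda>" "t \<in> ball 0 a" for x t
        using solves[of x t] that by (simp add: has_vector_derivative_def has_derivative_at_withinI)
      \<comment> \<open>Joint continuity of the time partial, which the equation itself identifies
        as \<open>G (p, u p)\<close>, is what lets the two partial derivatives combine into a total
        one.\<close>
      have "continuous_on (\<Lambda> \<times> ball 0 a) (\<lambda>p. blinfun_scaleR_left (G (p, u p)))"
        by (rule bounded_linear.continuous_on[OF bounded_linear_blinfun_scaleR_left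
              Ck_on_imp_continuous_on[OF Gu]])
      then show "continuous (at (x, t) within \<Lambda> \<times> ball 0 a) (\<lambda>(x, t). blinfun_scaleR_left (G ((x, t), u (x, t))))"
        using p by (simp add: case_prod_beta' continuous_on_eq_continuous_within xt)
    qed (use xt in auto)
    moreover have "(\<lambda>(x, t). u (x, t)) = u" by auto
    moreover have "(\<lambda>(v, \<tau>). z v (x, t) + blinfun_apply (blinfun_scaleR_left (G ((x, t), u (x, t)))) \<tau>) =
        (\<lambda>w. z (fst w) p + snd w *\<^sub>R G (p, u p))"
      unfolding xt(1) by auto
    moreover have "at (x, t) within \<Lambda> \<times> ball 0 a = at p"
      using at_within_open[OF p open_source] by (simp only: xt(1))
    ultimately show "(u has_derivative (\<lambda>w. z (fst w) p + snd w *\<^sub>R G (p, u p))) (at p)"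
      by (simp only:)
  next
    show "Ck_on k (\<Lambda> \<times> ball 0 a) (\<lambda>p. z (fst w) p + snd w *\<^sub>R G (p, u p))" for w
      by (intro Ck_on_add Ck_on_scaleR zk Gu Ck_on_const open_source)
  qed
qed

text \<open>Precomposing \<open>X\<close> with the nearest-point projection onto a closed ball gives
  a globally Lipschitz field, whose solutions exist for a fixed time. From the ball of half the
  radius they stay where the projection is the identity, so they solve the original equation.
  Regularity comes from \<open>ode_family_Ck\<close>, with the initial point as parameter.\<close>

theorem smooth_local_flow:
  fixes X :: "'e::euclidean_space \<Rightarrow> 'e"
  assumes "open V" "smooth_on V X" "x0 \<in> V"
  obtains r a \<phi> where "0 < r" "0 < a" "ball x0 r \<subseteq> V" "smooth_on (ball x0 r \<times> ball (0::real) a) \<phi>"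
    "\<And>x. x \<in> ball x0 r \<Longrightarrow> \<phi> (x, 0) = x"
    "\<And>x t. x \<in> ball x0 r \<Longrightarrow> \<bar>t\<bar> < a \<Longrightarrow> \<phi> (x, t) \<in> V"
    "\<And>x t. x \<in> ball x0 r \<Longrightarrow> \<bar>t\<bar> < a \<Longrightarrow> ((\<lambda>s. \<phi> (x, s)) has_vector_derivative X (\<phi> (x, t))) (at t)"
proof -
  obtain R where R: "0 < R" "cball x0 R \<subseteq> V" using assms(1,3) open_contains_cball by blast
  define C where "C = cball x0 R"
  have C: "compact C" "convex C" "closed C" "C \<noteq> {}" "C \<subseteq> V" using R by (auto simp: C_def)
  have X: "Ck_on k V X" for k using assms(2) by (simp add: smooth_on_def)
  have "compact ((\<lambda>x. Blinfun (frechet_derivative X (at x))) ` C)"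
    by (rule compact_continuous_image[OF continuous_on_subset[OF continuous_on_blinfun_frechet[OF X] C(5)] C(1)])
  then obtain K where "\<forall>y\<in>(\<lambda>x. Blinfun (frechet_derivative X (at x))) ` C. norm y \<le> K"
    by (metis compact_imp_bounded bounded_iff)
  then have K: "onorm (frechet_derivative X (at x)) \<le> K" if "x \<in> C" for x
    using that C(5) blinfun_apply_frechet[OF Ck_on_SucD[OF X]]
    by (metis imageI norm_blinfun.rep_eq subsetD)
  have "x0 \<in> C" using R by (simp add: C_def)
  have K0: "0 \<le> K"
    using K[OF \<open>x0 \<in> C\<close>] onorm_pos_le[OF has_derivative_bounded_linear[OF Ck_on_SucD[OF X assms(3)]]]
    by linarith
  have lipC: "norm (X x - X y) \<le> K * norm (x - y)" if "x \<in> C" "y \<in> C" for x y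
  proof (rule differentiable_bound[OF C(2) _ K that])
    show "(X has_derivative frechet_derivative X (at x)) (at x within C)" if "x \<in> C" for x
      using Ck_on_SucD[OF X] C(5) that by (meson has_derivative_at_withinI subsetD)
  qed
  have "compact (X ` C)"
    by (rule compact_continuous_image[OF continuous_on_subset[OF Ck_on_imp_continuous_on[OF X] C(5)] C(1)])
  then obtain M where "\<forall>y\<in>X ` C. norm y \<le> M"
    by (metis compact_imp_bounded bounded_iff)
  then have M: "norm (X x) \<le> M" if "x \<in> C" for x using that by blast
  have M0: "0 \<le> M" using M[OF \<open>x0 \<in> C\<close>] norm_ge_zero order_trans by blast
  \<comment> \<open>The first term gives \<open>a * K \<le> 1 / 2\<close>; the second keeps the
    distance travelled at speed at most \<open>M\<close> below \<open>R / 2\<close>. Adding 1 avoids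
    division by zero.\<close>
  define a where "a = min (1 / (2 * (K + 1))) (R / (4 * (M + 1)))"
  have a: "0 < a" using K0 M0 R by (simp add: a_def)
  have "a * K \<le> 1 / (2 * (K + 1)) * K" using K0 by (intro mult_right_mono) (auto simp: a_def)
  also have "\<dots> \<le> 1 / 2" using K0 by (simp add: field_simps)
  finally have aK: "a * K \<le> 1 / 2" .
  have "a * M \<le> R / (4 * (M + 1)) * M" using M0 by (intro mult_right_mono) (auto simp: a_def)
  also have "\<dots> < R / 2" using M0 R by (simp add: field_simps add_pos_nonneg)
  finally have aM: "a * M < R / 2" .

  define X' where "X' y = X (closest_point C y)" for y
  have cC: "closest_point C y \<in> C" for y by (rule closest_point_in_set[OF C(3,4)])
  have lip: "norm (X' y - X' z) \<le> K * norm (y - z)" for y z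
  proof -
    have "norm (X' y - X' z) \<le> K * norm (closest_point C y - closest_point C z)"
      unfolding X'_def by (intro lipC cC)
    also have "\<dots> \<le> K * norm (y - z)"
      using closest_point_lipschitz[OF C(2,3,4), of y z] K0 by (intro mult_left_mono) (auto simp: dist_norm)
    finally show ?thesis .
  qed
  have "continuous_on UNIV X'"
    unfolding X'_def
    by (rule continuous_on_compose2[OF continuous_on_subset[OF Ck_on_imp_continuous_on[OF X] C(5)]
          continuous_on_closest_point[OF C(2,3,4)]]) (use cC in auto)
  then have cont: "continuous_on ({-a..a} \<times> UNIV) (\<lambda>(t, y). X' y)"
    unfolding case_prod_beta' by (rule continuous_on_compose2) (auto intro: continuous_intros)
  have "\<exists>w. w 0 = x \<and> (\<forall>t. \<bar>t\<bar> \<le> a \<longrightarrow> (w has_vector_derivative X' (w t)) (at t within {-a..a}))" for x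
    by (rule short_time_solution[of a "\<lambda>t. X'" K x, OF less_imp_le[OF a] cont lip K0 aK]) blast
  then obtain w where w: "\<And>x. w x 0 = x"
    "\<And>x t. \<bar>t\<bar> \<le> a \<Longrightarrow> (w x has_vector_derivative X' (w x t)) (at t within {-a..a})"
    by metis
  define \<phi> where "\<phi> p = w (fst p) (snd p)" for p
  define r where "r = R / 2"
  have stays: "w x t \<in> ball x0 R" if x: "x \<in> ball x0 r" and t: "\<bar>t\<bar> \<le> a" for x t
  proof -
    have "norm (w x t - w x 0) \<le> M * \<bar>t - 0\<bar>"
      by (rule vector_derivative_bound[of "{-a..a}" _ "\<lambda>t. X' (w x t)"])
        (use w(2) t a M cC in \<open>auto simp: X'_def abs_le_iff\<close>)
    also have "\<dots> \<le> M * a" using t M0 by (intro mult_left_mono) auto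
    finally have "dist (w x t) x < R / 2" using aM by (simp add: w(1) dist_norm mult.commute)
    moreover have "dist x0 x < R / 2" using x by (simp add: r_def)
    ultimately show ?thesis using dist_triangle[of x0 "w x t" x] by (simp add: dist_commute)
  qed
  have X'_eq: "X' y = X y" if "y \<in> ball x0 R" for y
    unfolding X'_def using that closest_point_self[of y C] by (simp add: C_def)
  have solves: "((\<lambda>s. \<phi> (x, s)) has_vector_derivative X (\<phi> (x, t))) (at t)"
    if x: "x \<in> ball x0 r" and t: "\<bar>t\<bar> < a" for x t
  proof -
    have "(w x has_vector_derivative X' (w x t)) (at t)"
      using w(2)[of t x] t at_within_interior[of t "{-a..a}"] by (simp add: abs_less_iff)
    then show ?thesis using X'_eq[OF stays[OF x, of t]] t by (simp add: \<phi>_def)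
  qed
  have fam: "ode_family (\<lambda>q. X (snd q)) \<phi> a K (ball x0 r) (ball x0 R)"
  proof
    show "norm (X (snd ((x, t), y)) - X (snd ((x, t), z))) \<le> K * norm (y - z)"
      if "y \<in> ball x0 R" "z \<in> ball x0 R" for x :: 'e and t :: real and y z
      using lipC[of y z] that by (simp add: C_def)
  qed (use a K0 aK solves stays in \<open>auto simp: \<phi>_def\<close>)
  have "Ck_on k (ball x0 r \<times> ball 0 a) \<phi>" for k
  proof (rule ode_family_Ck[OF fam])
    have o: "open ((ball x0 r \<times> ball (0::real) a) \<times> ball x0 R)" by (intro open_Times open_ball)
    show "Ck_on k ((ball x0 r \<times> ball (0::real) a) \<times> ball x0 R) (\<lambda>q. X (snd q))"
      by (rule Ck_on_compose[OF X Ck_on_linear[OF bounded_linear_snd o] _ o])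
        (use R C in \<open>auto simp: C_def\<close>)
    show "Ck_on k (ball x0 r) (\<lambda>x. \<phi> (x, 0))"
      using Ck_on_ident[of "ball x0 r"] by (simp add: \<phi>_def w(1))
  qed
  then have "smooth_on (ball x0 r \<times> ball 0 a) \<phi>" by (simp add: smooth_on_def)
  moreover have "\<phi> (x, t) \<in> V" if "x \<in> ball x0 r" "\<bar>t\<bar> < a" for x t
    using stays[of x t] that R(2) by (auto simp: \<phi>_def)
  moreover have "ball x0 r \<subseteq> V" using R by (auto simp: r_def)
  moreover have "0 < r" using R by (simp add: r_def)
  ultimately show ?thesis
    using that[of r a \<phi>] a solves w(1) by (simp add: \<phi>_def)
qed

section \<open>Charts and tangent vectors\<close>

lemma smooth_onD: "smooth_on S f \<Longrightarrow> x \<in> S \<Longrightarrow> (f has_derivative frechet_derivative f (at x)) (at x)"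
  using Ck_on_SucD[of 0 S f x] by (simp only: smooth_on_def)

lemma frechet_derivative_eqI: "(f has_derivative f') (at x) \<Longrightarrow> frechet_derivative f (at x) = f'"
  using frechet_derivative_at by metis

locale manifold =
  fixes atl :: "('m::t2_space, 'n::finite) chart set"
  assumes smooth_atl: "smooth_structure atl"
begin

lemma is_chart: "c \<in> atl \<Longrightarrow> is_chart c"
  using smooth_atl by (simp add: smooth_structure_def)

lemma ex_chart: obtains c where "c \<in> atl" "p \<in> fst c"
  using smooth_atl unfolding smooth_structure_def by blast

lemma chart_open: "c \<in> atl \<Longrightarrow> open (fst c)" "c \<in> atl \<Longrightarrow> open (snd c ` fst c)"
  using is_chart by (auto simp: is_chart_def)

lemma chart_homeo: "c \<in> atl \<Longrightarrow> homeomorphism (fst c) (snd c ` fst c) (snd c) (chart_inv c)"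
  using is_chart by (auto simp: is_chart_def)

lemma chart_inv_left: "c \<in> atl \<Longrightarrow> p \<in> fst c \<Longrightarrow> chart_inv c (snd c p) = p"
  by (rule homeomorphism_apply1[OF chart_homeo])

lemma chart_inv_right: "c \<in> atl \<Longrightarrow> x \<in> snd c ` fst c \<Longrightarrow> snd c (chart_inv c x) = x"
  by (rule homeomorphism_apply2[OF chart_homeo])

lemma chart_inv_mem: "c \<in> atl \<Longrightarrow> x \<in> snd c ` fst c \<Longrightarrow> chart_inv c x \<in> fst c"
  by (auto simp: chart_inv_left)

lemma chart_image_iff:
  "c \<in> atl \<Longrightarrow> x \<in> snd c ` (fst c \<inter> W) \<longleftrightarrow> x \<in> snd c ` fst c \<and> chart_inv c x \<in> W"
  by (auto simp: chart_inv_left)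

lemma chart_image_open:
  assumes "c \<in> atl" "open W"
  shows "open (snd c ` (fst c \<inter> W))"
proof -
  have "snd c ` (fst c \<inter> W) = chart_inv c -` W \<inter> snd c ` fst c"
    using chart_image_iff[OF assms(1)] by auto
  then show ?thesis
    using continuous_on_open_vimage[OF chart_open(2)[OF assms(1)], of "chart_inv c"]
      homeomorphism_cont2[OF chart_homeo[OF assms(1)]] assms(2) by auto
qed

lemma chart_preimage_open:
  assumes "c \<in> atl" "open V"
  shows "open {q \<in> fst c. snd c q \<in> V}"
proof -
  have "{q \<in> fst c. snd c q \<in> V} = snd c -` V \<inter> fst c" by auto
  then show ?thesis
    using continuous_on_open_vimage[OF chart_open(1)[OF assms(1)], of "snd c"]
      homeomorphism_cont1[OF chart_homeo[OF assms(1)]] assms(2) by auto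
qed

lemma smooth_transition:
  "c \<in> atl \<Longrightarrow> d \<in> atl \<Longrightarrow> smooth_on (snd c ` (fst c \<inter> fst d)) (transition c d)"
  using smooth_atl unfolding smooth_structure_def compatible_def by blast

lemma transition_apply: "c \<in> atl \<Longrightarrow> p \<in> fst c \<Longrightarrow> transition c d (snd c p) = snd d p"
  by (simp add: transition_def chart_inv_left)

definition jac where "jac c d p = frechet_derivative (transition c d) (at (snd c p))"

lemma jac_has_derivative:
  assumes "c \<in> atl" "d \<in> atl" "p \<in> fst c" "p \<in> fst d"
  shows "(transition c d has_derivative jac c d p) (at (snd c p))"
  unfolding jac_def by (rule smooth_onD[OF smooth_transition]) (use assms in auto)

lemma jac_linear:
  "c \<in> atl \<Longrightarrow> d \<in> atl \<Longrightarrow> p \<in> fst c \<Longrightarrow> p \<in> fst d \<Longrightarrow> linear (jac c d p)"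
  using jac_has_derivative has_derivative_linear by blast

text \<open>The cocycle rule, an instance of the chain rule; it is what makes
  \<open>vec_of_comps\<close> obey the transformation law between any two charts.\<close>

lemma jac_compose:
  assumes "c \<in> atl" "d \<in> atl" "e \<in> atl" "p \<in> fst c" "p \<in> fst d" "p \<in> fst e"
  shows "jac d e p (jac c d p \<xi>) = jac c e p \<xi>"
proof -
  let ?S = "snd c ` (fst c \<inter> fst d)"
  have "((transition d e \<circ> transition c d) has_derivative (jac d e p \<circ> jac c d p)) (at (snd c p))"
    using diff_chain_at[OF jac_has_derivative[OF assms(1,2,4,5)], of "transition d e" "jac d e p"]
      jac_has_derivative[OF assms(2,3,5,6)] transition_apply[OF assms(1,4), of d] by simp
  then have "(transition c e has_derivative (jac d e p \<circ> jac c d p)) (at (snd c p))"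
  proof (rule has_derivative_transform_within_open)
    show "open ?S" by (rule chart_image_open[OF assms(1) chart_open(1)[OF assms(2)]])
    show "snd c p \<in> ?S" using assms by auto
    show "(transition d e \<circ> transition c d) x = transition c e x" if "x \<in> ?S" for x
      using that assms by (auto simp: transition_def chart_inv_left)
  qed
  from frechet_derivative_eqI[OF this] show ?thesis unfolding jac_def[of c e] by simp
qed

lemma jac_self:
  assumes "c \<in> atl" "p \<in> fst c"
  shows "jac c c p \<xi> = \<xi>"
proof -
  have "((\<lambda>x. x) has_derivative (\<lambda>v. v)) (at (snd c p))" by (rule has_derivative_ident)
  then have "(transition c c has_derivative (\<lambda>v. v)) (at (snd c p))"
    by (rule has_derivative_transform_within_open[OF _ chart_open(2)[OF assms(1)]])
      (use assms in \<open>auto simp: transition_def chart_inv_left\<close>)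
  from frechet_derivative_eqI[OF this] show ?thesis by (simp add: jac_def)
qed

lemma vec_of_comps_apply:
  "d \<in> atl \<Longrightarrow> p \<in> fst d \<Longrightarrow> vec_of_comps atl c p \<xi> d = jac c d p \<xi>"
  by (simp add: vec_of_comps_def jac_def)

lemma vec_of_comps_self: "c \<in> atl \<Longrightarrow> p \<in> fst c \<Longrightarrow> vec_of_comps atl c p \<xi> c = \<xi>"
  by (simp add: vec_of_comps_apply jac_self)

lemma tangent_spaceD:
  assumes "u \<in> tangent_space atl p" "c \<in> atl" "d \<in> atl" "p \<in> fst c" "p \<in> fst d"
  shows "u d = jac c d p (u c)"
  using assms unfolding tangent_space_def jac_def by blast

lemma vec_of_comps_tangent:
  assumes "c \<in> atl" "p \<in> fst c"
  shows "vec_of_comps atl c p \<xi> \<in> tangent_space atl p"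
proof -
  have "vec_of_comps atl c p \<xi> e = jac d e p (vec_of_comps atl c p \<xi> d)"
    if "d \<in> atl" "e \<in> atl" "p \<in> fst d" "p \<in> fst e" for d e
    using that assms by (simp add: vec_of_comps_apply jac_compose)
  moreover have "vec_of_comps atl c p \<xi> d = 0" if "\<not> (d \<in> atl \<and> p \<in> fst d)" for d
    using that by (auto simp: vec_of_comps_def)
  ultimately show ?thesis unfolding tangent_space_def jac_def by blast
qed

lemma tangent_eq_vec_of_comps:
  assumes "u \<in> tangent_space atl p" "c \<in> atl" "p \<in> fst c"
  shows "u = vec_of_comps atl c p (u c)"
proof
  fix d
  show "u d = vec_of_comps atl c p (u c) d"
  proof (cases "d \<in> atl \<and> p \<in> fst d")
    case True
    then show ?thesis using tangent_spaceD[OF assms(1,2) _ assms(3)] by (simp add: vec_of_comps_apply)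
  next
    case False
    then have "u d = 0" using assms(1) unfolding tangent_space_def by blast
    then show ?thesis using False by (auto simp: vec_of_comps_def)
  qed
qed

lemma vec_of_comps_add:
  assumes "c \<in> atl" "p \<in> fst c"
  shows "vec_of_comps atl c p (\<xi> + \<eta>) d = vec_of_comps atl c p \<xi> d + vec_of_comps atl c p \<eta> d"
  using linear_add[OF jac_linear[OF assms(1) _ assms(2)]] by (auto simp: vec_of_comps_def jac_def)

lemma vec_of_comps_scale:
  assumes "c \<in> atl" "p \<in> fst c"
  shows "vec_of_comps atl c p (r *\<^sub>R \<xi>) d = r *\<^sub>R vec_of_comps atl c p \<xi> d"
  using linear_cmul[OF jac_linear[OF assms(1) _ assms(2)]] by (auto simp: vec_of_comps_def jac_def)

text \<open>\<open>differential\<close> selects its chart by \<open>SOME\<close>. The Jacobian that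
  appears when \<open>f\<close> is rewritten in another chart is absorbed by the transformation law
  of \<open>u\<close>, so any chart around \<open>p\<close> may be used.\<close>

lemma differential_eq:
  assumes f: "smooth_fun atl U f" and p: "p \<in> U" and c: "c \<in> atl" "p \<in> fst c"
    and u: "u \<in> tangent_space atl p"
  shows "differential atl f p u = frechet_derivative (f \<circ> chart_inv c) (at (snd c p)) (u c)"
proof -
  define d where "d = (SOME c. c \<in> atl \<and> p \<in> fst c)"
  have d: "d \<in> atl" "p \<in> fst d" using someI[of "\<lambda>c. c \<in> atl \<and> p \<in> fst c" c] c by (auto simp: d_def)
  have der: "((f \<circ> chart_inv c) has_derivative frechet_derivative (f \<circ> chart_inv c) (at (snd c p))) (at (snd c p))"
    using f c p by (auto simp: smooth_fun_def intro: smooth_onD)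
  let ?S = "snd d ` (fst d \<inter> fst c)"
  have "(((f \<circ> chart_inv c) \<circ> transition d c) has_derivative
      (frechet_derivative (f \<circ> chart_inv c) (at (snd c p)) \<circ> jac d c p)) (at (snd d p))"
    using diff_chain_at[OF jac_has_derivative[OF d(1) c(1) d(2) c(2)], of "f \<circ> chart_inv c"]
      der transition_apply[OF d, of c] by simp
  then have "((f \<circ> chart_inv d) has_derivative
      (frechet_derivative (f \<circ> chart_inv c) (at (snd c p)) \<circ> jac d c p)) (at (snd d p))"
  proof (rule has_derivative_transform_within_open)
    show "open ?S" by (rule chart_image_open[OF d(1) chart_open(1)[OF c(1)]])
    show "snd d p \<in> ?S" using c d by auto
    show "((f \<circ> chart_inv c) \<circ> transition d c) x = (f \<circ> chart_inv d) x" if "x \<in> ?S" for x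
      using that c d by (auto simp: transition_def chart_inv_left)
  qed
  then have "frechet_derivative (f \<circ> chart_inv d) (at (snd d p)) (u d) =
      frechet_derivative (f \<circ> chart_inv c) (at (snd c p)) (jac d c p (u d))"
    by (simp add: frechet_derivative_eqI)
  then show ?thesis
    unfolding differential_def Let_def d_def[symmetric]
    using tangent_spaceD[OF u d(1) c(1) d(2) c(2)] by simp
qed

end

section \<open>Flat functions and smooth bump functions\<close>

definition flat_fun :: "nat \<Rightarrow> real \<Rightarrow> real" where
  "flat_fun m t = (if t \<le> 0 then 0 else inverse t ^ m * exp (- inverse t))"

lemma flat_fun_tendsto: "(flat_fun m \<longlongrightarrow> 0) (at 0)"
proof -
  have "((\<lambda>t::real. inverse t ^ m / exp (inverse t)) \<longlongrightarrow> 0) (at_right 0)"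
    by (rule filterlim_compose[OF tendsto_power_div_exp_0 filterlim_inverse_at_top_right])
  moreover have "eventually (\<lambda>t. inverse t ^ m / exp (inverse t) = flat_fun m t) (at_right 0)"
    using eventually_at_right_less[of "0::real"]
    by eventually_elim (simp add: flat_fun_def exp_minus field_simps)
  ultimately have r: "(flat_fun m \<longlongrightarrow> 0) (at_right 0)" by (rule Lim_transform_eventually)
  have "eventually (\<lambda>t. flat_fun m t = 0) (at_left (0::real))"
    using eventually_at_left_real[of "-1" 0] by (auto simp: flat_fun_def elim: eventually_mono)
  then have "(flat_fun m \<longlongrightarrow> 0) (at_left 0)" by (rule tendsto_eventually)
  with r show ?thesis by (simp add: filterlim_split_at)
qed

lemma flat_fun_derivative:
  "(flat_fun m has_real_derivative flat_fun (m + 2) t - real m * flat_fun (m + 1) t) (at t)"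
proof (cases "t = 0")
  case True
  \<comment> \<open>At 0 the difference quotient of \<open>flat_fun m\<close> is exactly
    \<open>flat_fun (m + 1)\<close>, whose limit there is already known.\<close>
  have "eventually (\<lambda>h. flat_fun (m + 1) h = (flat_fun m (0 + h) - flat_fun m 0) / h) (at 0)"
    by (rule always_eventually) (auto simp: flat_fun_def field_simps)
  then have "((\<lambda>h. (flat_fun m (0 + h) - flat_fun m 0) / h) \<longlongrightarrow> 0) (at 0)"
    by (rule Lim_transform_eventually[OF flat_fun_tendsto])
  then show ?thesis using True by (simp add: DERIV_def flat_fun_def)
next
  case False
  show ?thesis
  proof (cases "t < 0")
    case True
    have "((\<lambda>_. 0) has_real_derivative 0) (at t)" by simp
    then have "(flat_fun m has_real_derivative 0) (at t)"
      by (rule has_field_derivative_transform_within_open[of _ _ _ "{..<0}"])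
        (use True in \<open>auto simp: flat_fun_def\<close>)
    then show ?thesis using True by (simp add: flat_fun_def)
  next
    case nonneg: False
    with False have t: "0 < t" by simp
    have "((\<lambda>t. inverse t ^ m * exp (- inverse t)) has_real_derivative
        inverse t ^ (m + 2) * exp (- inverse t) - real m * (inverse t ^ (m + 1) * exp (- inverse t))) (at t)"
    proof -
      have inv: "(inverse has_real_derivative - (inverse t ^ Suc (Suc 0))) (at t)"
        by (rule DERIV_inverse) (use t in simp)
      have "((\<lambda>t. inverse t ^ m) has_real_derivative - (real m * inverse t ^ (m + 1))) (at t)"
        by (rule DERIV_cong[OF DERIV_power[OF inv, of m]]) (cases m, simp_all)
      moreover have "((\<lambda>t. exp (- inverse t)) has_real_derivative exp (- inverse t) * (inverse t)\<^sup>2) (at t)"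
        by (rule DERIV_cong[OF DERIV_chain2[OF DERIV_exp DERIV_minus[OF inv]]]) (simp add: power2_eq_square)
      ultimately show ?thesis
        by (rule DERIV_cong[OF DERIV_mult]) (simp add: power2_eq_square algebra_simps)
    qed
    then have "(flat_fun m has_real_derivative
        inverse t ^ (m + 2) * exp (- inverse t) - real m * (inverse t ^ (m + 1) * exp (- inverse t))) (at t)"
      by (rule has_field_derivative_transform_within_open[of _ _ _ "{0<..}"])
        (use t in \<open>auto simp: flat_fun_def\<close>)
    then show ?thesis using t by (simp add: flat_fun_def)
  qed
qed

text \<open>The functions \<open>t^(-m) * exp (-1/t)\<close>, continued by 0, are closed under
  differentiation up to linear combinations. Treating all \<open>m\<close> at once makes the
  induction on \<open>k\<close> immediate.\<close>

lemma Ck_on_flat_fun: "Ck_on k UNIV (flat_fun m)"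
proof (induction k arbitrary: m)
  case 0
  then show ?case
    using DERIV_isCont[OF flat_fun_derivative] by (simp add: continuous_at_imp_continuous_on)
next
  case (Suc k)
  show ?case
  proof (rule Ck_on_SucI[OF open_UNIV])
    show "(flat_fun m has_derivative (\<lambda>h. (flat_fun (m + 2) t + (- real m) * flat_fun (m + 1) t) * h)) (at t)" for t
      using flat_fun_derivative[of m t] by (simp add: has_field_derivative_def)
    show "Ck_on k UNIV (\<lambda>t. (flat_fun (m + 2) t + (- real m) * flat_fun (m + 1) t) * h)" for h
      by (intro Ck_on_mult Ck_on_add Suc.IH Ck_on_const open_UNIV)
  qed
qed

lemma ex_bump_function:
  fixes x0 :: "'a::euclidean_space"
  assumes "0 < r"
  obtains \<beta> :: "'a \<Rightarrow> real" where "smooth_on UNIV \<beta>" "\<beta> x0 = 1" "\<And>x. r \<le> norm (x - x0) \<Longrightarrow> \<beta> x = 0"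
proof -
  \<comment> \<open>The argument of \<open>flat_fun\<close> is positive exactly inside the ball of
    radius \<open>r\<close>; the constant factor cancels the value
    \<open>exp (- inverse (r\<^sup>2))\<close> at the centre.\<close>
  define \<beta> where "\<beta> x = flat_fun 0 (r\<^sup>2 + - ((x - x0) \<bullet> (x - x0))) * exp (inverse (r\<^sup>2))" for x
  have Ck: "Ck_on k UNIV \<beta>" for k
  proof -
    have "Ck_on k UNIV (\<lambda>x. x + (- x0))"
      by (intro Ck_on_add Ck_on_ident Ck_on_const open_UNIV)
    then have d: "Ck_on k UNIV (\<lambda>x. x - x0)" by simp
    have "Ck_on k UNIV (\<lambda>x. r\<^sup>2 + - ((x - x0) \<bullet> (x - x0)))"
      by (intro Ck_on_add Ck_on_bounded_linear[OF bounded_linear_minus[OF bounded_linear_ident]]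
          Ck_on_inner d Ck_on_const open_UNIV)
    then have "Ck_on k UNIV (\<lambda>x. flat_fun 0 (r\<^sup>2 + - ((x - x0) \<bullet> (x - x0))))"
      by (rule Ck_on_compose[OF Ck_on_flat_fun]) auto
    then show ?thesis unfolding \<beta>_def by (intro Ck_on_mult Ck_on_const open_UNIV)
  qed
  have one: "\<beta> x0 = 1"
    using assms by (simp add: \<beta>_def flat_fun_def exp_minus)
  have zero: "\<beta> x = 0" if "r \<le> norm (x - x0)" for x
  proof -
    have "r\<^sup>2 \<le> (x - x0) \<bullet> (x - x0)"
      using that assms by (simp add: power2_norm_eq_inner[symmetric] power_mono)
    then show ?thesis by (simp add: \<beta>_def flat_fun_def)
  qed
  show ?thesis
  proof (rule that[of \<beta>])
    show "smooth_on UNIV \<beta>" using Ck by (simp add: smooth_on_def)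
  qed (fact one zero)+
qed

section \<open>Tangent vectors as values of vector fields\<close>

context manifold begin

lemma zero_tangent: "(\<lambda>_. 0) \<in> tangent_space atl p"
proof -
  have "0 = jac c d p 0" if "c \<in> atl" "d \<in> atl" "p \<in> fst c" "p \<in> fst d" for c d
    using linear_0[OF jac_linear[OF that]] by simp
  then show ?thesis unfolding tangent_space_def jac_def by auto
qed

text \<open>The gradient condition speaks about vector fields only. A constant-coefficient field in
  one chart, cut off by a bump function, realizes any prescribed vector at \<open>p\<close> and so
  gives the pointwise identity \<open>gradient_eq\<close>.\<close>

lemma extend_tangent_vector:
  assumes u: "u \<in> tangent_space atl p"
  obtains X where "vector_field atl U X" "X p = u"
proof -
  obtain c where c: "c \<in> atl" "p \<in> fst c" by (rule ex_chart)
  obtain r where r: "0 < r" "cball (snd c p) r \<subseteq> snd c ` fst c"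
    using chart_open(2)[OF c(1)] c(2) open_contains_cball by (metis imageI)
  obtain \<beta> :: "real ^ 'n \<Rightarrow> real" where \<beta>: "smooth_on UNIV \<beta>" "\<beta> (snd c p) = 1"
      "\<And>x. r \<le> norm (x - snd c p) \<Longrightarrow> \<beta> x = 0"
    using ex_bump_function[OF r(1)] by blast
  define X where "X q = (if q \<in> fst c then vec_of_comps atl c q (\<beta> (snd c q) *\<^sub>R u c) else (\<lambda>_. 0))" for q
  define C where "C = chart_inv c ` cball (snd c p) r"
  have "compact C" unfolding C_def
    by (rule compact_continuous_image[OF continuous_on_subset[OF homeomorphism_cont2[OF chart_homeo[OF c(1)]] r(2)]]) simp
  \<comment> \<open>The Hausdorff property enters here: compact support inside the chart is closed
    in the manifold, so a point outside the chart has a neighbourhood on which \<open>X\<close>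
    vanishes.\<close>
  then have C: "closed C" by (rule compact_imp_closed)
  have X0: "X q = (\<lambda>_. 0)" if "q \<notin> C" for q
  proof (cases "q \<in> fst c")
    case True
    have "snd c q \<notin> cball (snd c p) r"
      using that chart_inv_left[OF c(1) True] unfolding C_def by (metis imageI)
    then have "\<beta> (snd c q) = 0" using \<beta>(3) by (simp add: dist_norm norm_minus_commute)
    then show ?thesis
      using vec_of_comps_scale[OF c(1) True, of 0] by (auto simp: X_def)
  qed (simp add: X_def)
  have tangent: "X q \<in> tangent_space atl q" for q
    using vec_of_comps_tangent[OF c(1)] zero_tangent by (simp add: X_def)
  have smooth: "Ck_on k (snd d ` (fst d \<inter> U)) (\<lambda>x. X (chart_inv d x) d)" if d: "d \<in> atl" for d k
  proof (rule Ck_on_local)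
    fix x assume "x \<in> snd d ` (fst d \<inter> U)"
    then obtain q where q: "q \<in> fst d" "x = snd d q" by auto
    show "\<exists>T. open T \<and> x \<in> T \<and> Ck_on k T (\<lambda>x. X (chart_inv d x) d)"
    proof (cases "q \<in> fst c")
      case True
      define T where "T = snd d ` (fst d \<inter> fst c)"
      have T: "open T" unfolding T_def by (rule chart_image_open[OF d chart_open(1)[OF c(1)]])
      have dc: "Ck_on k T (transition d c)"
        using smooth_transition[OF d c(1)] by (simp add: smooth_on_def T_def)
      have "Ck_on k T (\<lambda>x. frechet_derivative (transition c d) (at (transition d c x)) (\<beta> (transition d c x) *\<^sub>R u c))"
      proof (rule Ck_on_dir_deriv[OF _ dc _ _ T])
        show "Ck_on (Suc k) (snd c ` (fst c \<inter> fst d)) (transition c d)"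
          using smooth_transition[OF c(1) d] by (simp only: smooth_on_def)
        have "Ck_on k UNIV \<beta>" using \<beta>(1) by (simp add: smooth_on_def)
        then have "Ck_on k T (\<lambda>x. \<beta> (transition d c x))"
          by (rule Ck_on_compose[OF _ dc]) (use T in auto)
        then show "Ck_on k T (\<lambda>x. \<beta> (transition d c x) *\<^sub>R u c)"
          by (intro Ck_on_scaleR Ck_on_const T)
        show "transition d c ` T \<subseteq> snd c ` (fst c \<inter> fst d)"
          by (auto simp: T_def transition_apply[OF d])
      qed
      moreover have "X (chart_inv d y) d =
          frechet_derivative (transition c d) (at (transition d c y)) (\<beta> (transition d c y) *\<^sub>R u c)"
        if "y \<in> T" for y
        using that c(1) d
        by (auto simp: T_def X_def chart_inv_left vec_of_comps_apply jac_def transition_apply)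
      ultimately have "Ck_on k T (\<lambda>x. X (chart_inv d x) d)"
        by (rule Ck_on_congI[OF _ T])
      moreover have "x \<in> T" using q True by (simp add: T_def)
      ultimately show ?thesis using T by blast
    next
      case False
      define T where "T = snd d ` (fst d \<inter> - C)"
      have T: "open T" unfolding T_def by (rule chart_image_open[OF d]) (use C in auto)
      have "q \<notin> C" using False r(2) chart_inv_mem[OF c(1)] by (auto simp: C_def)
      then have "x \<in> T" using q by (simp add: T_def)
      moreover have "Ck_on k T (\<lambda>x. X (chart_inv d x) d)"
        by (rule Ck_on_congI[OF Ck_on_const[of k T 0] T])
          (use X0 d in \<open>auto simp: T_def chart_inv_left\<close>)
      ultimately show ?thesis using T by blast
    qed
  qed
  have "vector_field atl U X"
    unfolding vector_field_def smooth_on_def using tangent smooth by blast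
  moreover have "X p = u"
    using tangent_eq_vec_of_comps[OF u c] c(2) \<beta>(2) by (simp add: X_def)
  ultimately show ?thesis by (rule that)
qed

lemma gradient_eq:
  assumes "is_gradient atl A L U f N" "p \<in> U" "u \<in> tangent_space atl p"
  shows "fundamental_tensor atl A L (p, N p) (N p) u = differential atl f p u"
proof -
  obtain X where X: "vector_field atl U X" "X p = u" using extend_tangent_vector[OF assms(3)] .
  have "\<forall>X. vector_field atl U X \<longrightarrow>
      (\<forall>p\<in>U. fundamental_tensor atl A L (p, N p) (N p) (X p) = differential atl f p (X p))"
    using assms(1) unfolding is_gradient_def by blast
  from this[rule_format, OF X(1) assms(2)] show ?thesis by (simp add: X(2))
qed

end

section \<open>The fundamental tensor at a null vector\<close>

lemma bilinear_sum_diagonal: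
  fixes B :: "'v::real_vector \<Rightarrow> 'v \<Rightarrow> real" and E :: "'n::finite \<Rightarrow> 'v"
  assumes B: "bilinear B" and E: "\<And>i j. B (E i) (E j) = (if i = j then h i else 0)"
  shows "B (\<Sum>i\<in>UNIV. a i *\<^sub>R E i) (\<Sum>j\<in>UNIV. b j *\<^sub>R E j) = (\<Sum>i\<in>UNIV. a i * b i * h i)"
proof -
  have l: "linear (B x)" "linear (\<lambda>x. B x y)" for x y using B by (auto simp: bilinear_def)
  have "B (\<Sum>i\<in>UNIV. a i *\<^sub>R E i) (\<Sum>j\<in>UNIV. b j *\<^sub>R E j) =
      (\<Sum>i\<in>UNIV. a i * B (E i) (\<Sum>j\<in>UNIV. b j *\<^sub>R E j))"
    by (simp only: linear_sum[OF l(2)] linear_cmul[OF l(2)] real_scaleR_def)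
  also have "\<dots> = (\<Sum>i\<in>UNIV. \<Sum>j\<in>UNIV. a i * (b j * B (E i) (E j)))"
    by (simp only: linear_sum[OF l(1)] linear_cmul[OF l(1)] real_scaleR_def sum_distrib_left)
  also have "\<dots> = (\<Sum>i\<in>UNIV. a i * b i * h i)"
    by (rule sum.cong[OF refl]) (simp add: E if_distrib cong: if_cong)
  finally show ?thesis .
qed

locale lorentz_form =
  fixes B :: "'v::real_vector \<Rightarrow> 'v \<Rightarrow> real" and E :: "'n::finite \<Rightarrow> 'v" and i0 :: 'n
  assumes bilinear: "bilinear B"
    and diagonal: "\<And>i j. B (E i) (E j) = (if i = j then if i = i0 then 1 else - 1 else 0)"
    and spanning: "\<And>x. \<exists>a. x = (\<Sum>i\<in>UNIV. a i *\<^sub>R E i)"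
begin

lemmas expand = bilinear_sum_diagonal[OF bilinear diagonal]

lemma symmetric: "B x y = B y x"
proof -
  obtain a b where "x = (\<Sum>i\<in>UNIV. a i *\<^sub>R E i)" "y = (\<Sum>i\<in>UNIV. b i *\<^sub>R E i)"
    using spanning by metis
  then show ?thesis by (simp only: expand mult.commute)
qed

lemma nondegenerate:
  assumes "\<And>y. B x y = 0"
  shows "x = 0"
proof -
  obtain a where a: "x = (\<Sum>i\<in>UNIV. a i *\<^sub>R E i)" using spanning by metis
  have "a j = 0" for j
  proof -
    have "B x (\<Sum>i\<in>UNIV. (if i = j then 1 else 0) *\<^sub>R E i) = 0" by (rule assms)
    then have "(\<Sum>i\<in>UNIV. a i * (if i = j then 1 else 0) * (if i = i0 then 1 else - 1)) = 0"
      unfolding a expand .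
    also have "(\<Sum>i\<in>UNIV. a i * (if i = j then 1 else 0) * (if i = i0 then 1 else - 1)) =
        (\<Sum>i\<in>UNIV. if i = j then a i * (if i = i0 then 1 else - 1) else 0)"
      by (rule sum.cong) auto
    finally show ?thesis by (simp split: if_splits)
  qed
  then show ?thesis by (simp add: a)
qed

text \<open>Subtracting a multiple of the null vector \<open>x\<close> from \<open>y\<close> does not change \<open>B y y\<close> and makes the
  coefficient of the timelike basis vector vanish.\<close>

lemma negative_on_null_orthogonal:
  assumes "B x x = 0" "x \<noteq> 0" "B x y = 0" "\<And>k. y \<noteq> k *\<^sub>R x"
  shows "B y y < 0"
proof -
  have l: "linear (B x)" "linear (\<lambda>x. B x y)" for x y using bilinear by (auto simp: bilinear_def)
  obtain a b where a: "x = (\<Sum>i\<in>UNIV. a i *\<^sub>R E i)" and b: "y = (\<Sum>i\<in>UNIV. b i *\<^sub>R E i)"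
    using spanning by metis
  have neg: "B z z = - (\<Sum>i\<in>UNIV. (d i)\<^sup>2)"
    if "z = (\<Sum>i\<in>UNIV. d i *\<^sub>R E i)" "d i0 = 0" for z d
  proof -
    have "B z z = (\<Sum>i\<in>UNIV. - (d i)\<^sup>2)"
      unfolding that(1) expand by (rule sum.cong) (auto simp: power2_eq_square that(2))
    then show ?thesis by (simp add: sum_negf)
  qed
  have zero: "z = 0" if "z = (\<Sum>i\<in>UNIV. d i *\<^sub>R E i)" "d i0 = 0" "B z z = 0" for z d
  proof -
    have "(\<Sum>i\<in>UNIV. (d i)\<^sup>2) = 0" using neg[OF that(1,2)] that(3) by simp
    then have "d i = 0" for i by (simp add: sum_nonneg_eq_0_iff)
    then show ?thesis using that(1) by simp
  qed
  have a0: "a i0 \<noteq> 0" using zero[OF a] assms(1,2) by blast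
  define k where "k = b i0 / a i0"
  define z where "z = y - k *\<^sub>R x"
  define d where "d i = b i - k * a i" for i
  have z: "z = (\<Sum>i\<in>UNIV. d i *\<^sub>R E i)"
    unfolding z_def a b d_def
    by (simp add: scaleR_sum_right sum_subtractf[symmetric] algebra_simps)
  have d0: "d i0 = 0" using a0 by (simp add: d_def k_def)
  have "B z z = B y y - k * B y x - k * (B x y - k * B x x)"
    unfolding z_def
    by (simp add: linear_diff[OF l(1)] linear_diff[OF l(2)] linear_cmul[OF l(1)] linear_cmul[OF l(2)] algebra_simps)
  then have Bz: "B z z = B y y" using assms(1,3) symmetric[of y x] by simp
  have "B z z \<le> 0" unfolding neg[OF z d0] by (simp add: sum_nonneg)
  moreover have "B z z \<noteq> 0" using zero[OF z d0] assms(4)[of k] by (auto simp: z_def)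
  ultimately show ?thesis using Bz by linarith
qed

end

lemma has_derivative_along_line:
  fixes f :: "'a::real_normed_vector \<Rightarrow> real"
  assumes "(f has_derivative f') (at y)"
  shows "((\<lambda>t. f (y + t *\<^sub>R v)) has_real_derivative f' v) (at 0)"
proof -
  have "((\<lambda>t. y + t *\<^sub>R v) has_derivative (\<lambda>t. t *\<^sub>R v)) (at 0)"
    by (auto intro!: derivative_eq_intros)
  moreover have "(f has_derivative f') (at (y + 0 *\<^sub>R v))" using assms by simp
  ultimately have "((\<lambda>t. f (y + t *\<^sub>R v)) has_derivative (\<lambda>t. f' (t *\<^sub>R v))) (at 0)"
    using diff_chain_at[of "\<lambda>t. y + t *\<^sub>R v" "\<lambda>t. t *\<^sub>R v" 0 f f'] by (simp add: o_def)
  moreover have "(\<lambda>t. f' (t *\<^sub>R v)) = (*) (f' v)"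
    using linear_cmul[OF has_derivative_linear[OF assms]] by (simp add: fun_eq_iff mult.commute)
  ultimately show ?thesis by (simp only: has_field_derivative_def)
qed

section \<open>Dilations of the slit bundle, and the fundamental tensor in fibre coordinates\<close>

context manifold begin

lemma topspace_slit: "topspace (slit_topology atl) = slit_bundle atl"
proof -
  have "bundle_coords atl c (tangent_bundle atl) = (snd c ` fst c) \<times> UNIV" if "c \<in> atl" for c
    using vec_of_comps_tangent[OF that] chart_inv_mem[OF that]
    by (auto simp: bundle_coords_def bundle_param_def tangent_bundle_def)
  then have "openin (tangent_topology atl) (tangent_bundle atl)"
    unfolding openin_tangent_topology using chart_open by (auto simp: open_Times)
  then have "tangent_bundle atl \<subseteq> topspace (tangent_topology atl)" by (rule openin_subset)
  then show ?thesis by (auto simp: slit_topology_def slit_bundle_def)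
qed

lemma vec_of_comps_nonzero:
  assumes "c \<in> atl" "p \<in> fst c"
  shows "vec_of_comps atl c p \<xi> \<noteq> (\<lambda>_. 0) \<longleftrightarrow> \<xi> \<noteq> 0"
  using vec_of_comps_scale[OF assms, of 0 0] vec_of_comps_self[OF assms, of \<xi>] by auto

lemma bundle_coords_open:
  assumes "openin (slit_topology atl) W" "c \<in> atl"
  shows "open (bundle_coords atl c W)"
proof -
  obtain T where T: "openin (tangent_topology atl) T" "W = T \<inter> slit_bundle atl"
    using assms(1) unfolding slit_topology_def openin_subtopology by blast
  have "bundle_coords atl c W = bundle_coords atl c T \<inter> (UNIV \<times> (- {0}))"
    using vec_of_comps_tangent[OF assms(2)] vec_of_comps_nonzero[OF assms(2)] chart_inv_mem[OF assms(2)]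
    by (auto simp: T(2) bundle_coords_def bundle_param_def slit_bundle_def tangent_bundle_def)
  moreover have "open (bundle_coords atl c T)" using T(1) assms(2) by (simp add: openin_tangent_topology)
  ultimately show ?thesis
    by (simp only:) (intro open_Int open_Times open_UNIV open_Compl closed_singleton)
qed

definition dilate :: "real \<Rightarrow> 'm \<times> ('m, 'n) tvec \<Rightarrow> 'm \<times> ('m, 'n) tvec" where
  "dilate r v = (fst v, \<lambda>c. r *\<^sub>R snd v c)"

lemma dilate_slit:
  assumes "0 < r" "v \<in> slit_bundle atl"
  shows "dilate r v \<in> slit_bundle atl"
proof -
  have v: "snd v \<in> tangent_space atl (fst v)" "snd v \<noteq> (\<lambda>_. 0)"
    using assms(2) by (auto simp: slit_bundle_def tangent_bundle_def)
  obtain c where c: "c \<in> atl" "fst v \<in> fst c" by (rule ex_chart)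
  have "(\<lambda>d. r *\<^sub>R snd v d) = vec_of_comps atl c (fst v) (r *\<^sub>R snd v c)"
    by (subst tangent_eq_vec_of_comps[OF v(1) c]) (simp add: vec_of_comps_scale[OF c] fun_eq_iff)
  then have "(\<lambda>d. r *\<^sub>R snd v d) \<in> tangent_space atl (fst v)"
    by (simp add: vec_of_comps_tangent[OF c])
  moreover have "(\<lambda>d. r *\<^sub>R snd v d) \<noteq> (\<lambda>_. 0)" using v(2) assms(1) by (auto simp: fun_eq_iff)
  ultimately show ?thesis by (simp add: dilate_def slit_bundle_def tangent_bundle_def)
qed

text \<open>Continuity of dilation: in every bundle chart it is the linear map that multiplies the
  fibre coordinate by \<open>r\<close>.\<close>

lemma openin_dilate_preimage:
  assumes "openin (slit_topology atl) W" "0 < r"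
  shows "openin (slit_topology atl) {v \<in> slit_bundle atl. dilate r v \<in> W}"
proof -
  define W' where "W' = {v \<in> slit_bundle atl. dilate r v \<in> W}"
  have W: "W \<subseteq> slit_bundle atl" using openin_subset[OF assms(1)] by (simp add: topspace_slit)
  have "open (bundle_coords atl c W')" if c: "c \<in> atl" for c
  proof -
    have "bundle_coords atl c W' = (\<lambda>z. (fst z, r *\<^sub>R snd z)) -` bundle_coords atl c W"
    proof (rule set_eqI)
      fix z
      show "z \<in> bundle_coords atl c W' \<longleftrightarrow> z \<in> (\<lambda>z. (fst z, r *\<^sub>R snd z)) -` bundle_coords atl c W"
      proof (cases "fst z \<in> snd c ` fst c")
        case True
        define q where "q = chart_inv c (fst z)"
        have q: "q \<in> fst c" unfolding q_def by (rule chart_inv_mem[OF c True])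
        have sc: "bundle_param atl c (fst z, r *\<^sub>R snd z) = dilate r (bundle_param atl c z)"
          using vec_of_comps_scale[OF c q]
          by (simp add: bundle_param_def dilate_def q_def[symmetric] fun_eq_iff)
        have "bundle_param atl c z \<in> slit_bundle atl" if "dilate r (bundle_param atl c z) \<in> W"
        proof -
          have "dilate r (bundle_param atl c z) \<in> slit_bundle atl" using that W by blast
          then have "vec_of_comps atl c q (snd z) \<noteq> (\<lambda>_. 0)"
            by (auto simp: slit_bundle_def dilate_def bundle_param_def q_def)
          then show ?thesis
            using vec_of_comps_tangent[OF c q]
            by (simp add: slit_bundle_def tangent_bundle_def bundle_param_def q_def)
        qed
        then show ?thesis using True sc by (auto simp: bundle_coords_def W'_def)
      qed (simp add: bundle_coords_def)
    qed
    moreover have "open ((\<lambda>z. (fst z, r *\<^sub>R snd z)) -` bundle_coords atl c W)"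
      by (rule open_vimage[OF bundle_coords_open[OF assms(1) c]]) (intro continuous_intros)
    ultimately show ?thesis by simp
  qed
  then have "openin (tangent_topology atl) W'"
    unfolding openin_tangent_topology by (auto simp: W'_def slit_bundle_def)
  moreover have "W' = W' \<inter> slit_bundle atl" by (auto simp: W'_def)
  ultimately show ?thesis
    unfolding slit_topology_def openin_subtopology W'_def[symmetric] by blast
qed

text \<open>Pulling a neighbourhood of \<open>dilate r v\<close> back to \<open>v\<close> meets
  \<open>A\<close>, and \<open>A\<close> is conic. Thus the whole ray through a null vector stays
  where the extension is tied to \<open>L\<close>.\<close>

lemma cone_closure_dilate:
  assumes A: "\<And>v r. v \<in> A \<Longrightarrow> 0 < r \<Longrightarrow> dilate r v \<in> A"
    and v: "v \<in> cone_closure atl A" and r: "0 < r"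
  shows "dilate r v \<in> cone_closure atl A"
  unfolding cone_closure_def in_closure_of
proof (intro conjI allI impI)
  have vs: "v \<in> slit_bundle atl"
    using v unfolding cone_closure_def in_closure_of topspace_slit by blast
  then show "dilate r v \<in> topspace (slit_topology atl)" using dilate_slit[OF r] by (simp add: topspace_slit)
  fix T assume T: "dilate r v \<in> T \<and> openin (slit_topology atl) T"
  define T' where "T' = {w \<in> slit_bundle atl. dilate r w \<in> T}"
  have "openin (slit_topology atl) T'" unfolding T'_def using T r by (intro openin_dilate_preimage) auto
  moreover have "v \<in> T'" using vs T by (simp add: T'_def)
  ultimately obtain y where "y \<in> A" "y \<in> T'"
    using v unfolding cone_closure_def in_closure_of by blast
  then show "\<exists>y. y \<in> A \<and> y \<in> T" using A[OF _ r] unfolding T'_def by blast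
qed

text \<open>The extension selected by \<open>SOME\<close> in the definition is read in fibre
  coordinates over \<open>p\<close> as \<open>\<Phi>\<close>, retaining its agreement with
  \<open>L\<close> on the closure. The iterated one-variable derivatives then become a second
  Frechet derivative, taken first along \<open>u\<close> and then along \<open>w\<close>.\<close>

lemma fundamental_tensor_in_chart:
  assumes ext: "\<exists>F. local_extension atl A L (p, \<nu>) F" and c: "c \<in> atl" "p \<in> fst c"
    and \<nu>: "\<nu> \<in> tangent_space atl p"
  obtains \<Phi> S where "open S" "\<nu> c \<in> S" "smooth_on S \<Phi>"
    "\<And>\<xi>. \<xi> \<in> S \<Longrightarrow> (p, vec_of_comps atl c p \<xi>) \<in> cone_closure atl A \<Longrightarrow>
      \<Phi> \<xi> = L (p, vec_of_comps atl c p \<xi>)"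
    "\<And>u w. u \<in> tangent_space atl p \<Longrightarrow> w \<in> tangent_space atl p \<Longrightarrow>
      fundamental_tensor atl A L (p, \<nu>) u w =
      1 / 2 * frechet_derivative (\<lambda>\<eta>. frechet_derivative \<Phi> (at \<eta>) (u c)) (at (\<nu> c)) (w c)"
proof -
  define F where "F = (SOME F. local_extension atl A L (p, \<nu>) F)"
  have "local_extension atl A L (p, \<nu>) F" unfolding F_def using ext by (rule someI_ex)
  then obtain W where W: "openin (slit_topology atl) W" "(p, \<nu>) \<in> W" "smooth_on_bundle atl W F"
      "\<And>w. w \<in> W \<Longrightarrow> w \<in> cone_closure atl A \<Longrightarrow> F w = L w"
    unfolding local_extension_def by blast
  define S where "S = (\<lambda>\<xi>. (snd c p, \<xi>)) -` bundle_coords atl c W"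
  define \<Phi> where "\<Phi> = (\<lambda>\<xi>. F (p, vec_of_comps atl c p \<xi>))"
  have param: "bundle_param atl c (snd c p, \<xi>) = (p, vec_of_comps atl c p \<xi>)" for \<xi>
    by (simp add: bundle_param_def chart_inv_left[OF c])
  have S: "open S"
    unfolding S_def by (rule open_vimage[OF bundle_coords_open[OF W(1) c(1)]]) (intro continuous_intros)
  have S_iff: "\<xi> \<in> S \<longleftrightarrow> (p, vec_of_comps atl c p \<xi>) \<in> W" for \<xi>
    using c by (simp add: S_def bundle_coords_def param)
  have \<nu>S: "\<nu> c \<in> S"
    using W(2) tangent_eq_vec_of_comps[OF \<nu> c] by (simp add: S_iff)
  have Ck: "Ck_on k S \<Phi>" for k
  proof -
    have "Ck_on k (bundle_coords atl c W) (F \<circ> bundle_param atl c)"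
      using W(3) c(1) by (simp add: smooth_on_bundle_def smooth_on_def)
    moreover have "Ck_on k S (\<lambda>\<xi>. (snd c p, \<xi>))"
      by (intro Ck_on_Pair Ck_on_const Ck_on_ident S)
    ultimately have "Ck_on k S (\<lambda>\<xi>. (F \<circ> bundle_param atl c) (snd c p, \<xi>))"
      by (rule Ck_on_compose[OF _ _ _ S]) (auto simp: S_def)
    then show ?thesis by (simp add: \<Phi>_def param)
  qed
  have der: "(\<Phi> has_derivative frechet_derivative \<Phi> (at \<eta>)) (at \<eta>)" if "\<eta> \<in> S" for \<eta>
    by (rule Ck_on_SucD[OF Ck that])
  have der2: "((\<lambda>\<eta>. frechet_derivative \<Phi> (at \<eta>) \<mu>) has_derivative
      frechet_derivative (\<lambda>\<eta>. frechet_derivative \<Phi> (at \<eta>) \<mu>) (at \<eta>)) (at \<eta>)" if "\<eta> \<in> S" for \<eta> \<mu>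
  proof -
    have "Ck_on (Suc 0) S (\<lambda>\<eta>. frechet_derivative \<Phi> (at \<eta>) \<mu>)"
      using Ck[of "Suc (Suc 0)"] by (simp only: Ck_on.simps(2)[of "Suc 0"])
    then show ?thesis using that by (rule Ck_on_SucD)
  qed
  show ?thesis
  proof (rule that[of S \<Phi>])
    show "smooth_on S \<Phi>" using Ck by (simp add: smooth_on_def)
    show "\<Phi> \<xi> = L (p, vec_of_comps atl c p \<xi>)"
      if "\<xi> \<in> S" "(p, vec_of_comps atl c p \<xi>) \<in> cone_closure atl A" for \<xi>
      using that W(4) by (simp add: \<Phi>_def S_iff)
    fix u w assume u: "u \<in> tangent_space atl p" and w: "w \<in> tangent_space atl p"
    have F_eq: "F (p, \<lambda>d. \<nu> d + t *\<^sub>R u d + s *\<^sub>R w d) = \<Phi> ((\<nu> c + s *\<^sub>R w c) + t *\<^sub>R u c)" for t s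
    proof -
      have "\<nu> d + t *\<^sub>R u d + s *\<^sub>R w d = vec_of_comps atl c p ((\<nu> c + s *\<^sub>R w c) + t *\<^sub>R u c) d" for d
        using fun_cong[OF tangent_eq_vec_of_comps[OF \<nu> c], of d]
          fun_cong[OF tangent_eq_vec_of_comps[OF u c], of d]
          fun_cong[OF tangent_eq_vec_of_comps[OF w c], of d]
        by (simp add: vec_of_comps_add[OF c] vec_of_comps_scale[OF c])
      then show ?thesis by (simp add: \<Phi>_def)
    qed
    have inner: "deriv (\<lambda>t. \<Phi> ((\<nu> c + s *\<^sub>R w c) + t *\<^sub>R u c)) 0 = frechet_derivative \<Phi> (at (\<nu> c + s *\<^sub>R w c)) (u c)"
      if "\<nu> c + s *\<^sub>R w c \<in> S" for s
      by (rule DERIV_imp_deriv[OF has_derivative_along_line[OF der[OF that]]])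
    \<comment> \<open>The inner derivative is identified only while
      \<open>\<nu> c + s *\<^sub>R w c\<close> stays in \<open>S\<close>; this holds for
      \<open>s\<close> near 0, which is enough for the outer derivative at 0.\<close>
    have line: "open ((\<lambda>s. \<nu> c + s *\<^sub>R w c) -` S)"
      by (rule open_vimage[OF S]) (intro continuous_intros)
    have mem: "0 \<in> (\<lambda>s. \<nu> c + s *\<^sub>R w c) -` S" using \<nu>S by simp
    have deriv: "frechet_derivative \<Phi> (at (\<nu> c + s *\<^sub>R w c)) (u c) =
        deriv (\<lambda>t. F (fst (p, \<nu>), \<lambda>d. snd (p, \<nu>) d + t *\<^sub>R u d + s *\<^sub>R w d)) 0" if "s \<in> (\<lambda>s. \<nu> c + s *\<^sub>R w c) -` S" for s
      using inner[of s] that by (simp add: F_eq)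
    have "((\<lambda>s. deriv (\<lambda>t. F (fst (p, \<nu>), \<lambda>d. snd (p, \<nu>) d + t *\<^sub>R u d + s *\<^sub>R w d)) 0)
        has_real_derivative frechet_derivative (\<lambda>\<eta>. frechet_derivative \<Phi> (at \<eta>) (u c)) (at (\<nu> c)) (w c)) (at 0)"
      by (rule has_field_derivative_transform_within_open[OF has_derivative_along_line[OF der2[OF \<nu>S]] line mem deriv])
    from DERIV_imp_deriv[OF this]
    show "fundamental_tensor atl A L (p, \<nu>) u w =
      1 / 2 * frechet_derivative (\<lambda>\<eta>. frechet_derivative \<Phi> (at \<eta>) (u c)) (at (\<nu> c)) (w c)"
      unfolding fundamental_tensor_def Let_def F_def[symmetric] by simp
  qed (fact S \<nu>S)+
qed

text \<open>Linearity in the second slot is that of a Frechet derivative. In the first slot the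
  direction sits inside the differentiated function, and linearity follows from uniqueness of
  derivatives.\<close>

lemma fundamental_tensor_bilinear:
  assumes "\<exists>F. local_extension atl A L (p, \<nu>) F" "c \<in> atl" "p \<in> fst c" "\<nu> \<in> tangent_space atl p"
  obtains B where "bilinear B"
    "\<And>u w. u \<in> tangent_space atl p \<Longrightarrow> w \<in> tangent_space atl p \<Longrightarrow>
      fundamental_tensor atl A L (p, \<nu>) u w = B (u c) (w c)"
proof -
  obtain \<Phi> S where S: "open S" "\<nu> c \<in> S" "smooth_on S \<Phi>"
    and eq: "\<And>u w. u \<in> tangent_space atl p \<Longrightarrow> w \<in> tangent_space atl p \<Longrightarrow>
      fundamental_tensor atl A L (p, \<nu>) u w =
      1 / 2 * frechet_derivative (\<lambda>\<eta>. frechet_derivative \<Phi> (at \<eta>) (u c)) (at (\<nu> c)) (w c)"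
    by (rule fundamental_tensor_in_chart[OF assms]) blast
  define D where "D \<mu> = frechet_derivative (\<lambda>\<eta>. frechet_derivative \<Phi> (at \<eta>) \<mu>) (at (\<nu> c))" for \<mu>
  have Ck: "Ck_on k S \<Phi>" for k using S(3) by (simp add: smooth_on_def)
  have lin1: "linear (frechet_derivative \<Phi> (at \<eta>))" if "\<eta> \<in> S" for \<eta>
    by (rule Ck_on_Suc_linear_frechet[OF Ck that])
  have D: "((\<lambda>\<eta>. frechet_derivative \<Phi> (at \<eta>) \<mu>) has_derivative D \<mu>) (at (\<nu> c))" for \<mu>
  proof -
    have "Ck_on (Suc 0) S (\<lambda>\<eta>. frechet_derivative \<Phi> (at \<eta>) \<mu>)"
      using Ck[of "Suc (Suc 0)"] by (simp only: Ck_on.simps(2)[of "Suc 0"])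
    then show ?thesis unfolding D_def using S(2) by (rule Ck_on_SucD)
  qed
  have add: "D (\<mu> + \<mu>') \<omega> = D \<mu> \<omega> + D \<mu>' \<omega>" for \<mu> \<mu>' \<omega>
  proof -
    have "((\<lambda>\<eta>. frechet_derivative \<Phi> (at \<eta>) (\<mu> + \<mu>')) has_derivative (\<lambda>\<omega>. D \<mu> \<omega> + D \<mu>' \<omega>)) (at (\<nu> c))"
      by (rule has_derivative_transform_within_open[OF has_derivative_add[OF D D] S(1,2)])
        (simp add: linear_add[OF lin1])
    from has_derivative_unique[OF D this] show ?thesis by (simp add: fun_eq_iff)
  qed
  have scale: "D (r *\<^sub>R \<mu>) \<omega> = r *\<^sub>R D \<mu> \<omega>" for r \<mu> \<omega>
  proof -
    have "((\<lambda>\<eta>. frechet_derivative \<Phi> (at \<eta>) (r *\<^sub>R \<mu>)) has_derivative (\<lambda>\<omega>. r *\<^sub>R D \<mu> \<omega>)) (at (\<nu> c))"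
      by (rule has_derivative_transform_within_open[OF has_derivative_scaleR_right[OF D] S(1,2)])
        (simp add: linear_cmul[OF lin1])
    from has_derivative_unique[OF D this] show ?thesis by (simp add: fun_eq_iff)
  qed
  have lin2: "linear (D \<mu>)" for \<mu> using D has_derivative_linear by blast
  show ?thesis
  proof (rule that[of "\<lambda>\<mu> \<omega>. 1 / 2 * D \<mu> \<omega>"])
    show "bilinear (\<lambda>\<mu> \<omega>. 1 / 2 * D \<mu> \<omega>)"
      unfolding bilinear_def
    proof (intro conjI allI)
      show "linear (\<lambda>\<omega>. 1 / 2 * D \<mu> \<omega>)" for \<mu>
        by (rule linearI) (simp_all add: linear_add[OF lin2] linear_cmul[OF lin2])
      show "linear (\<lambda>\<mu>. 1 / 2 * D \<mu> \<omega>)" for \<omega>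
        by (rule linearI) (simp_all add: add scale)
    qed
  qed (simp add: eq D_def)
qed

text \<open>The null case of Euler's relation: \<open>\<Phi>\<close> agrees with \<open>L\<close> on
  the part of the ray through \<open>\<nu>\<close> lying in \<open>S\<close>, hence vanishes there,
  and so does its second radial derivative.\<close>

lemma fundamental_tensor_null:
  assumes ext: "\<exists>F. local_extension atl A L (p, \<nu>) F" and \<nu>: "\<nu> \<in> tangent_space atl p"
    and null: "\<And>r. 0 < r \<Longrightarrow> dilate r (p, \<nu>) \<in> cone_closure atl A \<and> L (dilate r (p, \<nu>)) = 0"
  shows "fundamental_tensor atl A L (p, \<nu>) \<nu> \<nu> = 0"
proof -
  obtain c where c: "c \<in> atl" "p \<in> fst c" by (rule ex_chart)
  obtain \<Phi> S where S: "open S" "\<nu> c \<in> S" "smooth_on S \<Phi>"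
    and L: "\<And>\<xi>. \<xi> \<in> S \<Longrightarrow> (p, vec_of_comps atl c p \<xi>) \<in> cone_closure atl A \<Longrightarrow>
      \<Phi> \<xi> = L (p, vec_of_comps atl c p \<xi>)"
    and eq: "\<And>u w. u \<in> tangent_space atl p \<Longrightarrow> w \<in> tangent_space atl p \<Longrightarrow>
      fundamental_tensor atl A L (p, \<nu>) u w =
      1 / 2 * frechet_derivative (\<lambda>\<eta>. frechet_derivative \<Phi> (at \<eta>) (u c)) (at (\<nu> c)) (w c)"
    by (rule fundamental_tensor_in_chart[OF ext c \<nu>]) blast
  have Ck: "Ck_on k S \<Phi>" for k using S(3) by (simp add: smooth_on_def)
  \<comment> \<open>An open set of radii containing 1. The first radial derivative has to vanish on
    all of it, not just at 1, before a second derivative can be taken.\<close>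
  define T where "T = (\<lambda>r. r *\<^sub>R \<nu> c) -` S \<inter> {0<..}"
  have T: "open T" unfolding T_def
    by (intro open_Int open_vimage[OF S(1)] open_greaterThan continuous_intros)
  have \<Phi>0: "\<Phi> (r *\<^sub>R \<nu> c) = 0" if "r \<in> T" for r
  proof -
    have r: "0 < r" "r *\<^sub>R \<nu> c \<in> S" using that by (auto simp: T_def)
    have "dilate r (p, \<nu>) = (p, vec_of_comps atl c p (r *\<^sub>R \<nu> c))"
    proof -
      have "(\<lambda>d. r *\<^sub>R \<nu> d) = vec_of_comps atl c p (r *\<^sub>R \<nu> c)"
      proof
        show "r *\<^sub>R \<nu> d = vec_of_comps atl c p (r *\<^sub>R \<nu> c) d" for d
          using vec_of_comps_scale[OF c, of r "\<nu> c" d] tangent_eq_vec_of_comps[OF \<nu> c] by argo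
      qed
      then show ?thesis by (simp only: dilate_def fst_conv snd_conv)
    qed
    then show ?thesis using L[OF r(2)] null[OF r(1)] by simp
  qed
  have line: "open ((\<lambda>s. r + s) -` T)" for r
    by (rule open_vimage[OF T]) (intro continuous_intros)
  have D0: "frechet_derivative \<Phi> (at (r *\<^sub>R \<nu> c)) (\<nu> c) = 0" if "r \<in> T" for r
  proof -
    have "r *\<^sub>R \<nu> c \<in> S" using that by (simp add: T_def)
    from has_derivative_along_line[OF Ck_on_SucD[OF Ck this], of "\<nu> c"]
    have 1: "((\<lambda>s. \<Phi> (r *\<^sub>R \<nu> c + s *\<^sub>R \<nu> c)) has_real_derivative
        frechet_derivative \<Phi> (at (r *\<^sub>R \<nu> c)) (\<nu> c)) (at 0)" .
    have "((\<lambda>s::real. 0::real) has_real_derivative 0) (at 0)" by simp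
    then have "((\<lambda>s. \<Phi> (r *\<^sub>R \<nu> c + s *\<^sub>R \<nu> c)) has_real_derivative 0) (at 0)"
      by (rule has_field_derivative_transform_within_open[OF _ line[of r]])
        (use that \<Phi>0 in \<open>auto simp: scaleR_add_left[symmetric]\<close>)
    from DERIV_unique[OF 1 this] show ?thesis .
  qed
  have "Ck_on (Suc 0) S (\<lambda>\<eta>. frechet_derivative \<Phi> (at \<eta>) (\<nu> c))"
    using Ck[of "Suc (Suc 0)"] by (simp only: Ck_on.simps(2)[of "Suc 0"])
  from has_derivative_along_line[OF Ck_on_SucD[OF this S(2)], of "\<nu> c"]
  have 2: "((\<lambda>s. frechet_derivative \<Phi> (at (\<nu> c + s *\<^sub>R \<nu> c)) (\<nu> c)) has_real_derivative
      frechet_derivative (\<lambda>\<eta>. frechet_derivative \<Phi> (at \<eta>) (\<nu> c)) (at (\<nu> c)) (\<nu> c)) (at 0)" .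
  have add1: "\<nu> c + s *\<^sub>R \<nu> c = (1 + s) *\<^sub>R \<nu> c" for s by (simp add: scaleR_add_left)
  have "((\<lambda>s::real. 0::real) has_real_derivative 0) (at 0)" by simp
  then have "((\<lambda>s. frechet_derivative \<Phi> (at (\<nu> c + s *\<^sub>R \<nu> c)) (\<nu> c)) has_real_derivative 0) (at 0)"
    by (rule has_field_derivative_transform_within_open[OF _ line[of 1]])
      (use S(2) D0 in \<open>auto simp: add1 T_def\<close>)
  from DERIV_unique[OF 2 this] show ?thesis by (simp add: eq[OF \<nu> \<nu>])
qed

end

section \<open>Adapted coordinates\<close>

lemma index_4_distinct:
  "(0::4) \<noteq> 1" "(0::4) \<noteq> 2" "(0::4) \<noteq> 3" "(1::4) \<noteq> 2" "(1::4) \<noteq> 3" "(2::4) \<noteq> 3"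
  by simp_all

text \<open>A flow box for \<open>X\<close> in which one further coordinate is replaced by
  \<open>k\<close>. As \<open>k\<close> is constant along \<open>X\<close>, the replacement leaves
  the components of \<open>X\<close> equal to \<open>axis i0 1\<close>; as its differential at
  \<open>x0\<close> is nonzero, some coordinate can be replaced without losing
  invertibility.\<close>

lemma straightening:
  fixes X :: "real ^ 'n::finite \<Rightarrow> real ^ 'n" and k :: "real ^ 'n \<Rightarrow> real" and i0 i1 :: 'n
  assumes V: "open V" "smooth_on V X" "smooth_on V k" "x0 \<in> V"
    and X0: "X x0 \<noteq> 0" and kv: "frechet_derivative k (at x0) v0 \<noteq> 0"
    and kX: "\<And>x. x \<in> V \<Longrightarrow> frechet_derivative k (at x) (X x) = 0"
    and idx: "i0 \<noteq> i1"
  obtains P Q h G where "open P" "P \<subseteq> V" "x0 \<in> P" "open Q" "homeomorphism P Q h G"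
    "smooth_on P h" "smooth_on Q G" "\<And>x. x \<in> P \<Longrightarrow> h x $ i1 = k x"
    "\<And>y. y \<in> Q \<Longrightarrow> frechet_derivative G (at y) (axis i0 1) = X (G y)"
proof -
  obtain r a \<phi> where ra: "0 < r" "0 < a" "ball x0 r \<subseteq> V" and \<phi>: "smooth_on (ball x0 r \<times> ball (0::real) a) \<phi>"
    and \<phi>0: "\<And>x. x \<in> ball x0 r \<Longrightarrow> \<phi> (x, 0) = x"
    and \<phi>V: "\<And>x t. x \<in> ball x0 r \<Longrightarrow> \<bar>t\<bar> < a \<Longrightarrow> \<phi> (x, t) \<in> V"
    and \<phi>': "\<And>x t. x \<in> ball x0 r \<Longrightarrow> \<bar>t\<bar> < a \<Longrightarrow> ((\<lambda>s. \<phi> (x, s)) has_vector_derivative X (\<phi> (x, t))) (at t)"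
    by (rule smooth_local_flow[OF V(1,2,4)]) (rule that)
  \<comment> \<open>A linear isomorphism sending \<open>axis i0 1\<close> to \<open>X x0\<close> is
    wanted: an orthogonal map between vectors of equal length, rescaled by
    \<open>norm (X x0)\<close>.\<close>
  have "norm (norm (X x0) *\<^sub>R axis i0 1 :: real ^ 'n) = norm (X x0)" by (simp add: norm_axis_1)
  then obtain R :: "real ^ 'n \<Rightarrow> real ^ 'n"
    where R: "orthogonal_transformation R" "R (norm (X x0) *\<^sub>R axis i0 1) = X x0"
    by (rule orthogonal_transformation_exists) (rule that)
  define T where "T v = norm (X x0) *\<^sub>R R v" for v
  have linR: "linear R" using R(1) by (rule orthogonal_transformation_linear)
  have T: "linear T"
    unfolding T_def by (rule linear_compose_scale_right[OF linR])
  have injT: "inj T"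
    using orthogonal_transformation_inj[OF R(1)] X0 by (auto simp: T_def inj_on_def)
  have Te: "T (axis i0 1) = X x0"
    using R(2) by (simp add: T_def linear_cmul[OF linR])
  have surjT: "surj T" by (rule linear_inj_imp_surj[OF T injT])
  have dk: "(k has_derivative frechet_derivative k (at x)) (at x)" if "x \<in> V" for x
    using smooth_onD[OF V(3) that] .
  have link: "linear (frechet_derivative k (at x))" if "x \<in> V" for x
    using dk[OF that] has_derivative_linear by blast
  \<comment> \<open>The vectors \<open>T (axis j 1)\<close> span, so the differential of
    \<open>k\<close> cannot vanish on all of them. The index found differs from \<open>i0\<close>,
    because \<open>T (axis i0 1) = X x0\<close> lies in the kernel.\<close>
  have "\<exists>j. frechet_derivative k (at x0) (T (axis j 1)) \<noteq> 0"
  proof (rule ccontr)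
    assume "\<not> ?thesis"
    then have 0: "frechet_derivative k (at x0) (T (axis j 1)) = 0" for j by blast
    obtain w where w: "v0 = T w" using surjT by blast
    have "linear (\<lambda>w. frechet_derivative k (at x0) (T w))"
      using linear_compose[OF T link[OF V(4)]] by (simp add: o_def)
    from linear_eq_sum_Basis[OF this, of w]
    have "frechet_derivative k (at x0) v0 =
        (\<Sum>b\<in>Basis. (w \<bullet> b) *\<^sub>R frechet_derivative k (at x0) (T b))" by (simp only: w)
    also have "\<dots> = 0" by (rule sum.neutral) (auto simp: Basis_vec_def 0)
    finally have "frechet_derivative k (at x0) v0 = 0" .
    then show False using kv by simp
  qed
  then obtain j where j: "frechet_derivative k (at x0) (T (axis j 1)) \<noteq> 0" by blast
  have ji0: "j \<noteq> i0" using j kX[OF V(4)] Te by auto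

  \<comment> \<open>Dropping the \<open>i0\<close> component puts the starting point on the
    hyperplane through \<open>x0\<close> spanned by the other \<open>T (axis m 1)\<close>,
    transversal to \<open>X x0\<close>; the component \<open>y $ i0\<close> becomes the flow time in
    \<open>F\<close>.\<close>
  define \<sigma> where "\<sigma> y = x0 + T (y + (- (y $ i0)) *\<^sub>R axis i0 1)" for y
  define S where "S = {y. \<sigma> y \<in> ball x0 r \<and> y $ i0 \<in> ball 0 a}"
  define F where "F y = \<phi> (\<sigma> y, y $ i0)" for y
  have blT: "bounded_linear T" using T linear_conv_bounded_linear by blast
  have bln: "bounded_linear (\<lambda>y :: real ^ 'n. y $ i0)" by (rule bounded_linear_vec_nth)
  have nthCk: "Ck_on m UNIV (\<lambda>y :: real ^ 'n. y $ i0)" for m by (rule Ck_on_linear[OF bln open_UNIV])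
  have \<sigma>Ck: "Ck_on m UNIV \<sigma>" for m
    unfolding \<sigma>_def
    by (intro Ck_on_add Ck_on_const Ck_on_bounded_linear[OF blT] Ck_on_ident Ck_on_scaleR
        Ck_on_bounded_linear[OF bounded_linear_minus[OF bounded_linear_ident]] nthCk open_UNIV)
  have pairCk: "Ck_on m UNIV (\<lambda>y. (\<sigma> y, y $ i0))" for m
    by (intro Ck_on_Pair \<sigma>Ck nthCk open_UNIV)
  have S: "open S"
  proof -
    have "S = (\<lambda>y. (\<sigma> y, y $ i0)) -` (ball x0 r \<times> ball 0 a)" by (auto simp: S_def)
    then show ?thesis
      by (simp only:) (intro open_vimage open_Times open_ball Ck_on_imp_continuous_on[OF pairCk[of 0]])
  qed
  have FCk: "Ck_on m S F" for m
    unfolding F_def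
    by (rule Ck_on_compose[OF _ Ck_on_subset[OF pairCk] _ S])
      (use \<phi> in \<open>auto simp: smooth_on_def S_def\<close>)
  have dF: "(F has_derivative frechet_derivative F (at y)) (at y)" if "y \<in> S" for y
    by (rule Ck_on_SucD[OF FCk that])
  have \<sigma>_shift: "\<sigma> (y + t *\<^sub>R axis i0 1) = \<sigma> y" for y t
    by (simp add: \<sigma>_def algebra_simps)
  have line: "((\<lambda>t. F (y + t *\<^sub>R v)) has_vector_derivative frechet_derivative F (at y) v) (at 0)"
    if "y \<in> S" for y v
  proof -
    have "((\<lambda>t. y + t *\<^sub>R v) has_derivative (\<lambda>t. t *\<^sub>R v)) (at 0)"
      by (auto intro!: derivative_eq_intros)
    moreover have "(F has_derivative frechet_derivative F (at y)) (at (y + 0 *\<^sub>R v))" using dF[OF that] by simp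
    ultimately have "((\<lambda>t. F (y + t *\<^sub>R v)) has_derivative (\<lambda>t. frechet_derivative F (at y) (t *\<^sub>R v))) (at 0)"
      using diff_chain_at[of "\<lambda>t. y + t *\<^sub>R v" "\<lambda>t. t *\<^sub>R v" 0 F] by (simp add: o_def)
    then show ?thesis
      using linear_cmul[OF has_derivative_linear[OF dF[OF that]]] by (simp add: has_vector_derivative_def)
  qed
  have DF_e: "frechet_derivative F (at y) (axis i0 1) = X (F y)" if y: "y \<in> S" for y
  proof -
    have "\<sigma> y \<in> ball x0 r" "\<bar>y $ i0\<bar> < a" using y by (auto simp: S_def)
    from \<phi>'[OF this] have der: "((\<lambda>t. \<phi> (\<sigma> y, t)) has_vector_derivative X (F y)) (at (y $ i0 + 0))"
      by (simp add: F_def)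
    have "((\<lambda>t. y $ i0 + t) has_vector_derivative 1) (at 0)"
      by (auto intro!: derivative_eq_intros)
    from vector_diff_chain_at[where g="\<lambda>t. \<phi> (\<sigma> y, t)", OF this der]
    have "((\<lambda>t. \<phi> (\<sigma> y, y $ i0 + t)) has_vector_derivative X (F y)) (at 0)"
      by (simp add: o_def)
    moreover have "F (y + t *\<^sub>R axis i0 1) = \<phi> (\<sigma> y, y $ i0 + t)" for t
      unfolding F_def \<sigma>_shift by simp
    ultimately have "((\<lambda>t. F (y + t *\<^sub>R axis i0 1)) has_vector_derivative X (F y)) (at 0)" by simp
    from vector_derivative_unique_at[OF line[OF y] this] show ?thesis .
  qed
  have \<sigma>0: "\<sigma> 0 = x0" by (simp add: \<sigma>_def linear_0[OF T])
  have 0: "0 \<in> S" using ra by (simp add: S_def \<sigma>0)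
  have F0: "F 0 = x0" using \<phi>0[of x0] ra(1) by (simp add: F_def \<sigma>0)
  have lin0: "linear (frechet_derivative F (at 0))" by (rule has_derivative_linear[OF dF[OF 0]])
  \<comment> \<open>On vectors without \<open>i0\<close> component the time is 0 and
    \<open>F\<close> is affine with linear part \<open>T\<close>; along \<open>axis i0 1\<close> the
    derivative is \<open>X x0\<close>, which is also the value of \<open>T\<close>.\<close>
  have DF0: "frechet_derivative F (at 0) v = T v" for v
  proof -
    define w where "w = v + (- (v $ i0)) *\<^sub>R axis i0 1"
    have w0: "w $ i0 = 0" by (simp add: w_def)
    have "frechet_derivative F (at 0) w = T w"
    proof -
      have "((\<lambda>t. x0 + t *\<^sub>R T w) has_vector_derivative T w) (at 0)"
        by (auto intro!: derivative_eq_intros)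
      moreover have "open ((\<lambda>t. x0 + t *\<^sub>R T w) -` ball x0 r)"
        by (rule open_vimage[OF open_ball]) (intro continuous_intros)
      moreover have "(0::real) \<in> (\<lambda>t. x0 + t *\<^sub>R T w) -` ball x0 r" using ra(1) by simp
      moreover have "x0 + t *\<^sub>R T w = F (0 + t *\<^sub>R w)" if "t \<in> (\<lambda>t. x0 + t *\<^sub>R T w) -` ball x0 r" for t
        using that \<phi>0[of "x0 + t *\<^sub>R T w"] by (simp add: F_def \<sigma>_def w0 linear_cmul[OF T])
      ultimately have "((\<lambda>t. F (0 + t *\<^sub>R w)) has_vector_derivative T w) (at 0)"
        by (rule has_vector_derivative_transform_within_open)
      from vector_derivative_unique_at[OF line[OF 0] this] show ?thesis .
    qed
    moreover have "v = w + (v $ i0) *\<^sub>R axis i0 1" by (simp add: w_def)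
    moreover have "frechet_derivative F (at 0) (axis i0 1) = T (axis i0 1)"
      using DF_e[OF 0] by (simp add: F0 Te)
    ultimately show ?thesis
      by (metis linear_add[OF lin0] linear_add[OF T] linear_cmul[OF lin0] linear_cmul[OF T])
  qed
  have injDF: "inj (frechet_derivative F (at 0))" using injT by (simp add: DF0 fun_eq_iff inj_on_def)
  have Fsmooth: "smooth_on S F" using FCk by (simp add: smooth_on_def)
  obtain P1 Q1 G1 where 1: "open P1" "P1 \<subseteq> S" "0 \<in> P1" "open Q1" "homeomorphism P1 Q1 F G1" "smooth_on Q1 G1"
    "\<And>x. x \<in> Q1 \<Longrightarrow> bij (frechet_derivative F (at (G1 x)))"
    "\<And>x. x \<in> Q1 \<Longrightarrow> (G1 has_derivative inv (frechet_derivative F (at (G1 x)))) (at x)"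
    by (rule smooth_inverse_function[OF S Fsmooth 0 injDF]) (rule that)
  have x0Q1: "x0 \<in> Q1" and G1x0: "G1 x0 = 0"
    using 1(3,5) F0 by (auto simp: homeomorphism_def)
  have G1P: "G1 x \<in> P1" "F (G1 x) = x" if "x \<in> Q1" for x
    using 1(5) that by (auto simp: homeomorphism_def)
  have Q1V: "Q1 \<subseteq> V"
  proof
    fix x assume "x \<in> Q1"
    then have "G1 x \<in> S" "F (G1 x) = x" using G1P 1(2) by auto
    then show "x \<in> V" using \<phi>V[of "\<sigma> (G1 x)" "G1 x $ i0"] by (auto simp: F_def S_def)
  qed

  \<comment> \<open>Slot \<open>i1\<close> receives \<open>k\<close>, and the old coordinate
    \<open>i1\<close> moves to slot \<open>j\<close>, so exactly the old coordinate \<open>j\<close>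
    is discarded. For \<open>j = i1\<close> nothing is permuted.\<close>
  define \<tau> where "\<tau> = Transposition.transpose i1 j"
  define h where "h x = (\<chi> i. if i = i1 then k x else G1 x $ \<tau> i)" for x
  have hCk: "Ck_on m Q1 h" for m
    unfolding h_def
  proof (rule Ck_on_vec_lambda[OF _ 1(4)])
    have "Ck_on m Q1 k" using V(3) Q1V unfolding smooth_on_def by (blast intro: Ck_on_subset)
    moreover have "Ck_on m Q1 (\<lambda>x. G1 x $ \<tau> i)" for i
      using 1(6) by (intro Ck_on_vec_nth 1(4)) (simp add: smooth_on_def)
    ultimately show "Ck_on m Q1 (\<lambda>x. if i = i1 then k x else G1 x $ \<tau> i)" for i
      by (cases "i = i1") simp_all
  qed
  define Dh where "Dh x v = (\<chi> i. if i = i1 then frechet_derivative k (at x) v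
    else inv (frechet_derivative F (at (G1 x))) v $ \<tau> i)" for x v
  have Dh: "(h has_derivative Dh x) (at x)" if x: "x \<in> Q1" for x
    unfolding has_derivative_componentwise_within[of h]
  proof
    fix b :: "real ^ 'n" assume "b \<in> Basis"
    then obtain i where b: "b = axis i 1" by (auto simp: Basis_vec_def)
    have "((\<lambda>x. h x $ i) has_derivative (\<lambda>v. Dh x v $ i)) (at x)"
    proof (cases "i = i1")
      case True
      then show ?thesis using dk[of x] x Q1V by (auto simp: h_def Dh_def)
    next
      case False
      then show ?thesis
        using bounded_linear.has_derivative[OF bounded_linear_vec_nth 1(8)[OF x], of "\<tau> i"]
        by (simp add: h_def Dh_def)
    qed
    then show "((\<lambda>x. h x \<bullet> b) has_derivative (\<lambda>v. Dh x v \<bullet> b)) (at x)"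
      by (simp add: b inner_axis)
  qed
  have Dh_eq: "frechet_derivative h (at x) = Dh x" if "x \<in> Q1" for x
    by (rule frechet_derivative_eqI[OF Dh[OF that]])
  \<comment> \<open>In flow-box coordinates \<open>X\<close> is \<open>axis i0 1\<close>. The
    permutation fixes \<open>i0\<close>, since \<open>i0\<close> differs from both \<open>i1\<close>
    and \<open>j\<close>, and the new coordinate \<open>k\<close> contributes 0.\<close>
  have DhX: "Dh x (X x) = axis i0 1" if x: "x \<in> Q1" for x
  proof -
    have "G1 x \<in> S" using G1P[OF x] 1(2) by blast
    then have "inv (frechet_derivative F (at (G1 x))) (X x) = axis i0 1"
      using DF_e[of "G1 x"] G1P(2)[OF x] 1(7)[OF x] by (metis bij_is_inj inv_f_f)
    moreover have "frechet_derivative k (at x) (X x) = 0" using kX x Q1V by blast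
    ultimately show ?thesis
      using idx ji0 by (auto simp: Dh_def vec_eq_iff axis_def \<tau>_def Transposition.transpose_def)
  qed
  have "inj (Dh x0)"
  proof (rule linear_injective_0[THEN iffD2, rule_format])
    show "linear (Dh x0)" using Dh[OF x0Q1] has_derivative_linear by blast
    fix v assume v: "Dh x0 v = 0"
    obtain w where w: "v = T w" using surjT by blast
    have invF: "inv (frechet_derivative F (at (G1 x0))) v = w"
      unfolding w G1x0 DF0[symmetric] using 1(7)[OF x0Q1] by (simp add: G1x0 bij_is_inj)
    \<comment> \<open>The retained coordinates kill every component of \<open>w\<close> except the
      discarded one; that one is killed by the \<open>k\<close> slot, by the choice of
      \<open>j\<close>.\<close>
    have "w $ m = 0" if "m \<noteq> j" for m
    proof -
      have "\<tau> m \<noteq> i1" "\<tau> (\<tau> m) = m" using that by (auto simp: \<tau>_def Transposition.transpose_def)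
      then show ?thesis using arg_cong[OF v, of "\<lambda>z. z $ \<tau> m"] by (simp add: Dh_def invF)
    qed
    then have wj: "w = (w $ j) *\<^sub>R axis j 1" by (auto simp: vec_eq_iff axis_def)
    have "frechet_derivative k (at x0) v = 0"
      using arg_cong[OF v, of "\<lambda>z. z $ i1"] by (simp add: Dh_def)
    then have "(w $ j) * frechet_derivative k (at x0) (T (axis j 1)) = 0"
      unfolding w by (subst (asm) wj) (simp add: linear_cmul[OF T] linear_cmul[OF link[OF V(4)]])
    then have "w = 0" using j wj by simp
    then show "v = 0" by (simp add: w linear_0[OF T])
  qed
  then have injDh: "inj (frechet_derivative h (at x0))" by (simp only: Dh_eq[OF x0Q1])
  have hsmooth: "smooth_on Q1 h" using hCk by (simp add: smooth_on_def)
  obtain P Q G where 2: "open P" "P \<subseteq> Q1" "x0 \<in> P" "open Q" "homeomorphism P Q h G" "smooth_on Q G"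
    "\<And>y. y \<in> Q \<Longrightarrow> bij (frechet_derivative h (at (G y)))"
    "\<And>y. y \<in> Q \<Longrightarrow> (G has_derivative inv (frechet_derivative h (at (G y)))) (at y)"
    by (rule smooth_inverse_function[OF 1(4) hsmooth x0Q1 injDh]) (rule that)
  show ?thesis
  proof (rule that[OF 2(1) _ 2(3,4,5) _ 2(6)])
    show "P \<subseteq> V" using 2(2) Q1V by blast
    show "smooth_on P h" using Ck_on_subset[OF hCk 2(2)] by (simp add: smooth_on_def)
    show "h x $ i1 = k x" for x by (simp add: h_def)
    fix y assume y: "y \<in> Q"
    then have "G y \<in> P" using 2(5) by (auto simp: homeomorphism_def)
    then have Gy: "G y \<in> Q1" using 2(2) by blast
    \<comment> \<open>The derivative of \<open>G\<close> inverts \<open>Dh (G y)\<close>, and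
      \<open>DhX\<close> says which vector is sent to \<open>axis i0 1\<close>.\<close>
    have "frechet_derivative G (at y) (axis i0 1) = inv (Dh (G y)) (Dh (G y) (X (G y)))"
      unfolding frechet_derivative_eqI[OF 2(8)[OF y]] Dh_eq[OF Gy] DhX[OF Gy] ..
    then show "frechet_derivative G (at y) (axis i0 1) = X (G y)"
      using 2(7)[OF y] by (simp add: Dh_eq[OF Gy] bij_is_inj)
  qed
qed

lemma smooth_on_compose:
  fixes f :: "'a::real_normed_vector \<Rightarrow> 'b::euclidean_space" and g :: "'b \<Rightarrow> 'c::real_normed_vector"
  shows "smooth_on T g \<Longrightarrow> smooth_on S f \<Longrightarrow> f ` S \<subseteq> T \<Longrightarrow> open S \<Longrightarrow> smooth_on S (\<lambda>x. g (f x))"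
  unfolding smooth_on_def using Ck_on_compose by blast

lemma smooth_on_subset: "smooth_on S f \<Longrightarrow> T \<subseteq> S \<Longrightarrow> smooth_on T f"
  unfolding smooth_on_def using Ck_on_subset by blast

lemma smooth_on_congI:
  "smooth_on S g \<Longrightarrow> open S \<Longrightarrow> (\<And>x. x \<in> S \<Longrightarrow> f x = g x) \<Longrightarrow> smooth_on S f"
  unfolding smooth_on_def using Ck_on_congI by blast

section \<open>New charts from local diffeomorphisms, and the metric as a Lorentz form in a
  chart\<close>

context manifold begin

text \<open>Composing a chart with a diffeomorphism between open sets gives a map whose transitions
  to all charts are smooth in both directions; maximality of the atlas then makes it a
  member.\<close>

lemma coordinate_change:
  assumes c: "c \<in> atl" and P: "open P" "P \<subseteq> snd c ` fst c" and Q: "open Q"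
    and hG: "homeomorphism P Q h G" "smooth_on P h" "smooth_on Q G"
  obtains d where "d \<in> atl" "fst d = {q \<in> fst c. snd c q \<in> P}" "snd d = h \<circ> snd c" "snd d ` fst d = Q"
    "\<And>y. y \<in> Q \<Longrightarrow> chart_inv d y = chart_inv c (G y)"
proof -
  define D where "D = {q \<in> fst c. snd c q \<in> P}"
  define d where "d = (D, h \<circ> snd c)"
  have fd: "fst d = D" and sd: "snd d = h \<circ> snd c" by (simp_all add: d_def)
  have D: "open D" unfolding D_def by (rule chart_preimage_open[OF c P(1)])
  have Gh: "G (h x) = x" "h x \<in> Q" if "x \<in> P" for x using hG(1) that by (auto simp: homeomorphism_def)
  have hGy: "h (G y) = y" "G y \<in> P" if "y \<in> Q" for y using hG(1) that by (auto simp: homeomorphism_def)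
  have inj: "inj_on (snd d) D"
  proof (rule inj_onI)
    fix q q' assume q: "q \<in> D" "q' \<in> D" "snd d q = snd d q'"
    then have "snd c q = snd c q'" using Gh(1) unfolding sd D_def o_def by (metis (no_types, lifting) mem_Collect_eq)
    then show "q = q'" using q chart_inv_left[OF c] unfolding D_def by (metis (no_types, lifting) mem_Collect_eq)
  qed
  have GD: "chart_inv c (G y) \<in> D" "snd c (chart_inv c (G y)) = G y" if "y \<in> Q" for y
    using hGy(2)[OF that] P(2) chart_inv_mem[OF c] chart_inv_right[OF c] by (auto simp: D_def)
  have inv: "chart_inv d y = chart_inv c (G y)" if y: "y \<in> Q" for y
  proof -
    have "snd d (chart_inv c (G y)) = y" using GD(2)[OF y] hGy(1)[OF y] by (simp add: sd)
    then show ?thesis unfolding chart_inv_def[of d] fd using inv_into_f_eq[OF inj GD(1)[OF y]] by simp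
  qed
  have image: "snd d ` D = Q"
  proof
    show "snd d ` D \<subseteq> Q" using Gh(2) by (auto simp: sd D_def)
    show "Q \<subseteq> snd d ` D"
    proof
      fix y assume y: "y \<in> Q"
      then have "y = snd d (chart_inv c (G y))" using GD(2) hGy(1) by (simp add: sd)
      then show "y \<in> snd d ` D" using GD(1)[OF y] by blast
    qed
  qed
  have "homeomorphism D Q (snd d) (chart_inv d)"
  proof (rule homeomorphismI)
    have "continuous_on D (snd c)"
      by (rule continuous_on_subset[OF homeomorphism_cont1[OF chart_homeo[OF c]]]) (auto simp: D_def)
    then show "continuous_on D (snd d)"
      unfolding sd by (rule continuous_on_compose[OF _ continuous_on_subset[OF homeomorphism_cont1[OF hG(1)]]])
        (auto simp: D_def)
    have "continuous_on Q (\<lambda>y. chart_inv c (G y))"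
      by (rule continuous_on_compose2[OF homeomorphism_cont2[OF chart_homeo[OF c]] homeomorphism_cont2[OF hG(1)]])
        (use hGy P(2) in auto)
    then show "continuous_on Q (chart_inv d)" by (rule continuous_on_eq) (simp add: inv)
    show "snd d ` D \<subseteq> Q" using image by simp
    show "chart_inv d ` Q \<subseteq> D" using GD(1) by (auto simp: inv)
    show "chart_inv d (snd d q) = q" if "q \<in> D" for q
      unfolding chart_inv_def fd by (rule inv_into_f_f[OF inj that])
    show "snd d (chart_inv d y) = y" if "y \<in> Q" for y
      using GD(2)[OF that] hGy(1)[OF that] by (simp add: inv[OF that] sd)
  qed
  then have chart: "is_chart d" using D Q by (simp add: is_chart_def fd image)
  have "compatible d e" if e: "e \<in> atl" for e
    unfolding compatible_def
  proof
    have S1: "snd d ` (fst d \<inter> fst e) = G -` (snd c ` (fst c \<inter> fst e)) \<inter> Q"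
    proof (rule set_eqI)
      fix y
      show "y \<in> snd d ` (fst d \<inter> fst e) \<longleftrightarrow> y \<in> G -` (snd c ` (fst c \<inter> fst e)) \<inter> Q"
      proof
        assume "y \<in> snd d ` (fst d \<inter> fst e)"
        then obtain q where "q \<in> D" "q \<in> fst e" "y = h (snd c q)" by (auto simp: fd sd)
        then show "y \<in> G -` (snd c ` (fst c \<inter> fst e)) \<inter> Q" using Gh by (auto simp: D_def)
      next
        assume y: "y \<in> G -` (snd c ` (fst c \<inter> fst e)) \<inter> Q"
        then have "chart_inv c (G y) \<in> fst e" using chart_image_iff[OF c] by auto
        moreover have "y = snd d (chart_inv c (G y))" using y GD(2) hGy(1) by (simp add: sd)
        moreover have "chart_inv c (G y) \<in> fst d" using y GD(1) by (simp add: fd)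
        ultimately show "y \<in> snd d ` (fst d \<inter> fst e)" by blast
      qed
    qed
    have oS1: "open (snd d ` (fst d \<inter> fst e))"
      unfolding S1
      using continuous_on_open_vimage[OF Q, of G] homeomorphism_cont2[OF hG(1)]
        chart_image_open[OF c chart_open(1)[OF e]] by auto
    show "smooth_on (snd d ` (fst d \<inter> fst e)) (transition d e)"
    proof (rule smooth_on_congI[OF _ oS1])
      show "smooth_on (snd d ` (fst d \<inter> fst e)) (\<lambda>y. transition c e (G y))"
        by (rule smooth_on_compose[OF smooth_transition[OF c e] smooth_on_subset[OF hG(3)] _ oS1])
          (auto simp: S1)
      show "transition d e y = transition c e (G y)" if "y \<in> snd d ` (fst d \<inter> fst e)" for y
        using that by (simp add: S1 transition_def inv)
    qed
    have oS2: "open (snd e ` (fst d \<inter> fst e))"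
      using chart_image_open[OF e D] by (simp add: fd Int_commute)
    show "smooth_on (snd e ` (fst d \<inter> fst e)) (transition e d)"
    proof (rule smooth_on_congI[OF _ oS2])
      show "smooth_on (snd e ` (fst d \<inter> fst e)) (\<lambda>x. h (transition e c x))"
      proof (rule smooth_on_compose[OF hG(2) smooth_on_subset[OF smooth_transition[OF e c]] _ oS2])
        show "snd e ` (fst d \<inter> fst e) \<subseteq> snd e ` (fst e \<inter> fst c)" by (auto simp: fd D_def)
        show "transition e c ` snd e ` (fst d \<inter> fst e) \<subseteq> P"
          by (auto simp: fd D_def transition_apply[OF e])
      qed
    qed (simp add: transition_def sd)
  qed
  then have "d \<in> atl" using chart smooth_atl unfolding smooth_structure_def by blast
  then show ?thesis using that[of d] inv image by (simp add: fd sd D_def)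
qed

lemma cone_closure_mem:
  assumes "(q, v) \<in> cone_closure atl A"
  shows "v \<in> tangent_space atl q" "v \<noteq> (\<lambda>_. 0)"
proof -
  have "(q, v) \<in> slit_bundle atl"
    using assms unfolding cone_closure_def in_closure_of topspace_slit by blast
  then show "v \<in> tangent_space atl q" "v \<noteq> (\<lambda>_. 0)"
    by (auto simp: slit_bundle_def tangent_bundle_def)
qed

text \<open>Reading components in \<open>c\<close> turns the metric into a form on a coordinate
  space and the orthonormal basis of the signature into a spanning family there, so the linear
  algebra of \<open>lorentz_form\<close> applies.\<close>

lemma lorentz_form_in_chart:
  assumes ext: "\<exists>F. local_extension atl A L (q, \<nu>) F" and \<nu>: "\<nu> \<in> tangent_space atl q"
    and lor: "lorentz_signature atl q (fundamental_tensor atl A L (q, \<nu>))"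
    and c: "c \<in> atl" "q \<in> fst c"
  obtains B E i0 where "lorentz_form B (E :: 'n \<Rightarrow> real ^ 'n) i0"
    "\<And>u w. u \<in> tangent_space atl q \<Longrightarrow> w \<in> tangent_space atl q \<Longrightarrow>
      fundamental_tensor atl A L (q, \<nu>) u w = B (u c) (w c)"
proof -
  obtain B where "bilinear B" and B: "\<forall>u w. u \<in> tangent_space atl q \<longrightarrow> w \<in> tangent_space atl q \<longrightarrow>
      fundamental_tensor atl A L (q, \<nu>) u w = B (u c) (w c)"
    by (rule fundamental_tensor_bilinear[OF ext c \<nu>]) blast
  obtain e :: "'n \<Rightarrow> ('m, 'n) tvec" and i0 where e: "\<forall>i. e i \<in> tangent_space atl q"
      "\<forall>u \<in> tangent_space atl q. \<exists>!a :: 'n \<Rightarrow> real. u = (\<lambda>c. \<Sum>i\<in>UNIV. a i *\<^sub>R e i c)"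
      "\<forall>i j. fundamental_tensor atl A L (q, \<nu>) (e i) (e j) = (if i = j then if i = i0 then 1 else - 1 else 0)"
    using lor unfolding lorentz_signature_def by blast
  have "lorentz_form B (\<lambda>i. e i c) i0"
  proof
    show "bilinear B" by fact
    show "B (e i c) (e j c) = (if i = j then if i = i0 then 1 else - 1 else 0)" for i j
      using e(1,3) B by metis
    fix \<xi>
    obtain a where a: "vec_of_comps atl c q \<xi> = (\<lambda>c. \<Sum>i\<in>UNIV. a i *\<^sub>R e i c)"
      using e(2) vec_of_comps_tangent[OF c, of \<xi>] by blast
    have "\<xi> = (\<Sum>i\<in>UNIV. a i *\<^sub>R e i c)"
      using fun_cong[OF a, of c] by (simp add: vec_of_comps_self[OF c])
    then show "\<exists>a. \<xi> = (\<Sum>i\<in>UNIV. a i *\<^sub>R e i c)" by blast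
  qed
  then show ?thesis by (rule that) (use B in blast)
qed

end

text \<open>A nonzero combination of the basis vectors 2 and 3 is orthogonal to the null vector
  \<open>axis 0 1\<close> without being a multiple of it, so
  \<open>negative_on_null_orthogonal\<close> applies; the quadratic form in its coefficients is the
  value of \<open>B\<close> on it.\<close>

lemma positive_definite_2_3:
  assumes "lorentz_form B E i0" "B (axis 0 1) (axis 0 1) = 0"
    "B (axis 0 1) (axis 2 1) = 0" "B (axis 0 1) (axis 3 1) = 0"
  shows "positive_definite_on {2, 3 :: 4} (\<lambda>i j. - B (axis i 1) (axis j 1 :: real ^ 4))"
proof -
  interpret lorentz_form B E i0 by fact
  have l: "linear (B x)" "linear (\<lambda>x. B x y)" for x y using bilinear by (auto simp: bilinear_def)
  have "0 < (\<Sum>i\<in>{2, 3 :: 4}. \<Sum>j\<in>{2, 3}. a i * - B (axis i 1) (axis j 1) * a j)"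
    if a: "\<exists>i\<in>{2, 3}. a i \<noteq> 0" for a :: "4 \<Rightarrow> real"
  proof -
    define w :: "real ^ 4" where "w = a 2 *\<^sub>R axis 2 1 + a 3 *\<^sub>R axis 3 1"
    have w: "w $ 2 = a 2" "w $ 3 = a 3"
      using index_4_distinct by (auto simp: w_def axis_def)
    have "B w w < 0"
    proof (rule negative_on_null_orthogonal[of "axis 0 1"])
      show "B (axis 0 1) w = 0"
        by (simp add: w_def linear_add[OF l(1)] linear_cmul[OF l(1)] assms(3,4))
      show "w \<noteq> k *\<^sub>R axis 0 1" for k
      proof
        assume "w = k *\<^sub>R axis 0 1"
        then have "w $ 2 = 0" "w $ 3 = 0" using index_4_distinct by (auto simp: axis_def)
        then show False using a w by auto
      qed
    qed (use assms(2) in \<open>auto simp: axis_eq_0_iff\<close>)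
    moreover have "B w w = (\<Sum>i\<in>{2, 3 :: 4}. \<Sum>j\<in>{2, 3}. a i * B (axis i 1) (axis j 1) * a j)"
      unfolding w_def using index_4_distinct
      by (simp add: linear_add[OF l(1)] linear_add[OF l(2)] linear_cmul[OF l(1)] linear_cmul[OF l(2)]
          algebra_simps)
    ultimately show ?thesis by (simp add: sum_negf)
  qed
  then show ?thesis using symmetric unfolding positive_definite_on_def by simp
qed

text \<open>In signature \<open>(+, -, -, -)\<close> the block of the metric transverse to
  \<open>N\<close> is negative definite, so definiteness is expressed for \<open>- g i j\<close>.
  The form holds at every point of the chart, since \<open>N\<close> is straightened and
  \<open>f\<close> is a coordinate on the whole chart.\<close>

theorem lemma3:
  fixes atl :: "('m::{t2_space, second_countable_topology}, 4) chart set"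
    and A :: "('m \<times> ('m, 4) tvec) set"
    and L :: "'m \<times> ('m, 4) tvec \<Rightarrow> real"
    and U :: "'m set" and f :: "'m \<Rightarrow> real" and N :: "'m \<Rightarrow> ('m, 4) tvec" and p :: 'm
  assumes "finsler_spacetime atl A L"
    and "open U" and "smooth_fun atl U f"
    and "is_gradient atl A L U f N"
    and "lightlike_field atl A L U N"
    and "p \<in> U"
  shows "\<exists>c\<in>atl. p \<in> fst c \<and> fst c \<subseteq> U \<and>
    (\<forall>q\<in>fst c. let g = metric_component atl A L N c q in
       g 0 0 = 0 \<and> g 0 1 = 1 \<and> g 0 2 = 0 \<and> g 0 3 = 0 \<and>
       g 1 0 = 1 \<and> g 2 0 = 0 \<and> g 3 0 = 0 \<and>
       positive_definite_on {2, 3} (\<lambda>i j. - g i j))"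
proof -
  have sm: "smooth_structure atl" and cone: "cone_domain atl A"
    and ext_all: "\<And>v. v \<in> cone_closure atl A \<Longrightarrow> \<exists>F. local_extension atl A L v F"
    and hom: "\<And>q u r. 0 < r \<Longrightarrow> (q, u) \<in> cone_closure atl A \<Longrightarrow>
      L (q, \<lambda>c. r *\<^sub>R u c) = r\<^sup>2 * L (q, u)"
    and lor_all: "\<And>v. v \<in> cone_closure atl A \<Longrightarrow>
      lorentz_signature atl (fst v) (fundamental_tensor atl A L v)"
    using assms(1) unfolding finsler_spacetime_def by blast+
  interpret manifold atl by unfold_locales (rule sm)
  have conic: "dilate r v \<in> A" if "v \<in> A" "0 < r" for v r
  proof -
    obtain q u where "v = (q, u)" by fastforce
    then show ?thesis using cone that unfolding cone_domain_def dilate_def by auto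
  qed
  have N: "(q, N q) \<in> cone_closure atl A" "L (q, N q) = 0" if "q \<in> U" for q
    using assms(5) that unfolding lightlike_field_def by auto
  have ext: "\<exists>F. local_extension atl A L (q, N q) F" if "q \<in> U" for q
    by (rule ext_all[OF N(1)[OF that]])
  have Nt: "N q \<in> tangent_space atl q" "N q \<noteq> (\<lambda>_. 0)" if "q \<in> U" for q
    using cone_closure_mem[OF N(1)[OF that]] by auto
  have lor: "lorentz_signature atl q (fundamental_tensor atl A L (q, N q))" if "q \<in> U" for q
    using lor_all[OF N(1)[OF that]] by simp
  have grad: "fundamental_tensor atl A L (q, N q) (N q) u = differential atl f q u"
    if "q \<in> U" "u \<in> tangent_space atl q" for q u
    by (rule gradient_eq[OF assms(4) that])
  have null: "fundamental_tensor atl A L (q, N q) (N q) (N q) = 0" if q: "q \<in> U" for q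
  proof (rule fundamental_tensor_null[OF ext[OF q] Nt(1)[OF q]])
    fix r :: real assume r: "0 < r"
    have "dilate r (q, N q) \<in> cone_closure atl A"
      by (rule cone_closure_dilate[OF conic N(1)[OF q] r])
    moreover have "L (dilate r (q, N q)) = 0"
      using hom[OF r N(1)[OF q]] N(2)[OF q] by (simp add: dilate_def)
    ultimately show "dilate r (q, N q) \<in> cone_closure atl A \<and> L (dilate r (q, N q)) = 0" ..
  qed

  obtain c where c: "c \<in> atl" "p \<in> fst c" by (rule ex_chart)
  define V where "V = snd c ` (fst c \<inter> U)"
  define X where "X x = N (chart_inv c x) c" for x
  define k where "k = f \<circ> chart_inv c"
  have V: "open V" unfolding V_def by (rule chart_image_open[OF c(1) assms(2)])
  have VD: "chart_inv c x \<in> fst c" "chart_inv c x \<in> U" "snd c (chart_inv c x) = x" if "x \<in> V" for x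
    using that by (auto simp: V_def chart_inv_left[OF c(1)])
  have X: "smooth_on V X"
    using assms(5) c(1) unfolding lightlike_field_def vector_field_def V_def X_def by blast
  have k: "smooth_on V k"
    using assms(3) c(1) unfolding smooth_fun_def V_def k_def by blast
  have pV: "snd c p \<in> V" using c(2) assms(6) by (auto simp: V_def)
  have inv_p: "chart_inv c (snd c p) = p" by (rule chart_inv_left[OF c])
  have dk: "frechet_derivative k (at x) (u c) = differential atl f (chart_inv c x) u"
    if "x \<in> V" "u \<in> tangent_space atl (chart_inv c x)" for x u
    using differential_eq[OF assms(3) VD(2)[OF that(1)] c(1) VD(1)[OF that(1)] that(2)]
    by (simp add: k_def VD(3)[OF that(1)])
  have X0: "X (snd c p) \<noteq> 0"
    using Nt[OF assms(6)] tangent_eq_vec_of_comps[OF Nt(1)[OF assms(6)] c]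
      vec_of_comps_nonzero[OF c] by (metis X_def inv_p)
  have kX: "frechet_derivative k (at x) (X x) = 0" if "x \<in> V" for x
    unfolding X_def using dk[OF that Nt(1)[OF VD(2)[OF that]]]
      grad[OF VD(2)[OF that] Nt(1)[OF VD(2)[OF that]]] null[OF VD(2)[OF that]] by simp
  \<comment> \<open>If \<open>df\<close> vanished at \<open>p\<close>, then \<open>g(N, u)\<close>
    would vanish for all \<open>u\<close>, and nondegeneracy would force \<open>N = 0\<close>, which
    is excluded because the closure is taken without the zero section.\<close>
  have "\<exists>v. frechet_derivative k (at (snd c p)) v \<noteq> 0"
  proof (rule ccontr)
    assume "\<not> ?thesis"
    then have zero: "frechet_derivative k (at (snd c p)) v = 0" for v by blast
    obtain B i0 and E :: "4 \<Rightarrow> real ^ 4" where lf: "lorentz_form B E i0"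
      and B: "\<And>u w. u \<in> tangent_space atl p \<Longrightarrow> w \<in> tangent_space atl p \<Longrightarrow>
        fundamental_tensor atl A L (p, N p) u w = B (u c) (w c)"
      by (rule lorentz_form_in_chart[OF ext[OF assms(6)] Nt(1)[OF assms(6)] lor[OF assms(6)] c]) (rule that)
    have "B (N p c) y = 0" for y
    proof -
      have t: "vec_of_comps atl c p y \<in> tangent_space atl p" by (rule vec_of_comps_tangent[OF c])
      have "B (N p c) (vec_of_comps atl c p y c) = differential atl f p (vec_of_comps atl c p y)"
        using B[OF Nt(1)[OF assms(6)] t] grad[OF assms(6) t] by simp
      also have "\<dots> = 0" using dk[OF pV, of "vec_of_comps atl c p y"] t zero by (simp add: inv_p)
      finally show ?thesis by (simp add: vec_of_comps_self[OF c])
    qed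
    then have "N p c = 0" by (rule lorentz_form.nondegenerate[OF lf])
    then show False using X0 by (simp add: X_def inv_p)
  qed
  then obtain v0 where v0: "frechet_derivative k (at (snd c p)) v0 \<noteq> 0" ..

  obtain P Q and h G :: "real ^ 4 \<Rightarrow> real ^ 4" where P: "open P" "P \<subseteq> V" "snd c p \<in> P" and Q: "open Q" and hG: "homeomorphism P Q h G"
    "smooth_on P h" "smooth_on Q G" and h1: "\<And>x. x \<in> P \<Longrightarrow> h x $ 1 = k x"
    and GX: "\<And>y. y \<in> Q \<Longrightarrow> frechet_derivative G (at y) (axis 0 1) = X (G y)"
    by (rule straightening[OF V X k pV X0 v0 kX index_4_distinct(1)], assumption) (rule that; assumption)
  have Pc: "P \<subseteq> snd c ` fst c" using P(2) by (auto simp: V_def)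
  obtain d where d: "d \<in> atl" "fst d = {q \<in> fst c. snd c q \<in> P}" "snd d = h \<circ> snd c" "snd d ` fst d = Q"
    and inv_d: "\<And>y. y \<in> Q \<Longrightarrow> chart_inv d y = chart_inv c (G y)"
    by (rule coordinate_change[OF c(1) P(1) Pc Q hG]) (rule that)
  have dU: "q \<in> U" "q \<in> fst c" "snd d q \<in> Q" "G (snd d q) = snd c q" if "q \<in> fst d" for q
  proof -
    have q: "q \<in> fst c" "snd c q \<in> P" using that d(2) by auto
    then show "q \<in> fst c" "q \<in> U" using P(2) VD(2) chart_inv_left[OF c(1)] by (blast, metis subsetD)
    show "snd d q \<in> Q" using that d(4) by blast
    show "G (snd d q) = snd c q" using q(2) hG(1) by (simp add: d(3) homeomorphism_def)
  qed
  have GP: "G y \<in> P" "h (G y) = y" if "y \<in> Q" for y using hG(1) that by (auto simp: homeomorphism_def)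

  have comps: "coord_vec atl d i q d = axis i 1" "coord_vec atl d i q \<in> tangent_space atl q"
    if "q \<in> fst d" for i q
    unfolding coord_vec_def
    by (rule vec_of_comps_self[OF d(1) that], rule vec_of_comps_tangent[OF d(1) that])
  \<comment> \<open>The transition from \<open>d\<close> to \<open>c\<close> is \<open>G\<close> on
    \<open>Q\<close>, so the derivative of \<open>G\<close> along \<open>axis 0 1\<close> gives the
    components of the coordinate vector in \<open>c\<close>. These are the components of
    \<open>N\<close>, and components in one chart determine a tangent vector.\<close>
  have N_eq: "coord_vec atl d 0 q = N q" if q: "q \<in> fst d" for q
  proof -
    have "(G has_derivative frechet_derivative G (at (snd d q))) (at (snd d q))"
      by (rule smooth_onD[OF hG(3) dU(3)[OF q]])
    then have "(transition d c has_derivative frechet_derivative G (at (snd d q))) (at (snd d q))"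
      by (rule has_derivative_transform_within_open[OF _ Q dU(3)[OF q]])
        (simp add: transition_def inv_d VD(3)[OF subsetD[OF P(2) GP(1)]])
    then have "jac d c q = frechet_derivative G (at (snd d q))"
      unfolding jac_def by (rule frechet_derivative_eqI)
    then have "coord_vec atl d 0 q c = N q c"
      using GX[OF dU(3)[OF q]] vec_of_comps_apply[OF c(1) dU(2)[OF q]]
      by (simp add: coord_vec_def X_def dU(4)[OF q] chart_inv_left[OF c(1) dU(2)[OF q]])
    then show ?thesis
      using tangent_eq_vec_of_comps[OF comps(2)[OF q] c(1) dU(2)[OF q]]
        tangent_eq_vec_of_comps[OF Nt(1)[OF dU(1)[OF q]] c(1) dU(2)[OF q]] by metis
  qed
  \<comment> \<open>In the new chart \<open>f\<close> is the coordinate function with index 1, hence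
    its own derivative.\<close>
  have df: "differential atl f q (coord_vec atl d i q) = (if i = 1 then 1 else 0)" if q: "q \<in> fst d" for i q
  proof -
    have "((\<lambda>y. y $ 1) has_derivative (\<lambda>v. v $ 1)) (at (snd d q))"
      by (rule bounded_linear.has_derivative[OF bounded_linear_vec_nth has_derivative_ident])
    then have "((f \<circ> chart_inv d) has_derivative (\<lambda>v. v $ 1)) (at (snd d q))"
    proof (rule has_derivative_transform_within_open[OF _ Q dU(3)[OF q]])
      fix y assume y: "y \<in> Q"
      show "y $ 1 = (f \<circ> chart_inv d) y" using h1[OF GP(1)[OF y]] GP(2)[OF y] by (simp add: inv_d[OF y] k_def)
    qed
    from frechet_derivative_eqI[OF this] show ?thesis
      using differential_eq[OF assms(3) dU(1)[OF q] d(1) q comps(2)[OF q], of i]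
      by (simp add: comps(1)[OF q] axis_def)
  qed
  have "let g = metric_component atl A L N d q in
       g 0 0 = 0 \<and> g 0 1 = 1 \<and> g 0 2 = 0 \<and> g 0 3 = 0 \<and>
       g 1 0 = 1 \<and> g 2 0 = 0 \<and> g 3 0 = 0 \<and>
       positive_definite_on {2, 3} (\<lambda>i j. - g i j)" if q: "q \<in> fst d" for q
  proof -
    obtain B i0 and E :: "4 \<Rightarrow> real ^ 4" where lf: "lorentz_form B E i0"
      and B: "\<And>u w. u \<in> tangent_space atl q \<Longrightarrow> w \<in> tangent_space atl q \<Longrightarrow>
        fundamental_tensor atl A L (q, N q) u w = B (u d) (w d)"
      by (rule lorentz_form_in_chart[OF ext[OF dU(1)[OF q]] Nt(1)[OF dU(1)[OF q]] lor[OF dU(1)[OF q]] d(1) q])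
        (rule that)
    have g: "metric_component atl A L N d q i j = B (axis i 1) (axis j 1)" for i j
      unfolding metric_component_def using B[OF comps(2)[OF q] comps(2)[OF q]] by (simp add: comps(1)[OF q])
    have g0: "metric_component atl A L N d q 0 j = (if j = 1 then 1 else 0)" for j
      unfolding metric_component_def N_eq[OF q]
      using grad[OF dU(1)[OF q] comps(2)[OF q]] df[OF q] by simp
    have sym: "metric_component atl A L N d q i 0 = metric_component atl A L N d q 0 i" for i
      unfolding g by (rule lorentz_form.symmetric[OF lf])
    have "positive_definite_on {2, 3} (\<lambda>i j. - metric_component atl A L N d q i j)"
      unfolding g by (rule positive_definite_2_3[OF lf]) (use g0 index_4_distinct in \<open>simp_all add: g\<close>)
    then show ?thesis using g0 sym index_4_distinct by (simp add: Let_def)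
  qed
  moreover have "p \<in> fst d" using d(2) c(2) P(3) by simp
  moreover have "fst d \<subseteq> U" using dU(1) by blast
  ultimately show ?thesis using d(1) by blast
qed

end
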